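(* Let $(V,\sigma)$ be a braided vector space over $\mathbb{C}$ with basis $\{v_1,\ldots,v_N\}$, and let $\mathcal{A}(\sigma)$ be the associated FRT algebra with generators $T^i_j$. The quantum exterior algebra $\bigwedge_\sigma V$ is a right $\mathcal{A}(\sigma)$-comodule algebra whose comodule structure map on the component $\bigwedge_\sigma^k V$ is given by $$\rho^{\times k}\big(A^{(k)}(v_{i_1}\otimes \cdots\otimes v_{i_k})\big)=\sum_{1\leq j_1,\ldots,j_k\leq N}A^{(k)}(v_{j_1}\otimes \cdots\otimes v_{j_k})\otimes T_{i_1}^{j_1}\cdots T_{i_k}^{j_k}.$$
   Context: Everything is over $\mathbb{C}$. Let $(n)_\nu=\frac{1-\nu^n}{1-\nu}$, $(n)_\nu!=(1)_\nu\cdots(n)_\nu$, $(0)_\nu!=1$. Fix $q\in\mathbb{C}$ nonzero with $q^{-2}$ not a root of unity (so $(n)_{q^{-2}}\ne 0$ for all $n\ge1$, and $q^2\neq -1$). A braiding on $V$ is an invertible $\sigma\in\mathrm{End}(V\otimes V)$ with $(\sigma\otimes I)(I\otimes\sigma)(\sigma\otimes I)=(I\otimes\sigma)(\sigma\otimes I)(I\otimes\sigma)$, where $I=\mathrm{id}_V$. On $V^{\otimes n}$ put $\sigma_i=\mathrm{id}_{V^{\otimes (i-1)}}\otimes\sigma\otimes \mathrm{id}_{V^{\otimes (n-i-1)}}$; for $w\in\mathfrak{S}_n$ with reduced expression $w=s_{i_1}\cdots s_{i_l}$ ($s_i$ the transposition of $i,i+1$; permutations compose as functions) put $\sigma_w=\sigma_{i_1}\cdots\sigma_{i_l}$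 (independent of the reduced expression). $l(w)$ is the length of $w$. $\mathfrak{S}_{m,n}$ is the set of $w\in\mathfrak{S}_{m+n}$ with $w(1)<\cdots<w(m)$ and $w(m+1)<\cdots<w(m+n)$. The quantum shuffle product on $T(V)$ is, for $x\in V^{\otimes m}$, $y\in V^{\otimes n}$, $$x\odot_\sigma y=\frac{(m)_{q^{-2}}!\,(n)_{q^{-2}}!}{(m+n)_{q^{-2}}!}\sum_{w\in\mathfrak{S}_{m,n}}(-q)^{-l(w)}\sigma_{w}(x\otimes y)$$ (scalar multiplication if $m$ or $n$ is $0$). The quantum exterior algebra $\bigwedge_\sigma V=\bigoplus_k\bigwedge_\sigma^kV$ is the graded subalgebra of $(T(V),\odot_\sigma)$ generated by $V$. With $A^{(1)}=I$ and $A^{(k)}=\frac{1}{(k)_{q^{-2}}!}\sum_{w\in\mathfrak{S}_k}(-q)^{-l(w)}\sigma_w$, one has $\bigwedge_\sigma^kV=\mathrm{Im}A^{(k)}\subset V^{\otimes k}$ for $k\ge1$ and $\bigwedge_\sigma^0V=\mathbb{C}$. Write $\sigma(v_i\otimes v_j)=\sum_{k,l}\sigma_{ij}^{kl}v_k\otimes v_l$. The FRT algebra $\mathcal{A}(\sigma)$ is the unital associative algebra generated by $\{T^i_j\}_{1\le i,j\le N}$ subject to $\sum_{k,l}\sigma_{ij}^{kl}T^m_kT^n_l=\sum_{k,l}T^k_iT^l_j\sigma_{kl}^{mn}$ for all $i,j,m,n$; it is a bialgebra with coproduct $T^i_j\mapsto\sum_kT^i_k\otimes T^k_j$ and counit $T^i_j\mapsto\delta^i_j$.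 The canonical right comodule structure on $V$ is $\rho:V\to V\otimes\mathcal{A}(\sigma)$, $\rho(v_i)=\sum_{j=1}^Nv_j\otimes T^j_i$. The map $\rho^{\times k}:V^{\otimes k}\to V^{\otimes k}\otimes\mathcal{A}(\sigma)$ is the tensor comodule structure, $\rho^{\times k}(v_{i_1}\otimes\cdots\otimes v_{i_k})=\sum_{j_1,\ldots,j_k}v_{j_1}\otimes\cdots\otimes v_{j_k}\otimes T^{j_1}_{i_1}\cdots T^{j_k}_{i_k}$. In degree $0$ the comodule map sends $1\mapsto1\otimes1$. *)

theory Defs
  imports
    Complex_Main
    "HOL-Library.Poly_Mapping"
    "HOL-Combinatorics.Permutations"
    "HOL-Algebra.QuotRing"
    "HOL-Algebra.Module"
begin

section \<open>Free vector spaces and free algebras over the complex numbers\<close>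

text \<open>
  The type \<open>'a \<Rightarrow>\<^sub>0 complex\<close> is the complex vector space with basis \<open>'a\<close>. For lists (the free
  monoid, written additively) the convolution product of \<open>Poly_Mapping\<close> makes
  \<open>'a list \<Rightarrow>\<^sub>0 complex\<close> the free algebra on \<open>'a\<close>.
\<close>

instantiation list :: (type) monoid_add
begin
definition zero_list_def: "0 = []"
definition plus_list_def: "xs + ys = xs @ ys"
instance by standard (simp_all add: zero_list_def plus_list_def)
end

definition cscale :: "complex \<Rightarrow> ('a \<Rightarrow>\<^sub>0 complex) \<Rightarrow> ('a \<Rightarrow>\<^sub>0 complex)" where
  "cscale c = Poly_Mapping.map ((*) c)"

lemma lookup_cscale [simp]: "Poly_Mapping.lookup (cscale c p) x = c * Poly_Mapping.lookup p x"
  by (simp add: cscale_def map.rep_eq when_def)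

global_interpretation pm: vector_space cscale
  by standard (auto intro!: poly_mapping_eqI simp: lookup_add algebra_simps)

abbreviation basis_vec :: "'a \<Rightarrow> ('a \<Rightarrow>\<^sub>0 complex)" where
  "basis_vec x \<equiv> Poly_Mapping.single x 1"

definition lin_ext :: "('a \<Rightarrow> 'b \<Rightarrow>\<^sub>0 complex) \<Rightarrow> ('a \<Rightarrow>\<^sub>0 complex) \<Rightarrow> ('b \<Rightarrow>\<^sub>0 complex)" where
  "lin_ext f p = (\<Sum>x\<in>Poly_Mapping.keys p. cscale (Poly_Mapping.lookup p x) (f x))"

definition free_algebra :: "(complex, 'a list \<Rightarrow>\<^sub>0 complex) module" where
  "free_algebra = \<lparr>carrier = UNIV, mult = (*), one = 1, zero = 0, add = (+), smult = cscale\<rparr>"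


section \<open>Unital associative algebras over the complex numbers\<close>

text \<open>The complex numbers, both as base ring and as an algebra over themselves.\<close>

definition complex_alg :: "(complex, complex) module" where
  "complex_alg = \<lparr>carrier = UNIV, mult = (*), one = 1, zero = 0, add = (+), smult = (*)\<rparr>"

text \<open>The locale \<open>algebra\<close> of the library requires commutativity.\<close>

locale complex_algebra = Module.module complex_alg A + ring A for A (structure) +
  assumes smult_mult_left:
      "\<lbrakk>x \<in> carrier A; y \<in> carrier A\<rbrakk> \<Longrightarrow> (c \<odot>\<^bsub>A\<^esub> x) \<otimes>\<^bsub>A\<^esub> y = c \<odot>\<^bsub>A\<^esub> (x \<otimes>\<^bsub>A\<^esub> y)"
    and smult_mult_right:
      "\<lbrakk>x \<in> carrier A; y \<in> carrier A\<rbrakk> \<Longrightarrow> x \<otimes>\<^bsub>A\<^esub> (c \<odot>\<^bsub>A\<^esub> y) = c \<odot>\<^bsub>A\<^esub> (x \<otimes>\<^bsub>A\<^esub> y)"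

definition alg_hom :: "(complex, 'a) module \<Rightarrow> (complex, 'b) module \<Rightarrow> ('a \<Rightarrow> 'b) set" where
  "alg_hom A B = {f \<in> ring_hom A B. \<forall>c. \<forall>x\<in>carrier A. f (c \<odot>\<^bsub>A\<^esub> x) = c \<odot>\<^bsub>B\<^esub> f x}"

definition alg_prod :: "(complex, 'a) module \<Rightarrow> 'a list \<Rightarrow> 'a" where
  "alg_prod A xs = foldr (\<lambda>x y. x \<otimes>\<^bsub>A\<^esub> y) xs \<one>\<^bsub>A\<^esub>"

definition alg_quot :: "(complex, 'a) module \<Rightarrow> 'a set \<Rightarrow> (complex, 'a set) module" where
  "alg_quot A J = ring.extend (A Quot J)
     (module.fields (\<lambda>c X. \<Union>x\<in>X. J +>\<^bsub>A\<^esub> (c \<odot>\<^bsub>A\<^esub> x)))"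


section \<open>Tensor products\<close>

text \<open>
  \<open>M \<otimes> N\<close> is the free vector space on \<open>carrier M \<times> carrier N\<close> modulo the subspace spanned by
  the bilinearity relators; \<open>tensor_class M N p\<close> is the class of \<open>p\<close>.
\<close>

definition bilinear_relators ::
    "(complex, 'a) module \<Rightarrow> (complex, 'b) module \<Rightarrow> ('a \<times> 'b \<Rightarrow>\<^sub>0 complex) set" where
  "bilinear_relators M N =
     {basis_vec (x \<oplus>\<^bsub>M\<^esub> x', y) - basis_vec (x, y) - basis_vec (x', y) |x x' y.
        x \<in> carrier M \<and> x' \<in> carrier M \<and> y \<in> carrier N} \<union>
     {basis_vec (x, y \<oplus>\<^bsub>N\<^esub> y') - basis_vec (x, y) - basis_vec (x, y') |x y y'.
        x \<in> carrier M \<and> y \<in> carrier N \<and> y' \<in> carrier N} \<union>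
     {basis_vec (c \<odot>\<^bsub>M\<^esub> x, y) - cscale c (basis_vec (x, y)) |c x y.
        x \<in> carrier M \<and> y \<in> carrier N} \<union>
     {basis_vec (x, c \<odot>\<^bsub>N\<^esub> y) - cscale c (basis_vec (x, y)) |c x y.
        x \<in> carrier M \<and> y \<in> carrier N}"

definition tensor_class ::
    "(complex, 'a) module \<Rightarrow> (complex, 'b) module \<Rightarrow> ('a \<times> 'b \<Rightarrow>\<^sub>0 complex) \<Rightarrow>
      ('a \<times> 'b \<Rightarrow>\<^sub>0 complex) set" where
  "tensor_class M N p = {r. r - p \<in> pm.span (bilinear_relators M N)}"

definition tens ::
    "(complex, 'a) module \<Rightarrow> (complex, 'b) module \<Rightarrow> 'a \<Rightarrow> 'b \<Rightarrow> ('a \<times> 'b \<Rightarrow>\<^sub>0 complex) set" where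
  "tens M N x y = tensor_class M N (basis_vec (x, y))"

text \<open>Only the vector space structure; the multiplicative fields are filled in by \<open>tensor_alg\<close>.\<close>

definition tensor_vs ::
    "(complex, 'a) module \<Rightarrow> (complex, 'b) module \<Rightarrow>
      (complex, ('a \<times> 'b \<Rightarrow>\<^sub>0 complex) set) module" where
  "tensor_vs M N =
     \<lparr>carrier = tensor_class M N ` {p. Poly_Mapping.keys p \<subseteq> carrier M \<times> carrier N},
      mult = undefined, one = undefined,
      zero = tensor_class M N 0,
      add = (\<lambda>X Y. \<Union>p\<in>X. \<Union>r\<in>Y. tensor_class M N (p + r)),
      smult = (\<lambda>c X. \<Union>p\<in>X. tensor_class M N (cscale c p))\<rparr>"

text \<open>
  The linear map \<open>M \<otimes> N \<rightarrow> P\<close> with \<open>x \<otimes> y \<mapsto> B x y\<close>, for bilinear \<open>B\<close>; the value then does not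
  depend on the representative \<open>p\<close> of the class \<open>X\<close>.
\<close>

definition tensor_lift ::
    "(complex, 'c) module \<Rightarrow> ('a \<Rightarrow> 'b \<Rightarrow> 'c) \<Rightarrow> ('a \<times> 'b \<Rightarrow>\<^sub>0 complex) set \<Rightarrow> 'c" where
  "tensor_lift P B X =
     (let p = (SOME p. p \<in> X)
      in finsum P (\<lambda>(x, y). Poly_Mapping.lookup p (x, y) \<odot>\<^bsub>P\<^esub> B x y) (Poly_Mapping.keys p))"

text \<open>\<open>(x \<otimes> y) (x' \<otimes> y') = x x' \<otimes> y y'\<close>\<close>

definition tensor_alg ::
    "(complex, 'a) module \<Rightarrow> (complex, 'b) module \<Rightarrow>
      (complex, ('a \<times> 'b \<Rightarrow>\<^sub>0 complex) set) module" where
  "tensor_alg M N =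
     (tensor_vs M N)
       \<lparr>mult := (\<lambda>X Y. tensor_lift (tensor_vs M N)
           (\<lambda>x y. tensor_lift (tensor_vs M N)
             (\<lambda>x' y'. tens M N (x \<otimes>\<^bsub>M\<^esub> x') (y \<otimes>\<^bsub>N\<^esub> y')) Y) X),
        one := tens M N \<one>\<^bsub>M\<^esub> \<one>\<^bsub>N\<^esub>\<rparr>"

text \<open>\<open>tensor_map M' N' f g\<close> is \<open>f \<otimes> g\<close> with values in \<open>M' \<otimes> N'\<close>.\<close>

definition tensor_map ::
    "(complex, 'c) module \<Rightarrow> (complex, 'd) module \<Rightarrow> ('a \<Rightarrow> 'c) \<Rightarrow> ('b \<Rightarrow> 'd) \<Rightarrow>
      ('a \<times> 'b \<Rightarrow>\<^sub>0 complex) set \<Rightarrow> ('c \<times> 'd \<Rightarrow>\<^sub>0 complex) set" where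
  "tensor_map M' N' f g = tensor_lift (tensor_vs M' N') (\<lambda>x y. tens M' N' (f x) (g y))"

text \<open>The associativity isomorphism \<open>(M \<otimes> N) \<otimes> P \<rightarrow> M \<otimes> (N \<otimes> P)\<close>.\<close>

definition tensor_assoc where
  "tensor_assoc M N P =
     tensor_lift (tensor_vs M (tensor_alg N P))
       (\<lambda>Z z. tensor_lift (tensor_vs M (tensor_alg N P))
         (\<lambda>x y. tens M (tensor_alg N P) x (tens N P y z)) Z)"


section \<open>Bialgebras and comodule algebras\<close>

locale complex_bialgebra = complex_algebra H for H (structure) +
  fixes \<Delta> and \<epsilon> :: "_ \<Rightarrow> complex"
  assumes coproduct_hom: "\<Delta> \<in> alg_hom H (tensor_alg H H)"
    and counit_hom: "\<epsilon> \<in> alg_hom H complex_alg"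
    and coassoc: "h \<in> carrier H \<Longrightarrow>
      tensor_assoc H H H (tensor_map (tensor_alg H H) H \<Delta> (\<lambda>y. y) (\<Delta> h)) =
      tensor_map H (tensor_alg H H) (\<lambda>x. x) \<Delta> (\<Delta> h)"
    and counit_left: "h \<in> carrier H \<Longrightarrow> tensor_lift H (\<lambda>x y. \<epsilon> x \<odot>\<^bsub>H\<^esub> y) (\<Delta> h) = h"
    and counit_right: "h \<in> carrier H \<Longrightarrow> tensor_lift H (\<lambda>x y. \<epsilon> y \<odot>\<^bsub>H\<^esub> x) (\<Delta> h) = h"

locale right_comodule_algebra =
  complex_bialgebra H \<Delta> \<epsilon> + M: complex_algebra M
  for H (structure) and \<Delta> and \<epsilon> and M +
  fixes \<delta>
  assumes coaction_hom: "\<delta> \<in> alg_hom M (tensor_alg M H)"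
    and coaction_coassoc: "x \<in> carrier M \<Longrightarrow>
      tensor_assoc M H H (tensor_map (tensor_alg M H) H \<delta> (\<lambda>h. h) (\<delta> x)) =
      tensor_map M (tensor_alg H H) (\<lambda>y. y) \<Delta> (\<delta> x)"
    and coaction_counit: "x \<in> carrier M \<Longrightarrow> tensor_lift M (\<lambda>y h. \<epsilon> h \<odot>\<^bsub>M\<^esub> y) (\<delta> x) = x"


section \<open>Braidings\<close>

text \<open>
  \<open>V\<close> is the vector space with basis \<open>(v\<^sub>i)\<close> indexed by the finite type \<open>'i\<close>. In \<open>V \<otimes> V\<close> the
  vector \<open>v\<^sub>i \<otimes> v\<^sub>j\<close> is \<open>basis_vec (i, j)\<close>; in \<open>T(V)\<close> the vector
  \<open>v\<^bsub>i1\<^esub> \<otimes> \<dots> \<otimes> v\<^bsub>ik\<^esub>\<close> is \<open>basis_vec [i1, \<dots>, ik]\<close>.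
\<close>

type_synonym 'i tensors = "'i list \<Rightarrow>\<^sub>0 complex"
type_synonym 'i endo2 = "('i \<times> 'i \<Rightarrow>\<^sub>0 complex) \<Rightarrow> ('i \<times> 'i \<Rightarrow>\<^sub>0 complex)"

definition tensor_power :: "nat \<Rightarrow> 'i tensors set" where
  "tensor_power n = {x. \<forall>w\<in>Poly_Mapping.keys x. length w = n}"

text \<open>\<open>coef \<sigma> i j k l\<close> is \<open>\<sigma>\<^sub>i\<^sub>j\<^sup>k\<^sup>l\<close>, the coefficient of \<open>v\<^sub>k \<otimes> v\<^sub>l\<close> in \<open>\<sigma> (v\<^sub>i \<otimes> v\<^sub>j)\<close>.\<close>

definition coef :: "'i endo2 \<Rightarrow> 'i \<Rightarrow> 'i \<Rightarrow> 'i \<Rightarrow> 'i \<Rightarrow> complex" where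
  "coef \<sigma> i j k l = Poly_Mapping.lookup (\<sigma> (basis_vec (i, j))) (k, l)"

text \<open>
  \<open>\<sigma>\<^sub>r\<close>, acting on the positions \<open>r\<close> and \<open>r + 1\<close> (counted from 1); meaningful on
  \<open>tensor_power n\<close> for \<open>1 \<le> r < n\<close>.
\<close>

definition braid_at :: "('i::finite) endo2 \<Rightarrow> nat \<Rightarrow> 'i tensors \<Rightarrow> 'i tensors" where
  "braid_at \<sigma> r = lin_ext (\<lambda>w. \<Sum>(k, l)\<in>UNIV.
     cscale (coef \<sigma> (w ! (r - 1)) (w ! r) k l)
       (basis_vec (take (r - 1) w @ [k, l] @ drop (r + 1) w)))"

definition braiding :: "('i::finite) endo2 \<Rightarrow> bool" where
  "braiding \<sigma> \<longleftrightarrow>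
     Vector_Spaces.linear cscale cscale \<sigma> \<and> bij \<sigma> \<and>
     (\<forall>x\<in>tensor_power 3.
        braid_at \<sigma> 1 (braid_at \<sigma> 2 (braid_at \<sigma> 1 x)) =
        braid_at \<sigma> 2 (braid_at \<sigma> 1 (braid_at \<sigma> 2 x)))"

definition perm_of_word :: "nat list \<Rightarrow> nat \<Rightarrow> nat" where
  "perm_of_word rs = foldr (\<lambda>r f. transpose r (r + 1) \<circ> f) rs id"

definition perm_length :: "nat \<Rightarrow> (nat \<Rightarrow> nat) \<Rightarrow> nat" where
  "perm_length n w =
     (LEAST l. \<exists>rs. set rs \<subseteq> {1..<n} \<and> perm_of_word rs = w \<and> length rs = l)"

definition reduced_word :: "nat \<Rightarrow> (nat \<Rightarrow> nat) \<Rightarrow> nat list \<Rightarrow> bool" where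
  "reduced_word n w rs \<longleftrightarrow>
     set rs \<subseteq> {1..<n} \<and> perm_of_word rs = w \<and> length rs = perm_length n w"

definition braid_word :: "('i::finite) endo2 \<Rightarrow> nat list \<Rightarrow> 'i tensors \<Rightarrow> 'i tensors" where
  "braid_word \<sigma> rs = foldr (\<lambda>r f. braid_at \<sigma> r \<circ> f) rs id"

text \<open>\<open>\<sigma>\<^sub>w\<close> on \<open>tensor_power n\<close>; for a braiding it does not depend on the reduced word chosen.\<close>

definition braid_perm ::
    "('i::finite) endo2 \<Rightarrow> nat \<Rightarrow> (nat \<Rightarrow> nat) \<Rightarrow> 'i tensors \<Rightarrow> 'i tensors" where
  "braid_perm \<sigma> n w = braid_word \<sigma> (SOME rs. reduced_word n w rs)"


section \<open>The quantum exterior algebra\<close>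

definition qnum :: "complex \<Rightarrow> nat \<Rightarrow> complex" where
  "qnum \<nu> n = (1 - \<nu> ^ n) / (1 - \<nu>)"

definition qfact :: "complex \<Rightarrow> nat \<Rightarrow> complex" where
  "qfact \<nu> n = (\<Prod>k=1..n. qnum \<nu> k)"

definition shuffle_perms :: "nat \<Rightarrow> nat \<Rightarrow> (nat \<Rightarrow> nat) set" where
  "shuffle_perms m n =
     {w. w permutes {1..m + n} \<and> strict_mono_on {1..m} w \<and> strict_mono_on {m + 1..m + n} w}"

text \<open>
  The product \<open>\<odot>\<^sub>\<sigma>\<close>, extended bilinearly from basis words. If \<open>m = 0\<close> or \<open>n = 0\<close> the sum
  reduces to the identity permutation, so no separate clause for scalars is needed.
\<close>

definition qshuffle ::
    "complex \<Rightarrow> ('i::finite) endo2 \<Rightarrow> 'i tensors \<Rightarrow> 'i tensors \<Rightarrow> 'i tensors" where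
  "qshuffle q \<sigma> x y =
     lin_ext (\<lambda>u. lin_ext (\<lambda>v.
       (let m = length u; n = length v; \<nu> = q powi (-2)
        in cscale (qfact \<nu> m * qfact \<nu> n / qfact \<nu> (m + n))
             (\<Sum>w\<in>shuffle_perms m n.
                cscale ((- q) powi (- int (perm_length (m + n) w)))
                  (braid_perm \<sigma> (m + n) w (basis_vec (u @ v)))))) y) x"

definition qantisym :: "complex \<Rightarrow> ('i::finite) endo2 \<Rightarrow> nat \<Rightarrow> 'i tensors \<Rightarrow> 'i tensors" where
  "qantisym q \<sigma> k x =
     cscale (1 / qfact (q powi (-2)) k)
       (\<Sum>w | w permutes {1..k}.
          cscale ((- q) powi (- int (perm_length k w))) (braid_perm \<sigma> k w x))"

text \<open>The unital subalgebra of \<open>(T(V), \<odot>\<^sub>\<sigma>)\<close> generated by \<open>V\<close>.\<close>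

inductive_set qext_carrier :: "complex \<Rightarrow> ('i::finite) endo2 \<Rightarrow> 'i tensors set"
  for q \<sigma> where
  one: "1 \<in> qext_carrier q \<sigma>"
| generator: "x \<in> tensor_power 1 \<Longrightarrow> x \<in> qext_carrier q \<sigma>"
| add: "\<lbrakk>x \<in> qext_carrier q \<sigma>; y \<in> qext_carrier q \<sigma>\<rbrakk> \<Longrightarrow> x + y \<in> qext_carrier q \<sigma>"
| scale: "x \<in> qext_carrier q \<sigma> \<Longrightarrow> cscale c x \<in> qext_carrier q \<sigma>"
| mult: "\<lbrakk>x \<in> qext_carrier q \<sigma>; y \<in> qext_carrier q \<sigma>\<rbrakk> \<Longrightarrow> qshuffle q \<sigma> x y \<in> qext_carrier q \<sigma>"

definition qext :: "complex \<Rightarrow> ('i::finite) endo2 \<Rightarrow> (complex, 'i tensors) module" where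
  "qext q \<sigma> = \<lparr>carrier = qext_carrier q \<sigma>, mult = qshuffle q \<sigma>, one = 1, zero = 0,
     add = (+), smult = cscale\<rparr>"


section \<open>The FRT bialgebra\<close>

text \<open>The letter \<open>(i, j)\<close> stands for \<open>T\<^sup>i\<^sub>j\<close>.\<close>

type_synonym 'i frt_elem = "(('i \<times> 'i) list \<Rightarrow>\<^sub>0 complex) set"

definition frt_relators :: "('i::finite) endo2 \<Rightarrow> (('i \<times> 'i) list \<Rightarrow>\<^sub>0 complex) set" where
  "frt_relators \<sigma> =
     {(\<Sum>(k, l)\<in>UNIV. cscale (coef \<sigma> i j k l) (basis_vec [(m, k), (n, l)])) -
      (\<Sum>(k, l)\<in>UNIV. cscale (coef \<sigma> k l m n) (basis_vec [(k, i), (l, j)])) |i j m n. True}"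

definition frt_ideal :: "('i::finite) endo2 \<Rightarrow> (('i \<times> 'i) list \<Rightarrow>\<^sub>0 complex) set" where
  "frt_ideal \<sigma> = genideal free_algebra (frt_relators \<sigma>)"

definition frt :: "('i::finite) endo2 \<Rightarrow> (complex, 'i frt_elem) module" where
  "frt \<sigma> = alg_quot free_algebra (frt_ideal \<sigma>)"

definition T_gen :: "('i::finite) endo2 \<Rightarrow> 'i \<Rightarrow> 'i \<Rightarrow> 'i frt_elem" where
  "T_gen \<sigma> i j = frt_ideal \<sigma> +>\<^bsub>free_algebra\<^esub> basis_vec [(i, j)]"

text \<open>
  The algebra homomorphism out of the FRT algebra with \<open>T\<^sup>i\<^sub>j \<mapsto> g (i, j)\<close>, provided \<open>g\<close> respects
  the defining relations; the value then does not depend on the representative \<open>p\<close>.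
\<close>

definition frt_lift ::
    "(complex, 'c) module \<Rightarrow> ('i \<times> 'i \<Rightarrow> 'c) \<Rightarrow> 'i frt_elem \<Rightarrow> 'c" where
  "frt_lift P g X =
     (let p = (SOME p. p \<in> X)
      in finsum P (\<lambda>w. Poly_Mapping.lookup p w \<odot>\<^bsub>P\<^esub> alg_prod P (map g w)) (Poly_Mapping.keys p))"

definition frt_coproduct ::
    "('i::finite) endo2 \<Rightarrow> 'i frt_elem \<Rightarrow> ('i frt_elem \<times> 'i frt_elem \<Rightarrow>\<^sub>0 complex) set" where
  "frt_coproduct \<sigma> =
     frt_lift (tensor_alg (frt \<sigma>) (frt \<sigma>))
       (\<lambda>(i, j). finsum (tensor_alg (frt \<sigma>) (frt \<sigma>))
          (\<lambda>k. tens (frt \<sigma>) (frt \<sigma>) (T_gen \<sigma> i k) (T_gen \<sigma> k j)) UNIV)"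

definition frt_counit :: "('i::finite) endo2 \<Rightarrow> 'i frt_elem \<Rightarrow> complex" where
  "frt_counit \<sigma> = frt_lift complex_alg (\<lambda>(i, j). if i = j then 1 else 0)"

text \<open>\<open>T_mono \<sigma> [j1, \<dots>, jk] [i1, \<dots>, ik] = T\<^bsup>j1\<^esup>\<^bsub>i1\<^esub> \<dots> T\<^bsup>jk\<^esup>\<^bsub>ik\<^esub>\<close>\<close>

definition T_mono :: "('i::finite) endo2 \<Rightarrow> 'i list \<Rightarrow> 'i list \<Rightarrow> 'i frt_elem" where
  "T_mono \<sigma> js is = alg_prod (frt \<sigma>) (map (\<lambda>(j, i). T_gen \<sigma> j i) (zip js is))"

text \<open>
  The tensor comodule maps \<open>\<rho>\<^bsup>\<times>k\<^esup>\<close> for all \<open>k\<close> together, as one map \<open>T(V) \<rightarrow> T(V) \<otimes> \<A>(\<sigma>)\<close>. Here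
  \<open>free_algebra\<close> serves as the vector space \<open>T(V)\<close>; its product is not used.
\<close>

definition tensor_coaction ::
    "('i::finite) endo2 \<Rightarrow> 'i tensors \<Rightarrow> ('i tensors \<times> 'i frt_elem \<Rightarrow>\<^sub>0 complex) set" where
  "tensor_coaction \<sigma> x =
     finsum (tensor_vs free_algebra (frt \<sigma>))
       (\<lambda>is. Poly_Mapping.lookup x is \<odot>\<^bsub>tensor_vs free_algebra (frt \<sigma>)\<^esub>
          finsum (tensor_vs free_algebra (frt \<sigma>))
            (\<lambda>js. tens free_algebra (frt \<sigma>) (basis_vec js) (T_mono \<sigma> js is))
            {js. length js = length is})
       (Poly_Mapping.keys x)"

end

theory Submission
  imports Defs "HOL-Library.Infinite_Set"
begin

text \<open>
  The antisymmetrizers of all degrees assemble to a linear endomorphism \<open>A\<close> of \<open>T(V)\<close> satisfying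
  \<open>A u \<odot> A v = A (u v)\<close>: every permutation in \<open>S\<^bsub>m+n\<^esub>\<close> is uniquely a shuffle times an element of
  \<open>S\<^sub>m \<times> S\<^sub>n\<close>, lengths add up in this factorization, and by Matsumoto's theorem the braid operators
  multiply accordingly. So the quantum exterior algebra is the image of the algebra homomorphism \<open>A\<close>
  on the free algebra, which gives associativity without multiple shuffles. The FRT relations
  say that the tensor coaction commutes with every \<open>\<sigma>\<^sub>r\<close>, hence with \<open>A\<close>, so that
  \<open>A v\<^sub>i \<mapsto> \<Sum>\<^sub>j A v\<^sub>j \<otimes> T\<^sup>j\<^sub>i\<close> (for multi-indices \<open>i\<close>, \<open>j\<close>) is a well-defined linear map. The comodule
  algebra axioms are then verified on the spanning vectors \<open>A v\<^sub>i\<close>, where they follow from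
  \<open>\<Delta> T\<^sup>j\<^sub>i = \<Sum>\<^sub>k T\<^sup>j\<^sub>k \<otimes> T\<^sup>k\<^sub>i\<close>.
\<close>

section \<open>Linear algebra over the complex numbers\<close>

text \<open>The axioms concern quotient objects: elements of a tensor product or of the FRT algebra
  are classes, and a map out of them is evaluated at a representative picked by choice. Such maps
  can be handled only through universal properties: well-definedness and linearity are established
  once, and afterwards two linear maps are compared on pure tensors or on monomials. Multi-indices
  are words, so the \<open>T_mono \<sigma> js is\<close> are the entries of one matrix. The
  coproduct is then a matrix product, the FRT relation says that this matrix commutes with that of
  \<open>\<sigma>\<close>, and coassociativity of the coproduct and of the coaction is the same
  rearrangement of a double sum. Since \<open>\<sigma>\<close> is an arbitrary braiding, no
  quadratic relation is at hand to simplify products of braid operators. Only braid words whose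
  concatenation stays reduced can be combined, and this is why lengths, computed as inversion
  numbers, need precise control.\<close>

lemma cring_complex_alg: "cring complex_alg"
proof (rule cringI)
  show "abelian_group complex_alg"
    by (rule abelian_groupI) (auto simp: complex_alg_def intro: add.left_inverse)
  show "comm_monoid complex_alg"
    by (rule comm_monoidI) (auto simp: complex_alg_def)
qed (simp add: complex_alg_def algebra_simps)

text \<open>Scalars range over a type here, which frees the module laws from the membership
  conditions on scalars that come with \<open>complex_alg\<close> as a base ring.\<close>

locale cvs = abelian_group M for M :: "(complex, 'a) module" (structure) +
  assumes smult_closed [simp, intro]: "x \<in> carrier M \<Longrightarrow> c \<odot> x \<in> carrier M"
    and smult_l_distr: "x \<in> carrier M \<Longrightarrow> (a + b) \<odot> x = a \<odot> x \<oplus> b \<odot> x"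
    and smult_r_distr: "\<lbrakk>x \<in> carrier M; y \<in> carrier M\<rbrakk> \<Longrightarrow> a \<odot> (x \<oplus> y) = a \<odot> x \<oplus> a \<odot> y"
    and smult_assoc: "x \<in> carrier M \<Longrightarrow> (a * b) \<odot> x = a \<odot> (b \<odot> x)"
    and smult_one [simp]: "x \<in> carrier M \<Longrightarrow> 1 \<odot> x = x"

lemma module_complex_alg_iff: "Module.module complex_alg M \<longleftrightarrow> cvs M"
proof
  assume "Module.module complex_alg M"
  then interpret Module.module complex_alg M .
  show "cvs M"
    using smult_closed smult_l_distr smult_r_distr smult_assoc1 smult_one
    by unfold_locales (auto simp: complex_alg_def)
next
  assume "cvs M"
  then interpret cvs M .
  show "Module.module complex_alg M"
    by (rule moduleI[OF cring_complex_alg abelian_group_axioms])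
      (auto simp: complex_alg_def smult_l_distr smult_r_distr smult_assoc)
qed

lemma complex_algebra_cvs: "complex_algebra A \<Longrightarrow> cvs A"
  using complex_algebra.axioms(1) module_complex_alg_iff by blast

lemma complex_algebra_ring: "complex_algebra A \<Longrightarrow> ring A"
  by (rule complex_algebra.axioms(2))

lemma (in cvs) smult_zero_left [simp]: "x \<in> carrier M \<Longrightarrow> 0 \<odot> x = \<zero>"
  using smult_l_distr[of x 0 0] by (metis add_0 add.r_cancel_one' smult_closed)

lemma (in abelian_monoid) finsum_Times:
  assumes "finite A" "finite B" "\<And>a b. a \<in> A \<Longrightarrow> b \<in> B \<Longrightarrow> f (a, b) \<in> carrier G"
  shows "finsum G f (A \<times> B) = finsum G (\<lambda>a. finsum G (\<lambda>b. f (a, b)) B) A"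
  using assms(1,3)
proof (induction A rule: finite_induct)
  case empty
  then show ?case by simp
next
  case (insert x F)
  have "insert x F \<times> B = Pair x ` B \<union> F \<times> B" by auto
  then have "finsum G f (insert x F \<times> B) = finsum G f (Pair x ` B) \<oplus> finsum G f (F \<times> B)"
    using insert assms(2) by (simp, subst finsum_Un_disjoint) auto
  also have "finsum G f (Pair x ` B) = finsum G (\<lambda>b. f (x, b)) B"
    using insert by (subst finsum_reindex) (auto simp: inj_on_def)
  finally show ?case using insert by (subst finsum_insert) (auto intro!: finsum_closed)
qed

lemma (in abelian_monoid) finsum_bij:
  assumes "bij_betw h A B" "\<And>b. b \<in> B \<Longrightarrow> f b \<in> carrier G"
  shows "finsum G f B = finsum G (\<lambda>a. f (h a)) A"
  using assms finsum_reindex[of f h A] unfolding bij_betw_def by auto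

lemma finsum_swap:
  assumes "cvs M" "finite A" "finite B" "\<And>a b. a \<in> A \<Longrightarrow> b \<in> B \<Longrightarrow> f a b \<in> carrier M"
  shows "finsum M (\<lambda>a. finsum M (\<lambda>b. f a b) B) A = finsum M (\<lambda>b. finsum M (\<lambda>a. f a b) A) B"
proof -
  interpret cvs M by fact
  have "bij_betw (\<lambda>(b, a). (a, b)) (B \<times> A) (A \<times> B)"
    by (rule bij_betw_byWitness[where f' = "\<lambda>(a, b). (b, a)"]) auto
  then have "finsum M (\<lambda>(a, b). f a b) (A \<times> B) =
      finsum M (\<lambda>x. (\<lambda>(a, b). f a b) ((\<lambda>(b, a). (a, b)) x)) (B \<times> A)"
    by (rule finsum_bij) (use assms in auto)
  then show ?thesis using assms(2-4) by (simp add: finsum_Times case_prod_unfold)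
qed

lemma finsum_bij_Times:
  assumes "cvs M" "bij_betw h (A \<times> B) C" "finite A" "finite B" "\<And>c. c \<in> C \<Longrightarrow> f c \<in> carrier M"
  shows "finsum M f C = finsum M (\<lambda>a. finsum M (\<lambda>b. f (h (a, b))) B) A"
proof -
  interpret cvs M by fact
  have "h x \<in> C" if "x \<in> A \<times> B" for x using assms(2) that by (auto simp: bij_betw_def)
  then show ?thesis using assms(3-5) by (subst finsum_bij[OF assms(2)]) (auto intro!: finsum_Times)
qed

text \<open>Linearity is demanded on carriers only: maps defined through a chosen representative are
  unconstrained elsewhere.\<close>

definition clin :: "(complex, 'a) module \<Rightarrow> (complex, 'b) module \<Rightarrow> ('a \<Rightarrow> 'b) \<Rightarrow> bool" where
  "clin M P f \<longleftrightarrow> f \<in> carrier M \<rightarrow> carrier P \<and>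
     (\<forall>x\<in>carrier M. \<forall>y\<in>carrier M. f (x \<oplus>\<^bsub>M\<^esub> y) = f x \<oplus>\<^bsub>P\<^esub> f y) \<and>
     (\<forall>c. \<forall>x\<in>carrier M. f (c \<odot>\<^bsub>M\<^esub> x) = c \<odot>\<^bsub>P\<^esub> f x)"

lemma clinI:
  assumes "\<And>x. x \<in> carrier M \<Longrightarrow> f x \<in> carrier P"
    and "\<And>x y. x \<in> carrier M \<Longrightarrow> y \<in> carrier M \<Longrightarrow> f (x \<oplus>\<^bsub>M\<^esub> y) = f x \<oplus>\<^bsub>P\<^esub> f y"
    and "\<And>c x. x \<in> carrier M \<Longrightarrow> f (c \<odot>\<^bsub>M\<^esub> x) = c \<odot>\<^bsub>P\<^esub> f x"
  shows "clin M P f"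
  using assms by (auto simp: clin_def)

lemma clin_closed: "clin M P f \<Longrightarrow> x \<in> carrier M \<Longrightarrow> f x \<in> carrier P"
  and clin_add: "clin M P f \<Longrightarrow> x \<in> carrier M \<Longrightarrow> y \<in> carrier M \<Longrightarrow> f (x \<oplus>\<^bsub>M\<^esub> y) = f x \<oplus>\<^bsub>P\<^esub> f y"
  and clin_smult: "clin M P f \<Longrightarrow> x \<in> carrier M \<Longrightarrow> f (c \<odot>\<^bsub>M\<^esub> x) = c \<odot>\<^bsub>P\<^esub> f x"
  by (auto simp: clin_def)

lemma clin_zero:
  assumes "cvs M" "cvs P" "clin M P f"
  shows "f \<zero>\<^bsub>M\<^esub> = \<zero>\<^bsub>P\<^esub>"
proof -
  interpret M: cvs M by fact
  interpret P: cvs P by fact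
  have "f (0 \<odot>\<^bsub>M\<^esub> \<zero>\<^bsub>M\<^esub>) = 0 \<odot>\<^bsub>P\<^esub> f \<zero>\<^bsub>M\<^esub>"
    by (rule clin_smult[OF assms(3)]) simp
  then show ?thesis using clin_closed[OF assms(3) M.zero_closed] by simp
qed

lemma clin_finsum:
  assumes "cvs M" "cvs P" "clin M P f" "\<And>a. a \<in> A \<Longrightarrow> g a \<in> carrier M"
  shows "f (finsum M g A) = finsum P (\<lambda>a. f (g a)) A"
proof -
  interpret M: cvs M by fact
  interpret P: cvs P by fact
  show ?thesis
  proof (cases "finite A")
    case True
    then show ?thesis using assms(4)
    proof (induction A rule: finite_induct)
      case empty
      then show ?case by (simp add: clin_zero[OF assms(1-3)])
    next
      case (insert x F)
      then show ?case by (subst M.finsum_insert)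
          (auto simp: clin_add[OF assms(3)] P.finsum_insert Pi_iff clin_closed[OF assms(3)])
    qed
  next
    case False
    then show ?thesis by (simp add: M.finsum_infinite P.finsum_infinite clin_zero[OF assms(1-3)])
  qed
qed

lemma clin_comp: "clin M N f \<Longrightarrow> clin N P g \<Longrightarrow> clin M P (\<lambda>x. g (f x))"
  by (auto simp: clin_def Pi_iff)

lemma clin_id: "clin M M (\<lambda>x. x)"
  by (simp add: clin_def)

lemma (in cvs) clin_add_fun: "clin N M f \<Longrightarrow> clin N M g \<Longrightarrow> clin N M (\<lambda>x. f x \<oplus> g x)"
  by (auto simp: clin_def Pi_iff smult_r_distr a_ac)

lemma (in cvs) clin_smult_fun: "clin N M f \<Longrightarrow> clin N M (\<lambda>x. c \<odot> f x)"
  by (auto simp: clin_def Pi_iff smult_r_distr mult.commute simp flip: smult_assoc)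

lemma (in cvs) clin_smult_vec: "clin M M (\<lambda>x. c \<odot> x)"
  by (intro clin_smult_fun clin_id)

lemma (in cvs) smult_finsum:
  "(\<And>a. a \<in> A \<Longrightarrow> g a \<in> carrier M) \<Longrightarrow> c \<odot> finsum M g A = finsum M (\<lambda>a. c \<odot> g a) A"
  by (rule clin_finsum[OF _ _ clin_smult_vec]) (auto intro: cvs_axioms)

text \<open>Spans are inductive so that equality of linear maps on a span and transport of a span
  along a linear map are rule inductions, without finite linear combinations.\<close>

inductive_set lspan :: "(complex, 'a) module \<Rightarrow> 'a set \<Rightarrow> 'a set" for M S where
  lspan_zero: "\<zero>\<^bsub>M\<^esub> \<in> lspan M S"
| lspan_base: "x \<in> S \<Longrightarrow> x \<in> lspan M S"
| lspan_add: "x \<in> lspan M S \<Longrightarrow> y \<in> lspan M S \<Longrightarrow> x \<oplus>\<^bsub>M\<^esub> y \<in> lspan M S"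
| lspan_smult: "x \<in> lspan M S \<Longrightarrow> c \<odot>\<^bsub>M\<^esub> x \<in> lspan M S"

lemma (in cvs) lspan_closed: "S \<subseteq> carrier M \<Longrightarrow> x \<in> lspan M S \<Longrightarrow> x \<in> carrier M"
  by (erule lspan.induct) auto

lemma clin_eq_on_lspan:
  assumes "cvs M" "cvs P" "clin M P f" "clin M P g" "S \<subseteq> carrier M"
    and "\<And>x. x \<in> S \<Longrightarrow> f x = g x" and "x \<in> lspan M S"
  shows "f x = g x"
  using assms(7)
proof induction
  case lspan_zero
  then show ?case by (simp add: clin_zero[OF assms(1,2)] assms(3,4))
next
  case (lspan_add x y)
  then show ?case using assms(1,3,4,5)
    by (simp add: clin_add[OF assms(3)] clin_add[OF assms(4)] cvs.lspan_closed[OF assms(1,5)])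
next
  case (lspan_smult x c)
  then show ?case
    by (simp add: clin_smult[OF assms(3)] clin_smult[OF assms(4)] cvs.lspan_closed[OF assms(1,5)])
qed (use assms in auto)

lemma clin_image_lspan:
  assumes "cvs M" "cvs P" "clin M P f" "S \<subseteq> carrier M" "x \<in> lspan M S"
  shows "f x \<in> lspan P (f ` S)"
  using assms(5)
proof induction
  case lspan_zero
  then show ?case by (simp add: clin_zero[OF assms(1-3)] lspan.lspan_zero)
next
  case (lspan_base x)
  then show ?case by (auto intro: lspan.lspan_base)
next
  case (lspan_add x y)
  then show ?case
    by (simp add: clin_add[OF assms(3)] cvs.lspan_closed[OF assms(1,4)] lspan.lspan_add)
next
  case (lspan_smult x c)
  then show ?case
    by (simp add: clin_smult[OF assms(3)] cvs.lspan_closed[OF assms(1,4)] lspan.lspan_smult)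
qed

lemma lspan_subset:
  assumes "S \<subseteq> lspan M T" "x \<in> lspan M S"
  shows "x \<in> lspan M T"
  using assms(2)
  by induction (use assms(1) in \<open>auto intro: lspan.intros\<close>)

subsection \<open>Free vector spaces\<close>

text \<open>For \<open>C = carrier M \<times> carrier N\<close> the classes of its elements form
  \<open>tensor_vs M N\<close>; for \<open>C = words n\<close> it is the tensor power of degree
  \<open>n\<close>.\<close>

definition free_vs :: "'x set \<Rightarrow> (complex, 'x \<Rightarrow>\<^sub>0 complex) module" where
  "free_vs C = \<lparr>carrier = {p. Poly_Mapping.keys p \<subseteq> C}, mult = undefined, one = undefined,
     zero = 0, add = (+), smult = cscale\<rparr>"

lemma free_vs_simps [simp]:
  "carrier (free_vs C) = {p. Poly_Mapping.keys p \<subseteq> C}" "zero (free_vs C) = 0"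
  "add (free_vs C) = (+)" "smult (free_vs C) = cscale"
  by (auto simp: free_vs_def)

lemma keys_cscale: "Poly_Mapping.keys (cscale c p) \<subseteq> Poly_Mapping.keys p"
  by (auto simp: in_keys_iff)

lemma cscale_single [simp]: "cscale c (Poly_Mapping.single x a) = Poly_Mapping.single x (c * a)"
  by (rule poly_mapping_eqI) (simp add: lookup_single when_def)

lemma cvs_free_vs: "cvs (free_vs C)"
proof -
  have "abelian_group (free_vs C)"
  proof (rule abelian_groupI, goal_cases)
    case (6 x)
    then show ?case by (intro bexI[of _ "- x"]) auto
  qed (use keys_add in \<open>fastforce simp: algebra_simps\<close>)+
  then show ?thesis by (intro cvs.intro cvs_axioms.intro)
      (use keys_cscale in \<open>fastforce simp: pm.scale_left_distrib pm.scale_right_distrib\<close>)+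
qed

lemma poly_mapping_sum_basis:
  "p = (\<Sum>x\<in>Poly_Mapping.keys p. cscale (Poly_Mapping.lookup p x) (basis_vec x))"
proof (rule poly_mapping_eqI)
  fix y
  have "Poly_Mapping.lookup p y =
     (\<Sum>x\<in>Poly_Mapping.keys p. if x = y then Poly_Mapping.lookup p x else 0)"
    by (simp add: in_keys_iff)
  also have "\<dots> = Poly_Mapping.lookup
      (\<Sum>x\<in>Poly_Mapping.keys p. cscale (Poly_Mapping.lookup p x) (basis_vec x)) y"
    unfolding lookup_sum by (rule sum.cong) (auto simp: lookup_single when_def)
  finally show "Poly_Mapping.lookup p y = \<dots>" .
qed

lemma free_vs_lspan:
  assumes "Poly_Mapping.keys p \<subseteq> C"
  shows "p \<in> lspan (free_vs C) (basis_vec ` C)"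
proof -
  have "finite K \<Longrightarrow> K \<subseteq> C \<Longrightarrow> (\<Sum>x\<in>K. cscale (f x) (basis_vec x)) \<in> lspan (free_vs C) (basis_vec ` C)"
    for K f
  proof (induction K rule: finite_induct)
    case empty
    then show ?case using lspan_zero[of "free_vs C"] by simp
  next
    case (insert x F)
    then have "cscale (f x) (basis_vec x) \<in> lspan (free_vs C) (basis_vec ` C)"
      using lspan_smult[of _ "free_vs C"] lspan_base[of "basis_vec x" _ "free_vs C"]
      by (metis free_vs_simps(4) image_eqI insert_subset)
    then show ?case using insert lspan_add[of _ "free_vs C"] by auto
  qed
  then show ?thesis by (subst poly_mapping_sum_basis) (use assms in auto)
qed

text \<open>The common core of \<open>lin_ext\<close>, \<open>tensor_lift\<close>,
  \<open>frt_lift\<close> and \<open>tensor_coaction\<close>: each of them is \<open>lc\<close>,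
  possibly at a chosen representative, so linearity is proved here once.\<close>

definition lc :: "(complex, 'a) module \<Rightarrow> ('x \<Rightarrow> 'a) \<Rightarrow> ('x \<Rightarrow>\<^sub>0 complex) \<Rightarrow> 'a" where
  "lc P B p = finsum P (\<lambda>x. Poly_Mapping.lookup p x \<odot>\<^bsub>P\<^esub> B x) (Poly_Mapping.keys p)"

context cvs begin

lemma lc_superset:
  assumes "B \<in> S \<rightarrow> carrier M" "Poly_Mapping.keys p \<subseteq> S" "finite S"
  shows "lc M B p = finsum M (\<lambda>x. Poly_Mapping.lookup p x \<odot> B x) S"
  unfolding lc_def using assms
  by (intro add.finprod_mono_neutral_cong_left) (auto simp: in_keys_iff Pi_iff)

lemma lc_basis [simp]: "B x \<in> carrier M \<Longrightarrow> lc M B (basis_vec x) = B x"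
  by (simp add: lc_def finsum_insert)

text \<open>Supports do not add, because coefficients may cancel. All three sums are therefore first
  extended to the union of the two supports.\<close>

lemma clin_lc:
  assumes "B \<in> C \<rightarrow> carrier M"
  shows "clin (free_vs C) M (lc M B)"
proof (rule clinI)
  fix p r assume "p \<in> carrier (free_vs C)" "r \<in> carrier (free_vs C)"
  then have k: "Poly_Mapping.keys p \<subseteq> C" "Poly_Mapping.keys r \<subseteq> C" by auto
  let ?S = "Poly_Mapping.keys p \<union> Poly_Mapping.keys r"
  have B: "B \<in> ?S \<rightarrow> carrier M" using assms k by auto
  have "lc M B (p + r) = finsum M (\<lambda>x. Poly_Mapping.lookup (p + r) x \<odot> B x) ?S"
    by (rule lc_superset[OF B keys_add]) simp
  also have "\<dots> = finsum M (\<lambda>x. Poly_Mapping.lookup p x \<odot> B x \<oplus> Poly_Mapping.lookup r x \<odot> B x) ?S"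
    using B by (intro finsum_cong') (auto simp: lookup_add intro!: smult_l_distr)
  also have "\<dots> = lc M B p \<oplus> lc M B r" using B by (subst finsum_addf) (auto simp: lc_superset[OF B])
  finally show "lc M B (p \<oplus>\<^bsub>free_vs C\<^esub> r) = lc M B p \<oplus> lc M B r" by simp
next
  fix c p assume "p \<in> carrier (free_vs C)"
  then have k: "Poly_Mapping.keys p \<subseteq> C" by auto
  let ?S = "Poly_Mapping.keys p"
  have B: "B \<in> ?S \<rightarrow> carrier M" using assms k by auto
  have "lc M B (cscale c p) = finsum M (\<lambda>x. Poly_Mapping.lookup (cscale c p) x \<odot> B x) ?S"
    by (rule lc_superset[OF B keys_cscale]) simp
  also have "\<dots> = finsum M (\<lambda>x. c \<odot> (Poly_Mapping.lookup p x \<odot> B x)) ?S"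
    using B by (intro finsum_cong') (auto intro!: smult_assoc)
  also have "\<dots> = c \<odot> lc M B p" unfolding lc_def using B by (subst smult_finsum) auto
  finally show "lc M B (c \<odot>\<^bsub>free_vs C\<^esub> p) = c \<odot> lc M B p" by simp
qed (use assms in \<open>auto simp: lc_def intro!: finsum_closed\<close>)

end

lemma clin_free_unique:
  assumes "cvs P" "clin (free_vs C) P f" "clin (free_vs C) P g"
    "\<And>x. x \<in> C \<Longrightarrow> f (basis_vec x) = g (basis_vec x)" "Poly_Mapping.keys p \<subseteq> C"
  shows "f p = g p"
  by (rule clin_eq_on_lspan[OF cvs_free_vs assms(1-3) _ _ free_vs_lspan[OF assms(5)]])
    (use assms(4) in auto)

lemma (in cvs) smult_zero_right [simp]: "c \<odot> \<zero> = \<zero>"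
  using smult_assoc[of \<zero> c 0] by simp

section \<open>Bilinear maps and the universal property of the tensor product\<close>

definition bilin :: "(complex, 'a) module \<Rightarrow> (complex, 'b) module \<Rightarrow> (complex, 'c) module \<Rightarrow>
    ('a \<Rightarrow> 'b \<Rightarrow> 'c) \<Rightarrow> bool" where
  "bilin M N P B \<longleftrightarrow> (\<forall>x\<in>carrier M. clin N P (B x)) \<and> (\<forall>y\<in>carrier N. clin M P (\<lambda>x. B x y))"

lemma bilinD1: "bilin M N P B \<Longrightarrow> x \<in> carrier M \<Longrightarrow> clin N P (B x)"
  and bilinD2: "bilin M N P B \<Longrightarrow> y \<in> carrier N \<Longrightarrow> clin M P (\<lambda>x. B x y)"
  by (auto simp: bilin_def)

lemma bilin_closed: "bilin M N P B \<Longrightarrow> x \<in> carrier M \<Longrightarrow> y \<in> carrier N \<Longrightarrow> B x y \<in> carrier P"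
  by (meson bilinD1 clin_closed)

lemma bilin_comp:
  assumes "bilin M N P B" "clin M' M f" "clin N' N g"
  shows "bilin M' N' P (\<lambda>x y. B (f x) (g y))"
  unfolding bilin_def
proof (intro conjI ballI)
  fix x assume "x \<in> carrier M'"
  then show "clin N' P (\<lambda>y. B (f x) (g y))"
    by (intro clin_comp[OF assms(3)] bilinD1[OF assms(1)] clin_closed[OF assms(2)])
next
  fix y assume "y \<in> carrier N'"
  then show "clin M' P (\<lambda>x. B (f x) (g y))"
    using clin_comp[OF assms(2) bilinD2[OF assms(1) clin_closed[OF assms(3)]]] by simp
qed

lemma bilin_comp_left:
  assumes "bilin M N P B" "clin P Q h"
  shows "bilin M N Q (\<lambda>x y. h (B x y))"
  unfolding bilin_def
  using clin_comp[OF bilinD1[OF assms(1)] assms(2)] clin_comp[OF bilinD2[OF assms(1)] assms(2)]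
  by blast

lemma tensor_vs_simps:
  "carrier (tensor_vs M N) = tensor_class M N ` {p. Poly_Mapping.keys p \<subseteq> carrier M \<times> carrier N}"
  "zero (tensor_vs M N) = tensor_class M N 0"
  "add (tensor_vs M N) = (\<lambda>X Y. \<Union>p\<in>X. \<Union>r\<in>Y. tensor_class M N (p + r))"
  "smult (tensor_vs M N) = (\<lambda>c X. \<Union>p\<in>X. tensor_class M N (cscale c p))"
  by (simp_all add: tensor_vs_def)

lemma tensor_class_eq_iff:
  "tensor_class M N p = tensor_class M N r \<longleftrightarrow> p - r \<in> pm.span (bilinear_relators M N)"
proof
  assume "tensor_class M N p = tensor_class M N r"
  moreover have "p \<in> tensor_class M N p" by (simp add: tensor_class_def pm.span_zero)
  ultimately show "p - r \<in> pm.span (bilinear_relators M N)" by (simp add: tensor_class_def)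
next
  assume *: "p - r \<in> pm.span (bilinear_relators M N)"
  have "x - p \<in> pm.span (bilinear_relators M N) \<longleftrightarrow> x - r \<in> pm.span (bilinear_relators M N)" for x
    using pm.span_add[OF _ *, of "x - p"] pm.span_diff[OF _ *, of "x - r"] by auto
  then show "tensor_class M N p = tensor_class M N r" by (auto simp: tensor_class_def)
qed

lemma tensor_class_self: "p \<in> tensor_class M N p"
  by (simp add: tensor_class_def pm.span_zero)

text \<open>The sum of two classes is defined as a union over all pairs of representatives; the
  family is constant and nonempty, so the union is its common value.\<close>

lemma tensor_class_add:
  "tensor_class M N p \<oplus>\<^bsub>tensor_vs M N\<^esub> tensor_class M N r = tensor_class M N (p + r)"
proof -
  have "tensor_class M N (p' + r') = tensor_class M N (p + r)"
    if "p' \<in> tensor_class M N p" "r' \<in> tensor_class M N r" for p' r'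
    using that pm.span_add[of "p' - p" _ "r' - r"]
    by (simp add: tensor_class_eq_iff) (simp add: tensor_class_def algebra_simps)
  then have "(\<Union>p'\<in>tensor_class M N p. \<Union>r'\<in>tensor_class M N r. tensor_class M N (p' + r')) =
      tensor_class M N (p + r)"
    using tensor_class_self by (intro SUP_eq_const) blast+
  then show ?thesis by (simp only: tensor_vs_simps)
qed

lemma tensor_class_smult:
  "c \<odot>\<^bsub>tensor_vs M N\<^esub> tensor_class M N p = tensor_class M N (cscale c p)"
proof -
  have "tensor_class M N (cscale c p') = tensor_class M N (cscale c p)"
    if "p' \<in> tensor_class M N p" for p'
    using that pm.span_scale[of "p' - p" _ c]
    by (simp add: tensor_class_eq_iff) (simp add: tensor_class_def pm.scale_right_diff_distrib)
  then have "(\<Union>p'\<in>tensor_class M N p. tensor_class M N (cscale c p')) = tensor_class M N (cscale c p)"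
    using tensor_class_self by (intro SUP_eq_const) blast+
  then show ?thesis by (simp only: tensor_vs_simps)
qed

text \<open>Equational laws and inverses pass along a surjective map compatible with the operations,
  so a quotient inherits the vector space laws without any computation with classes.\<close>

lemma cvs_image:
  assumes "cvs M"
    and carr: "carrier P = f ` carrier M"
    and add: "\<And>x y. x \<in> carrier M \<Longrightarrow> y \<in> carrier M \<Longrightarrow> f x \<oplus>\<^bsub>P\<^esub> f y = f (x \<oplus>\<^bsub>M\<^esub> y)"
    and smult: "\<And>c x. x \<in> carrier M \<Longrightarrow> c \<odot>\<^bsub>P\<^esub> f x = f (c \<odot>\<^bsub>M\<^esub> x)"
    and zero: "\<zero>\<^bsub>P\<^esub> = f \<zero>\<^bsub>M\<^esub>"
  shows "cvs P"
proof -
  interpret M: cvs M by fact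
  have "abelian_group P"
  proof (rule abelian_groupI, goal_cases)
    case (6 x)
    then obtain a where "x = f a" "a \<in> carrier M" by (auto simp: carr)
    then show ?case by (intro bexI[of _ "f (\<ominus>\<^bsub>M\<^esub> a)"]) (auto simp: add carr zero M.l_neg)
  qed (auto simp: carr add zero M.a_assoc intro!: arg_cong[of _ _ f] M.a_comm)
  then show ?thesis by (intro cvs.intro cvs_axioms.intro)
     (auto simp: carr add smult M.smult_l_distr M.smult_r_distr M.smult_assoc)
qed

lemma cvs_tensor_vs: "cvs (tensor_vs M N)"
  by (rule cvs_image[OF cvs_free_vs[of "carrier M \<times> carrier N"], where f = "tensor_class M N"])
    (simp_all add: tensor_vs_simps(1,2) tensor_class_add tensor_class_smult)

lemma clin_tensor_class: "clin (free_vs (carrier M \<times> carrier N)) (tensor_vs M N) (tensor_class M N)"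
  by (rule clinI) (simp_all add: tensor_vs_simps(1) tensor_class_add tensor_class_smult)

lemma bilin_tens:
  "bilin M N (tensor_vs M N) (tens M N)"
proof -
  have rel: "tensor_class M N p = tensor_class M N r" if "p - r \<in> bilinear_relators M N" for p r
    using that by (simp add: tensor_class_eq_iff pm.span_base)
  have rel2: "tensor_class M N p = tensor_class M N (r + s)" if "p - r - s \<in> bilinear_relators M N" for p r s
    using that by (intro rel) (simp add: diff_diff_eq)
  have closed: "tens M N x y \<in> carrier (tensor_vs M N)" if "x \<in> carrier M" "y \<in> carrier N" for x y
    using that by (auto simp: tens_def tensor_vs_simps)
  have add1: "tens M N (x \<oplus>\<^bsub>M\<^esub> x') y = tens M N x y \<oplus>\<^bsub>tensor_vs M N\<^esub> tens M N x' y"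
    if "x \<in> carrier M" "x' \<in> carrier M" "y \<in> carrier N" for x x' y
    using that unfolding tens_def tensor_class_add
    by (intro rel2) (unfold bilinear_relators_def, blast)
  have add2: "tens M N x (y \<oplus>\<^bsub>N\<^esub> y') = tens M N x y \<oplus>\<^bsub>tensor_vs M N\<^esub> tens M N x y'"
    if "x \<in> carrier M" "y \<in> carrier N" "y' \<in> carrier N" for x y y'
    using that unfolding tens_def tensor_class_add
    by (intro rel2) (unfold bilinear_relators_def, blast)
  have smult1: "tens M N (c \<odot>\<^bsub>M\<^esub> x) y = c \<odot>\<^bsub>tensor_vs M N\<^esub> tens M N x y"
    if "x \<in> carrier M" "y \<in> carrier N" for c x y
    using that unfolding tens_def tensor_class_smult
    by (intro rel) (unfold bilinear_relators_def, blast)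
  have smult2: "tens M N x (c \<odot>\<^bsub>N\<^esub> y) = c \<odot>\<^bsub>tensor_vs M N\<^esub> tens M N x y"
    if "x \<in> carrier M" "y \<in> carrier N" for c x y
    using that unfolding tens_def tensor_class_smult
    by (intro rel) (unfold bilinear_relators_def, blast)
  show ?thesis unfolding bilin_def
    by (intro conjI ballI clinI) (simp_all add: closed add1 add2 smult1 smult2)
qed

lemma tens_closed: "x \<in> carrier M \<Longrightarrow> y \<in> carrier N \<Longrightarrow> tens M N x y \<in> carrier (tensor_vs M N)"
  by (rule bilin_closed[OF bilin_tens])

lemma tensor_vs_lspan:
  assumes "X \<in> carrier (tensor_vs M N)"
  shows "X \<in> lspan (tensor_vs M N) (case_prod (tens M N) ` (carrier M \<times> carrier N))"
proof -
  obtain p where p: "X = tensor_class M N p" "Poly_Mapping.keys p \<subseteq> carrier M \<times> carrier N"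
    using assms by (auto simp: tensor_vs_simps)
  have "tensor_class M N p \<in> lspan (tensor_vs M N) (tensor_class M N ` basis_vec ` (carrier M \<times> carrier N))"
    by (rule clin_image_lspan[OF cvs_free_vs cvs_tensor_vs clin_tensor_class _ free_vs_lspan[OF p(2)]]) auto
  also have "tensor_class M N ` basis_vec ` (carrier M \<times> carrier N) =
      case_prod (tens M N) ` (carrier M \<times> carrier N)"
    by (force simp: tens_def image_image)
  finally show ?thesis using p by simp
qed

text \<open>The linear extension of a bilinear map vanishes on each of the four kinds of relators,
  hence on their span. It is therefore constant on classes, and the representative chosen by
  \<open>tensor_lift\<close> is immaterial.\<close>

lemma tensor_lift_class:
  assumes "cvs M" "cvs N" "cvs P" "bilin M N P B" "Poly_Mapping.keys p \<subseteq> carrier M \<times> carrier N"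
  shows "tensor_lift P B (tensor_class M N p) = lc P (case_prod B) p"
proof -
  interpret M: cvs M by fact
  interpret N: cvs N by fact
  interpret P: cvs P by fact
  let ?C = "carrier M \<times> carrier N"
  let ?F = "free_vs ?C"
  have BC: "case_prod B \<in> ?C \<rightarrow> carrier P" using bilin_closed[OF assms(4)] by auto
  note lin = P.clin_lc[OF BC]
  note L_add = clin_add[OF lin, simplified]
  note L_smult = clin_smult[OF lin, simplified]
  have L_basis: "lc P (case_prod B) (basis_vec (x, y)) = B x y" if "x \<in> carrier M" "y \<in> carrier N" for x y
    using that by (subst P.lc_basis) (auto simp: bilin_closed[OF assms(4)])
  have L0: "lc P (case_prod B) 0 = \<zero>\<^bsub>P\<^esub>" using clin_zero[OF cvs_free_vs P.cvs_axioms lin] by simp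
  have diff: "lc P (case_prod B) (a - b) = \<zero>\<^bsub>P\<^esub> \<and> Poly_Mapping.keys (a - b) \<subseteq> ?C"
    if "lc P (case_prod B) a = lc P (case_prod B) b"
      "Poly_Mapping.keys a \<subseteq> ?C" "Poly_Mapping.keys b \<subseteq> ?C" for a b
  proof -
    have k: "Poly_Mapping.keys (a - b) \<subseteq> ?C" using that keys_add[of a "- b"] by auto
    have "lc P (case_prod B) (a - b) \<oplus>\<^bsub>P\<^esub> lc P (case_prod B) b = lc P (case_prod B) b"
      using L_add[OF k that(3)] that(1) by simp
    then have "lc P (case_prod B) (a - b) = \<zero>\<^bsub>P\<^esub>"
      using clin_closed[OF lin, of "a - b"] clin_closed[OF lin, of b] k that(3)
      by (simp add: P.add.r_cancel_one P.a_comm)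
    then show ?thesis using k by simp
  qed
  \<comment> \<open>The support condition has to be carried through the induction: \<open>lc\<close>
    is linear only on combinations supported in \<open>?C\<close>, and the chosen representative is
    not known in advance to be one.\<close>
  have key: "lc P (case_prod B) s = \<zero>\<^bsub>P\<^esub> \<and> Poly_Mapping.keys s \<subseteq> ?C"
    if "s \<in> pm.span (bilinear_relators M N)" for s
    using that
  proof (induction rule: pm.span_induct_alt)
    case base
    then show ?case by (simp add: L0)
  next
    case (step c x y)
    have x: "lc P (case_prod B) x = \<zero>\<^bsub>P\<^esub> \<and> Poly_Mapping.keys x \<subseteq> ?C"
    proof -
      have add2: "Poly_Mapping.keys (basis_vec (a,b) + basis_vec (c,d)) \<subseteq> ?C"
         "lc P (case_prod B) (basis_vec (a, b) + basis_vec (c, d)) = B a b \<oplus>\<^bsub>P\<^esub> B c d"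
        if "a \<in> carrier M" "b \<in> carrier N" "c \<in> carrier M" "d \<in> carrier N" for a b c d
        using that keys_add[of "basis_vec (a,b)" "basis_vec (c,d)"] by (auto simp: L_add L_basis)
      have sc: "Poly_Mapping.keys (cscale c (basis_vec (a,b))) \<subseteq> ?C"
         "lc P (case_prod B) (cscale c (basis_vec (a, b))) = c \<odot>\<^bsub>P\<^esub> B a b"
        if "a \<in> carrier M" "b \<in> carrier N" for a b c
        using that keys_cscale[of c "basis_vec (a,b)"]
        by (auto simp: L_smult L_basis simp del: cscale_single)
      note rel = step(1)[unfolded bilinear_relators_def diff_diff_eq]
      from rel consider (1) a a' b where "x = basis_vec (a \<oplus>\<^bsub>M\<^esub> a', b) - (basis_vec (a, b) + basis_vec (a', b))"
           "a \<in> carrier M" "a' \<in> carrier M" "b \<in> carrier N"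
        | (2) a b b' where "x = basis_vec (a, b \<oplus>\<^bsub>N\<^esub> b') - (basis_vec (a, b) + basis_vec (a, b'))"
           "a \<in> carrier M" "b \<in> carrier N" "b' \<in> carrier N"
        | (3) c a b where "x = basis_vec (c \<odot>\<^bsub>M\<^esub> a, b) - cscale c (basis_vec (a, b))"
            "a \<in> carrier M" "b \<in> carrier N"
        | (4) c a b where "x = basis_vec (a, c \<odot>\<^bsub>N\<^esub> b) - cscale c (basis_vec (a, b))"
            "a \<in> carrier M" "b \<in> carrier N"
        by blast
      then show ?thesis
      proof cases
        case 1
        then show ?thesis unfolding 1(1)
          by (intro diff) (simp_all add: add2 L_basis clin_add[OF bilinD2[OF assms(4)]])
      next
        case 2
        then show ?thesis unfolding 2(1)
          by (intro diff) (simp_all add: add2 L_basis clin_add[OF bilinD1[OF assms(4)]])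
      next
        case 3
        then show ?thesis unfolding 3(1)
          by (intro diff) (simp_all add: sc L_basis clin_smult[OF bilinD2[OF assms(4)]] del: cscale_single)
      next
        case 4
        then show ?thesis unfolding 4(1)
          by (intro diff) (simp_all add: sc L_basis clin_smult[OF bilinD1[OF assms(4)]] del: cscale_single)
      qed
    qed
    have kc: "Poly_Mapping.keys (cscale c x) \<subseteq> ?C" using x keys_cscale[of c x] by auto
    have "lc P (case_prod B) (cscale c x + y) = lc P (case_prod B) (cscale c x) \<oplus>\<^bsub>P\<^esub> \<zero>\<^bsub>P\<^esub>"
      using L_add[OF kc, of y] step by simp
    also have "lc P (case_prod B) (cscale c x) = \<zero>\<^bsub>P\<^esub>"
      using L_smult[of x c] x P.smult_zero_right by simp
    finally show ?case using keys_add[of "cscale c x" y] kc step by auto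
  qed
  define r where "r = (SOME r. r \<in> tensor_class M N p)"
  have "r \<in> tensor_class M N p"
    unfolding r_def by (rule someI, rule tensor_class_self)
  then have "r - p \<in> pm.span (bilinear_relators M N)" by (simp add: tensor_class_def)
  from key[OF this] have rp: "lc P (case_prod B) (r - p) = \<zero>\<^bsub>P\<^esub>" "Poly_Mapping.keys (r - p) \<subseteq> ?C"
    by auto
  have "lc P (case_prod B) r = lc P (case_prod B) p"
    using L_add[OF rp(2) assms(5)] rp(1) clin_closed[OF lin, of p] assms(5) by simp
  moreover have "tensor_lift P B (tensor_class M N p) = lc P (case_prod B) r"
    unfolding tensor_lift_def lc_def r_def[symmetric] Let_def by (simp add: case_prod_unfold)
  ultimately show ?thesis by simp
qed

context
  fixes M :: "(complex, 'a) module" and N :: "(complex, 'b) module" and P :: "(complex, 'c) module"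
  assumes MNP: "cvs M" "cvs N" "cvs P"
begin

lemma tensor_lift_tens:
  assumes "bilin M N P B" "x \<in> carrier M" "y \<in> carrier N"
  shows "tensor_lift P B (tens M N x y) = B x y"
  unfolding tens_def using assms bilin_closed[OF assms]
  by (subst tensor_lift_class[OF MNP assms(1)]) (auto simp: cvs.lc_basis[OF MNP(3)])

lemma clin_tensor_lift:
  assumes "bilin M N P B"
  shows "clin (tensor_vs M N) P (tensor_lift P B)"
proof -
  have lin: "clin (free_vs (carrier M \<times> carrier N)) P (lc P (case_prod B))"
    by (rule cvs.clin_lc[OF MNP(3)]) (auto intro: bilin_closed[OF assms])
  show ?thesis
  proof (rule clinI)
    fix X assume "X \<in> carrier (tensor_vs M N)"
    then obtain p where p: "X = tensor_class M N p" "Poly_Mapping.keys p \<subseteq> carrier M \<times> carrier N"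
      by (auto simp: tensor_vs_simps)
    then show "tensor_lift P B X \<in> carrier P"
      using clin_closed[OF lin] by (simp add: tensor_lift_class[OF MNP assms])
    fix c
    have "Poly_Mapping.keys (cscale c p) \<subseteq> carrier M \<times> carrier N"
      using p keys_cscale[of c p] by auto
    then show "tensor_lift P B (c \<odot>\<^bsub>tensor_vs M N\<^esub> X) = c \<odot>\<^bsub>P\<^esub> tensor_lift P B X"
      using p clin_smult[OF lin, of p c]
      by (simp add: tensor_class_smult tensor_lift_class[OF MNP assms])
    fix Y assume "Y \<in> carrier (tensor_vs M N)"
    then obtain r where r: "Y = tensor_class M N r" "Poly_Mapping.keys r \<subseteq> carrier M \<times> carrier N"
      by (auto simp: tensor_vs_simps)
    have "Poly_Mapping.keys (p + r) \<subseteq> carrier M \<times> carrier N"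
      using p r keys_add[of p r] by auto
    then show "tensor_lift P B (X \<oplus>\<^bsub>tensor_vs M N\<^esub> Y) = tensor_lift P B X \<oplus>\<^bsub>P\<^esub> tensor_lift P B Y"
      using p r clin_add[OF lin, of p r]
      by (simp add: tensor_class_add tensor_lift_class[OF MNP assms])
  qed
qed

text \<open>The uniqueness half of the universal property. Linearity is used in one factor at a
  time, first in the second with the left factor in \<open>S\<close>, then in the first.\<close>

lemma tensor_map_unique:
  assumes "clin (tensor_vs M N) P f" "clin (tensor_vs M N) P g"
    and "S \<subseteq> carrier M" "carrier M \<subseteq> lspan M S" "T \<subseteq> carrier N" "carrier N \<subseteq> lspan N T"
    and "\<And>x y. x \<in> S \<Longrightarrow> y \<in> T \<Longrightarrow> f (tens M N x y) = g (tens M N x y)"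
    and "X \<in> carrier (tensor_vs M N)"
  shows "f X = g X"
proof (rule clin_eq_on_lspan[OF cvs_tensor_vs MNP(3) assms(1,2) _ _ tensor_vs_lspan[OF assms(8)]])
  fix Z assume "Z \<in> case_prod (tens M N) ` (carrier M \<times> carrier N)"
  then obtain x y where Z: "Z = tens M N x y" "x \<in> carrier M" "y \<in> carrier N" by auto
  have 1: "f (tens M N s y) = g (tens M N s y)" if s: "s \<in> S" for s
  proof (rule clin_eq_on_lspan[OF MNP(2,3) _ _ assms(5)])
    show "clin N P (\<lambda>y. f (tens M N s y))" "clin N P (\<lambda>y. g (tens M N s y))"
      using s assms(1,2,3) by (auto intro!: clin_comp[OF bilinD1[OF bilin_tens]])
    show "y \<in> lspan N T" using Z assms by auto
  qed (use s assms(7) in auto)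
  have "f (tens M N x y) = g (tens M N x y)"
  proof (rule clin_eq_on_lspan[OF MNP(1,3) _ _ assms(3)])
    show "clin M P (\<lambda>x. f (tens M N x y))" "clin M P (\<lambda>x. g (tens M N x y))"
      using Z(3) assms(1,2) by (auto intro!: clin_comp[OF bilinD2[OF bilin_tens]])
    show "x \<in> lspan M S" using Z assms by auto
  qed (use 1 in auto)
  then show "f Z = g Z" by (simp add: Z)
qed (auto simp: tens_closed)

end

section \<open>Tensor products of algebras\<close>

lemma tensor_alg_simps:
  "carrier (tensor_alg M N) = carrier (tensor_vs M N)"
  "zero (tensor_alg M N) = zero (tensor_vs M N)"
  "add (tensor_alg M N) = add (tensor_vs M N)"
  "smult (tensor_alg M N) = smult (tensor_vs M N)"
  "one (tensor_alg M N) = tens M N \<one>\<^bsub>M\<^esub> \<one>\<^bsub>N\<^esub>"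
  by (simp_all add: tensor_alg_def tensor_vs_def)

lemma clin_tensor_alg [simp]:
  "clin (tensor_alg M N) P = clin (tensor_vs M N) P"
  "clin P (tensor_alg M N) = clin P (tensor_vs M N)"
  by (auto simp: fun_eq_iff clin_def tensor_alg_simps)

lemma cvs_cong:
  assumes "cvs M" "carrier N = carrier M" "zero N = zero M" "add N = add M" "smult N = smult M"
  shows "cvs N"
  by (rule cvs_image[OF assms(1), where f = id]) (auto simp: assms(2-))

lemma cvs_tensor_alg: "cvs (tensor_alg M N)"
  by (rule cvs_cong[OF cvs_tensor_vs]) (simp_all add: tensor_alg_simps)

lemma finsum_tensor_alg: "finsum (tensor_alg M N) = finsum (tensor_vs M N)"
  by (simp add: fun_eq_iff finsum_def tensor_alg_simps)

lemma tensor_map_tens: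
  assumes "cvs M" "cvs N" "clin M M' f" "clin N N' g" "x \<in> carrier M" "y \<in> carrier N"
  shows "tensor_map M' N' f g (tens M N x y) = tens M' N' (f x) (g y)"
  unfolding tensor_map_def
  by (rule tensor_lift_tens[OF assms(1,2) cvs_tensor_vs bilin_comp[OF bilin_tens assms(3,4)] assms(5,6)])

lemma clin_tensor_map:
  assumes "cvs M" "cvs N" "clin M M' f" "clin N N' g"
  shows "clin (tensor_vs M N) (tensor_vs M' N') (tensor_map M' N' f g)"
  unfolding tensor_map_def
  by (rule clin_tensor_lift[OF assms(1,2) cvs_tensor_vs bilin_comp[OF bilin_tens assms(3,4)]])

lemma complex_algebraI:
  assumes "cvs A" "ring A"
    "\<And>c x y. x \<in> carrier A \<Longrightarrow> y \<in> carrier A \<Longrightarrow> (c \<odot>\<^bsub>A\<^esub> x) \<otimes>\<^bsub>A\<^esub> y = c \<odot>\<^bsub>A\<^esub> (x \<otimes>\<^bsub>A\<^esub> y)"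
    "\<And>c x y. x \<in> carrier A \<Longrightarrow> y \<in> carrier A \<Longrightarrow> x \<otimes>\<^bsub>A\<^esub> (c \<odot>\<^bsub>A\<^esub> y) = c \<odot>\<^bsub>A\<^esub> (x \<otimes>\<^bsub>A\<^esub> y)"
  shows "complex_algebra A"
  using assms by (intro complex_algebra.intro complex_algebra_axioms.intro) (auto simp: module_complex_alg_iff)

lemma bilin_mult:
  assumes "complex_algebra A"
  shows "bilin A A A (mult A)"
proof -
  interpret ring A by (rule complex_algebra_ring[OF assms])
  show ?thesis unfolding bilin_def
    using complex_algebra.smult_mult_left[OF assms] complex_algebra.smult_mult_right[OF assms]
    by (intro conjI ballI clinI) (auto simp: l_distr r_distr)
qed

lemma bilinear_algebraI:
  assumes "cvs A" "bilin A A A (mult A)" "\<one>\<^bsub>A\<^esub> \<in> carrier A"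
    "\<And>x. x \<in> carrier A \<Longrightarrow> \<one>\<^bsub>A\<^esub> \<otimes>\<^bsub>A\<^esub> x = x" "\<And>x. x \<in> carrier A \<Longrightarrow> x \<otimes>\<^bsub>A\<^esub> \<one>\<^bsub>A\<^esub> = x"
    "\<And>x y z. x \<in> carrier A \<Longrightarrow> y \<in> carrier A \<Longrightarrow> z \<in> carrier A \<Longrightarrow>
       (x \<otimes>\<^bsub>A\<^esub> y) \<otimes>\<^bsub>A\<^esub> z = x \<otimes>\<^bsub>A\<^esub> (y \<otimes>\<^bsub>A\<^esub> z)"
  shows "complex_algebra A"
proof (rule complex_algebraI[OF assms(1)])
  interpret cvs A by fact
  show "ring A"
    by (rule ringI[OF abelian_group_axioms monoidI])
      (auto simp: assms(3-6) bilin_closed[OF assms(2)]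
        clin_add[OF bilinD1[OF assms(2)]] clin_add[OF bilinD2[OF assms(2)]])
qed (simp_all add: clin_smult[OF bilinD1[OF assms(2)]] clin_smult[OF bilinD2[OF assms(2)]])

text \<open>Serves two constructions: quotient algebras, with \<open>f\<close> the coset map, and
  the quantum exterior algebra, with \<open>f\<close> the antisymmetrizer on the free
  algebra.\<close>

lemma complex_algebra_image:
  fixes A :: "(complex, 'a) module" and B :: "(complex, 'b) module"
  assumes "complex_algebra A"
    and carr: "carrier B = f ` carrier A"
    and add: "\<And>x y. x \<in> carrier A \<Longrightarrow> y \<in> carrier A \<Longrightarrow> f x \<oplus>\<^bsub>B\<^esub> f y = f (x \<oplus>\<^bsub>A\<^esub> y)"
    and smult: "\<And>c x. x \<in> carrier A \<Longrightarrow> c \<odot>\<^bsub>B\<^esub> f x = f (c \<odot>\<^bsub>A\<^esub> x)"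
    and mult: "\<And>x y. x \<in> carrier A \<Longrightarrow> y \<in> carrier A \<Longrightarrow> f x \<otimes>\<^bsub>B\<^esub> f y = f (x \<otimes>\<^bsub>A\<^esub> y)"
    and zero: "\<zero>\<^bsub>B\<^esub> = f \<zero>\<^bsub>A\<^esub>" and one: "\<one>\<^bsub>B\<^esub> = f \<one>\<^bsub>A\<^esub>"
  shows "complex_algebra B"
proof (rule complex_algebraI)
  interpret A: complex_algebra A by fact
  interpret A': cvs A by (rule complex_algebra_cvs[OF assms(1)])
  show B: "cvs B" by (rule cvs_image[OF A'.cvs_axioms carr add smult zero])
  interpret B: cvs B by fact
  show "ring B"
    by (rule ringI[OF B.abelian_group_axioms monoidI])
     (auto simp: carr add mult one A.m_assoc A.l_distr A.r_distr)
qed (auto simp: carr smult mult complex_algebra.smult_mult_left[OF assms(1)]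
      complex_algebra.smult_mult_right[OF assms(1)] cvs.smult_closed[OF complex_algebra_cvs[OF assms(1)]]
      monoid.m_closed[OF ring.is_monoid[OF complex_algebra_ring[OF assms(1)]]])

lemma lspan_carrier: "carrier M \<subseteq> lspan M (carrier M)"
  by (auto intro: lspan_base)

text \<open>Linearity in the parameter \<open>z\<close> amounts to identities between linear maps in
  \<open>Z\<close>, so pure tensors suffice. This handles nested lifts, such as the product of a
  tensor algebra and the associator, in which the lifted map depends on a further argument.\<close>

lemma bilin_tensor_lift:
  assumes M: "cvs M" and N: "cvs N" and P: "cvs P" and Q: "cvs Q"
    and bil: "\<And>z. z \<in> carrier P \<Longrightarrow> bilin M N Q (B z)"
    and lin: "\<And>x y. x \<in> carrier M \<Longrightarrow> y \<in> carrier N \<Longrightarrow> clin P Q (\<lambda>z. B z x y)"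
  shows "bilin (tensor_vs M N) P Q (\<lambda>Z z. tensor_lift Q (B z) Z)"
  unfolding bilin_def
proof (intro conjI ballI)
  interpret Q: cvs Q by fact
  interpret P: cvs P by fact
  note lift = clin_tensor_lift[OF M N Q bil]
  note uniq = tensor_map_unique[OF M N Q _ _ order.refl lspan_carrier order.refl lspan_carrier]
  show "clin (tensor_vs M N) Q (tensor_lift Q (B z))" if "z \<in> carrier P" for z
    by (rule lift[OF that])
  show "clin P Q (\<lambda>z. tensor_lift Q (B z) Z)" if Z: "Z \<in> carrier (tensor_vs M N)" for Z
  proof (rule clinI)
    fix z assume z: "z \<in> carrier P"
    then show "tensor_lift Q (B z) Z \<in> carrier Q" by (rule clin_closed[OF lift Z])
    show "tensor_lift Q (B (c \<odot>\<^bsub>P\<^esub> z)) Z = c \<odot>\<^bsub>Q\<^esub> tensor_lift Q (B z) Z" for c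
      by (rule uniq[OF lift Q.clin_smult_fun[OF lift] _ Z])
        (simp_all add: z tensor_lift_tens[OF M N Q bil] clin_smult[OF lin])
    fix z' assume z': "z' \<in> carrier P"
    show "tensor_lift Q (B (z \<oplus>\<^bsub>P\<^esub> z')) Z = tensor_lift Q (B z) Z \<oplus>\<^bsub>Q\<^esub> tensor_lift Q (B z') Z"
      by (rule uniq[OF lift Q.clin_add_fun[OF lift lift] _ Z])
        (simp_all add: z z' tensor_lift_tens[OF M N Q bil] clin_add[OF lin])
  qed
qed

context
  fixes M :: "(complex, 'a) module" and N :: "(complex, 'b) module"
  assumes M: "complex_algebra M" and N: "complex_algebra N"
begin

interpretation M: ring M by (rule complex_algebra_ring[OF M])
interpretation N: ring N by (rule complex_algebra_ring[OF N])

private abbreviation (input) "T \<equiv> tensor_vs M N"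

private lemmas cM = complex_algebra_cvs[OF M]
private lemmas cN = complex_algebra_cvs[OF N]
private lemmas cT = cvs_tensor_vs[of M N]
private lemmas uniq = tensor_map_unique[OF cM cN cT _ _ order.refl lspan_carrier order.refl lspan_carrier]

text \<open>Left multiplication by the pure tensor of \<open>x\<close> and \<open>y\<close>; it is
  the inner one of the two lifts in \<open>tensor_alg\<close>.\<close>

private definition inner where
  "inner x y = tensor_lift T (\<lambda>x' y'. tens M N (x \<otimes>\<^bsub>M\<^esub> x') (y \<otimes>\<^bsub>N\<^esub> y'))"

private lemma bil: "x \<in> carrier M \<Longrightarrow> y \<in> carrier N \<Longrightarrow>
    bilin M N T (\<lambda>x' y'. tens M N (x \<otimes>\<^bsub>M\<^esub> x') (y \<otimes>\<^bsub>N\<^esub> y'))"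
  by (intro bilin_comp[OF bilin_tens] bilinD1[OF bilin_mult] M N)

private lemma inner_lin: "x \<in> carrier M \<Longrightarrow> y \<in> carrier N \<Longrightarrow> clin T T (inner x y)"
  unfolding inner_def by (rule clin_tensor_lift[OF cM cN cT bil])

private lemma inner_tens: "x \<in> carrier M \<Longrightarrow> y \<in> carrier N \<Longrightarrow> x' \<in> carrier M \<Longrightarrow> y' \<in> carrier N \<Longrightarrow>
    inner x y (tens M N x' y') = tens M N (x \<otimes>\<^bsub>M\<^esub> x') (y \<otimes>\<^bsub>N\<^esub> y')"
  unfolding inner_def by (rule tensor_lift_tens[OF cM cN cT bil])

private lemma inner_bilin:
  assumes Y: "Y \<in> carrier T"
  shows "bilin M N T (\<lambda>x y. inner x y Y)"
  unfolding bilin_def inner_def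
proof (intro conjI ballI)
  fix x assume x: "x \<in> carrier M"
  \<comment> \<open>With \<open>x\<close> fixed, \<open>y\<close> becomes the parameter of the
    family of lifts, and \<open>Y\<close> the tensor to which they are applied.\<close>
  have "bilin T N T (\<lambda>Y y. tensor_lift T (\<lambda>x' y'. tens M N (x \<otimes>\<^bsub>M\<^esub> x') (y \<otimes>\<^bsub>N\<^esub> y')) Y)"
    by (rule bilin_tensor_lift[OF cM cN cN cT bil[OF x]], assumption,
        rule clin_comp[OF bilinD2[OF bilin_mult[OF N]] bilinD1[OF bilin_tens]]) (simp_all add: x)
  then show "clin N T (\<lambda>y. tensor_lift T (\<lambda>x' y'. tens M N (x \<otimes>\<^bsub>M\<^esub> x') (y \<otimes>\<^bsub>N\<^esub> y')) Y)"
    by (rule bilinD1[OF _ Y])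
next
  fix y assume y: "y \<in> carrier N"
  have "bilin T M T (\<lambda>Y x. tensor_lift T (\<lambda>x' y'. tens M N (x \<otimes>\<^bsub>M\<^esub> x') (y \<otimes>\<^bsub>N\<^esub> y')) Y)"
    by (rule bilin_tensor_lift[OF cM cN cM cT bil[OF _ y]], assumption,
        rule clin_comp[OF bilinD2[OF bilin_mult[OF M]] bilinD2[OF bilin_tens]]) (simp_all add: y)
  then show "clin M T (\<lambda>x. tensor_lift T (\<lambda>x' y'. tens M N (x \<otimes>\<^bsub>M\<^esub> x') (y \<otimes>\<^bsub>N\<^esub> y')) Y)"
    by (rule bilinD1[OF _ Y])
qed

private lemma mult_eq: "X \<otimes>\<^bsub>tensor_alg M N\<^esub> Y = tensor_lift T (\<lambda>x y. inner x y Y) X"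
  by (simp add: tensor_alg_def inner_def)

lemma tensor_mult_tens:
  "x \<in> carrier M \<Longrightarrow> y \<in> carrier N \<Longrightarrow> x' \<in> carrier M \<Longrightarrow> y' \<in> carrier N \<Longrightarrow>
    tens M N x y \<otimes>\<^bsub>tensor_alg M N\<^esub> tens M N x' y' = tens M N (x \<otimes>\<^bsub>M\<^esub> x') (y \<otimes>\<^bsub>N\<^esub> y')"
  by (simp add: mult_eq tensor_lift_tens[OF cM cN cT inner_bilin] inner_tens tens_closed)

private lemma tensor_mult_bilin: "bilin T T T (mult (tensor_alg M N))"
  unfolding mult_eq[abs_def] by (rule bilin_tensor_lift[OF cM cN cT cT inner_bilin inner_lin])

private lemmas mult_lin_left = bilinD2[OF tensor_mult_bilin]
private lemmas mult_lin_right = bilinD1[OF tensor_mult_bilin]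

text \<open>Both sides of associativity are trilinear. The three stages release the third, the
  second and the first argument in turn from being a pure tensor.\<close>

lemma complex_algebra_tensor: "complex_algebra (tensor_alg M N)"
proof -
  let ?m = "mult (tensor_alg M N)"
  note bil = tensor_mult_bilin
  have one: "tens M N \<one>\<^bsub>M\<^esub> \<one>\<^bsub>N\<^esub> \<in> carrier T" by (simp add: tens_closed)
  note closed = bilin_closed[OF bil]
  have assoc1: "?m (?m (tens M N a b) (tens M N c d)) Z = ?m (tens M N a b) (?m (tens M N c d) Z)"
    if "a \<in> carrier M" "b \<in> carrier N" "c \<in> carrier M" "d \<in> carrier N" "Z \<in> carrier T" for a b c d Z
  proof (rule uniq[where X = Z])
    show "clin T T (\<lambda>Z. ?m (?m (tens M N a b) (tens M N c d)) Z)"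
      using that by (intro mult_lin_right closed) (simp_all add: tens_closed)
    show "clin T T (\<lambda>Z. ?m (tens M N a b) (?m (tens M N c d) Z))"
      using that by (intro clin_comp[OF mult_lin_right mult_lin_right]) (simp_all add: tens_closed)
  qed (use that in \<open>simp_all add: tensor_mult_tens M.m_assoc N.m_assoc\<close>)
  have assoc2: "?m (?m (tens M N a b) Y) Z = ?m (tens M N a b) (?m Y Z)"
    if "a \<in> carrier M" "b \<in> carrier N" "Y \<in> carrier T" "Z \<in> carrier T" for a b Y Z
  proof (rule uniq[where X = Y])
    show "clin T T (\<lambda>Y. ?m (?m (tens M N a b) Y) Z)"
      using that by (intro clin_comp[OF mult_lin_right mult_lin_left]) (simp_all add: tens_closed)
    show "clin T T (\<lambda>Y. ?m (tens M N a b) (?m Y Z))"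
      using that by (intro clin_comp[OF mult_lin_left mult_lin_right]) (simp_all add: tens_closed)
  qed (use that assoc1 in \<open>simp_all add: tens_closed\<close>)
  have assoc: "?m (?m X Y) Z = ?m X (?m Y Z)"
    if "X \<in> carrier T" "Y \<in> carrier T" "Z \<in> carrier T" for X Y Z
  proof (rule uniq[where X = X])
    show "clin T T (\<lambda>X. ?m (?m X Y) Z)"
      using that by (intro clin_comp[OF mult_lin_left mult_lin_left])
    show "clin T T (\<lambda>X. ?m X (?m Y Z))"
      using that by (intro mult_lin_left closed)
  qed (use that assoc2 in simp_all)
  have l_one: "?m (tens M N \<one>\<^bsub>M\<^esub> \<one>\<^bsub>N\<^esub>) X = X" if "X \<in> carrier T" for X
    by (rule uniq[OF mult_lin_right[OF one] clin_id _ that]) (simp add: tensor_mult_tens)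
  have r_one: "?m X (tens M N \<one>\<^bsub>M\<^esub> \<one>\<^bsub>N\<^esub>) = X" if "X \<in> carrier T" for X
    by (rule uniq[OF mult_lin_left[OF one] clin_id _ that]) (simp add: tensor_mult_tens)
  show ?thesis by (rule bilinear_algebraI[OF cvs_tensor_alg])
      (use bil in \<open>simp_all add: bilin_def tensor_alg_simps one l_one r_one assoc\<close>)
qed

end

section \<open>The free algebra\<close>

lemma free_algebra_simps [simp]:
  "carrier free_algebra = UNIV" "mult free_algebra = (*)" "one free_algebra = 1"
  "zero free_algebra = 0" "add free_algebra = (+)" "smult free_algebra = cscale"
  by (simp_all add: free_algebra_def)

text \<open>Scalars are multiples of the empty word and can be inserted on either side, so
  compatibility of the convolution product with scaling becomes associativity.\<close>

lemma cscale_single_mult: "cscale c p = Poly_Mapping.single 0 c * (p :: 'a list \<Rightarrow>\<^sub>0 complex)"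
  by (subst (1 2) poly_mapping_sum_basis)
    (simp add: sum_distrib_left pm.scale_sum_right mult_single)

lemma cscale_mult_single: "cscale c p = (p :: 'a list \<Rightarrow>\<^sub>0 complex) * Poly_Mapping.single 0 c"
  by (subst (1 2) poly_mapping_sum_basis)
    (simp add: sum_distrib_right pm.scale_sum_right mult_single mult.commute)

lemma cscale_mult_left: "cscale c p * r = cscale c (p * r :: 'a list \<Rightarrow>\<^sub>0 complex)"
  by (simp add: cscale_single_mult mult.assoc)

lemma cscale_mult_right: "p * cscale c r = cscale c (p * r :: 'a list \<Rightarrow>\<^sub>0 complex)"
  by (simp add: cscale_mult_single mult.assoc)

lemma basis_mult: "basis_vec u * basis_vec v = (basis_vec (u @ v) :: 'a list \<Rightarrow>\<^sub>0 complex)"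
  by (simp add: mult_single plus_list_def)

lemma one_eq_basis: "(1 :: 'a list \<Rightarrow>\<^sub>0 complex) = basis_vec []"
  by (simp flip: zero_list_def)

lemma cvs_free_algebra: "cvs free_algebra"
  by (rule cvs_cong[OF cvs_free_vs[of UNIV]]) simp_all

lemma clin_free_algebra: "clin (free_algebra :: (complex, 'a list \<Rightarrow>\<^sub>0 complex) module) P f \<longleftrightarrow> clin (free_vs UNIV) P f"
  by (simp add: clin_def)

lemma complex_algebra_free: "complex_algebra free_algebra"
  by (rule bilinear_algebraI[OF cvs_free_algebra])
    (auto simp: bilin_def clin_def algebra_simps cscale_mult_left cscale_mult_right)

lemma free_algebra_lspan: "carrier free_algebra \<subseteq> lspan free_algebra (range basis_vec)"
proof
  fix p :: "'a list \<Rightarrow>\<^sub>0 complex"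
  have "p \<in> lspan (free_vs UNIV) (range basis_vec)"
    by (rule free_vs_lspan) simp
  then show "p \<in> lspan free_algebra (range basis_vec)"
  proof induction
    case lspan_zero
    show ?case using lspan.lspan_zero[of free_algebra] by simp
  next
    case (lspan_base x)
    then show ?case by (rule lspan.lspan_base)
  next
    case (lspan_add x y)
    show ?case using lspan.lspan_add[OF lspan_add.IH] by simp
  next
    case (lspan_smult x c)
    show ?case using lspan.lspan_smult[OF lspan_smult.IH, of c] by simp
  qed
qed

lemma free_algebra_ext:
  assumes "cvs P" "clin free_algebra P f" "clin free_algebra P g" "\<And>w. f (basis_vec w) = g (basis_vec w)"
  shows "f p = g p"
  by (rule clin_eq_on_lspan[OF cvs_free_algebra assms(1-3), where S = "range basis_vec"])
    (use assms(4) free_algebra_lspan in auto)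

subsection \<open>Quotient algebras\<close>

lemma alg_quot_simps:
  "carrier (alg_quot A J) = carrier (A Quot J)" "mult (alg_quot A J) = mult (A Quot J)"
  "one (alg_quot A J) = one (A Quot J)" "zero (alg_quot A J) = zero (A Quot J)"
  "add (alg_quot A J) = add (A Quot J)"
  "smult (alg_quot A J) = (\<lambda>c X. \<Union>x\<in>X. J +>\<^bsub>A\<^esub> (c \<odot>\<^bsub>A\<^esub> x))"
  by (simp_all add: alg_quot_def ring.defs module.defs)

context
  fixes A :: "(complex, 'a) module" and J
  assumes A: "complex_algebra A" and J: "ideal J A"
begin

interpretation J: ideal J A by (rule J)
interpretation V: cvs A by (rule complex_algebra_cvs[OF A])

lemma coset_eq_iff:
  assumes "x \<in> carrier A" "y \<in> carrier A"
  shows "J +>\<^bsub>A\<^esub> x = J +>\<^bsub>A\<^esub> y \<longleftrightarrow> x \<ominus>\<^bsub>A\<^esub> y \<in> J"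
  using J.quotient_eq_iff_same_a_r_cos[OF J assms] by simp

lemma alg_quot_ops:
  assumes "x \<in> carrier A" "y \<in> carrier A"
  shows "(J +>\<^bsub>A\<^esub> x) \<oplus>\<^bsub>alg_quot A J\<^esub> (J +>\<^bsub>A\<^esub> y) = J +>\<^bsub>A\<^esub> (x \<oplus>\<^bsub>A\<^esub> y)"
    and "(J +>\<^bsub>A\<^esub> x) \<otimes>\<^bsub>alg_quot A J\<^esub> (J +>\<^bsub>A\<^esub> y) = J +>\<^bsub>A\<^esub> (x \<otimes>\<^bsub>A\<^esub> y)"
  using J.rcoset_mult_add[OF assms] J.a_rcos_sum[OF assms]
  by (simp_all add: alg_quot_simps FactRing_def)

text \<open>A ring ideal absorbs the scalar multiple of the unit by \<open>c\<close>, and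
  multiplication by that element is scaling by \<open>c\<close>.\<close>

lemma ideal_smult: "x \<in> J \<Longrightarrow> c \<odot>\<^bsub>A\<^esub> x \<in> J"
proof -
  assume x: "x \<in> J"
  have "(c \<odot>\<^bsub>A\<^esub> \<one>\<^bsub>A\<^esub>) \<otimes>\<^bsub>A\<^esub> x \<in> J"
    by (rule J.I_l_closed[OF x]) simp
  then show ?thesis
    using complex_algebra.smult_mult_left[OF A, of "\<one>\<^bsub>A\<^esub>" x c] x by (simp add: J.Icarr)
qed

lemma alg_quot_smult:
  assumes "x \<in> carrier A"
  shows "c \<odot>\<^bsub>alg_quot A J\<^esub> (J +>\<^bsub>A\<^esub> x) = J +>\<^bsub>A\<^esub> (c \<odot>\<^bsub>A\<^esub> x)"
proof -
  have "J +>\<^bsub>A\<^esub> (c \<odot>\<^bsub>A\<^esub> y) = J +>\<^bsub>A\<^esub> (c \<odot>\<^bsub>A\<^esub> x)" if y: "y \<in> J +>\<^bsub>A\<^esub> x" for y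
  proof -
    have yc: "y \<in> carrier A" using y assms J.a_r_coset_subset_G[OF J.a_subset] by blast
    obtain j where j: "j \<in> J" "y = j \<oplus>\<^bsub>A\<^esub> x" using y by (auto simp: a_r_coset_def')
    have "c \<odot>\<^bsub>A\<^esub> y = c \<odot>\<^bsub>A\<^esub> j \<oplus>\<^bsub>A\<^esub> c \<odot>\<^bsub>A\<^esub> x"
      using j assms by (simp add: V.smult_r_distr J.Icarr)
    then have "c \<odot>\<^bsub>A\<^esub> y \<in> J +>\<^bsub>A\<^esub> (c \<odot>\<^bsub>A\<^esub> x)"
      using ideal_smult[OF j(1)] by (auto simp: a_r_coset_def')
    then show ?thesis using J.a_repr_independence'[of "c \<odot>\<^bsub>A\<^esub> y" "c \<odot>\<^bsub>A\<^esub> x"] assms by simp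
  qed
  moreover have "x \<in> J +>\<^bsub>A\<^esub> x" using assms by (rule J.a_rcos_self)
  ultimately have "(\<Union>y\<in>J +>\<^bsub>A\<^esub> x. J +>\<^bsub>A\<^esub> (c \<odot>\<^bsub>A\<^esub> y)) = J +>\<^bsub>A\<^esub> (c \<odot>\<^bsub>A\<^esub> x)"
    by (intro SUP_eq_const) blast+
  then show ?thesis by (simp add: alg_quot_simps)
qed

lemma alg_quot_carrier: "carrier (alg_quot A J) = (+>\<^bsub>A\<^esub>) J ` carrier A"
  by (auto simp: alg_quot_simps FactRing_def A_RCOSETS_def')

lemma alg_quot_zero_one:
  "\<zero>\<^bsub>alg_quot A J\<^esub> = J +>\<^bsub>A\<^esub> \<zero>\<^bsub>A\<^esub>" "\<one>\<^bsub>alg_quot A J\<^esub> = J +>\<^bsub>A\<^esub> \<one>\<^bsub>A\<^esub>"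
  using J.a_coset_add_zero[OF J.a_subset]
  by (simp_all add: alg_quot_simps FactRing_def)

lemma complex_algebra_alg_quot: "complex_algebra (alg_quot A J)"
  by (rule complex_algebra_image[OF A alg_quot_carrier])
    (simp_all add: alg_quot_ops alg_quot_smult alg_quot_zero_one)

end

section \<open>Finite sums of pure tensors and sums indexed by words\<close>

lemma tens_add_left: "x \<in> carrier M \<Longrightarrow> x' \<in> carrier M \<Longrightarrow> y \<in> carrier N \<Longrightarrow>
    tens M N (x \<oplus>\<^bsub>M\<^esub> x') y = tens M N x y \<oplus>\<^bsub>tensor_vs M N\<^esub> tens M N x' y"
  by (rule clin_add[OF bilinD2[OF bilin_tens]])

lemma tens_smult_left: "x \<in> carrier M \<Longrightarrow> y \<in> carrier N \<Longrightarrow>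
    tens M N (c \<odot>\<^bsub>M\<^esub> x) y = c \<odot>\<^bsub>tensor_vs M N\<^esub> tens M N x y"
  by (rule clin_smult[OF bilinD2[OF bilin_tens]])

lemma tens_finsum_left: "cvs M \<Longrightarrow> (\<And>a. a \<in> A \<Longrightarrow> f a \<in> carrier M) \<Longrightarrow> y \<in> carrier N \<Longrightarrow>
    tens M N (finsum M f A) y = finsum (tensor_vs M N) (\<lambda>a. tens M N (f a) y) A"
  by (rule clin_finsum[OF _ cvs_tensor_vs bilinD2[OF bilin_tens]])

lemma tens_finsum_right: "cvs N \<Longrightarrow> (\<And>a. a \<in> A \<Longrightarrow> f a \<in> carrier N) \<Longrightarrow> x \<in> carrier M \<Longrightarrow>
    tens M N x (finsum N f A) = finsum (tensor_vs M N) (\<lambda>a. tens M N x (f a)) A"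
  by (rule clin_finsum[OF _ cvs_tensor_vs bilinD1[OF bilin_tens]])

lemma finsum_cvs_cong:
  assumes "cvs M" "\<And>a. a \<in> A \<Longrightarrow> f a = g a" "\<And>a. a \<in> A \<Longrightarrow> g a \<in> carrier M"
  shows "finsum M f A = finsum M g A"
proof -
  interpret cvs M by fact
  show ?thesis using assms by (intro finsum_cong') auto
qed

lemma finsum_cvs_closed:
  assumes "cvs M" "\<And>a. a \<in> A \<Longrightarrow> f a \<in> carrier M"
  shows "finsum M f A \<in> carrier M"
proof -
  interpret cvs M by fact
  show ?thesis using assms by (intro finsum_closed) auto
qed

lemmas tensor_sum_cong = finsum_cvs_cong[OF cvs_tensor_vs]
lemmas tensor_sum_closed = finsum_cvs_closed[OF cvs_tensor_vs]

abbreviation words :: "nat \<Rightarrow> 'i list set" where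
  "words n \<equiv> {ws. length ws = n}"

lemma finite_words [simp]: "finite (words n :: ('i::finite) list set)"
  using finite_lists_length_eq[of "UNIV :: 'i set" n] by simp

lemma words_add_bij: "bij_betw (\<lambda>(u, v). u @ v) (words m \<times> words n) (words (m + n))"
  by (rule bij_betw_byWitness[where f' = "\<lambda>w. (take m w, drop m w)"]) auto

lemma words_two_bij: "bij_betw (\<lambda>(k, l). [k, l]) UNIV (words 2)"
  by (rule bij_betw_byWitness[where f' = "\<lambda>w. (w ! 0, w ! 1)"])
    (auto simp: numeral_2_eq_2 length_Suc_conv)

lemma finsum_words_add:
  assumes "cvs P" "\<And>w. length w = m + n \<Longrightarrow> f w \<in> carrier P"
  shows "finsum P f (words (m + n) :: ('i::finite) list set) =
    finsum P (\<lambda>u. finsum P (\<lambda>v. f (u @ v)) (words n)) (words m)"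
  using finsum_bij_Times[OF assms(1) words_add_bij finite_words finite_words, of m n f] assms(2) by simp

section \<open>The FRT algebra\<close>

lemma alg_prod_simps [simp]:
  "alg_prod A [] = \<one>\<^bsub>A\<^esub>" "alg_prod A (x # xs) = x \<otimes>\<^bsub>A\<^esub> alg_prod A xs"
  by (simp_all add: alg_prod_def)

lemma alg_prod_closed:
  assumes "complex_algebra A" "set xs \<subseteq> carrier A"
  shows "alg_prod A xs \<in> carrier A"
proof -
  interpret ring A by (rule complex_algebra_ring[OF assms(1)])
  show ?thesis using assms(2) by (induction xs) auto
qed

lemma alg_prod_append:
  assumes "complex_algebra A" "set xs \<subseteq> carrier A" "set ys \<subseteq> carrier A"
  shows "alg_prod A (xs @ ys) = alg_prod A xs \<otimes>\<^bsub>A\<^esub> alg_prod A ys"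
proof -
  interpret ring A by (rule complex_algebra_ring[OF assms(1)])
  show ?thesis using assms(2) by (induction xs) (auto simp: alg_prod_closed assms m_assoc)
qed

definition frt_class :: "('i::finite) endo2 \<Rightarrow> (('i \<times> 'i) list \<Rightarrow>\<^sub>0 complex) \<Rightarrow> 'i frt_elem" where
  "frt_class \<sigma> p = frt_ideal \<sigma> +>\<^bsub>free_algebra\<^esub> p"

lemma ideal_frt: "ideal (frt_ideal \<sigma>) free_algebra"
  unfolding frt_ideal_def
  by (rule ring.genideal_ideal[OF complex_algebra_ring[OF complex_algebra_free]]) simp

lemma complex_algebra_frt: "complex_algebra (frt \<sigma>)"
  unfolding frt_def by (rule complex_algebra_alg_quot[OF complex_algebra_free ideal_frt])

lemmas cvs_frt = complex_algebra_cvs[OF complex_algebra_frt]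

lemma carrier_frt: "carrier (frt \<sigma>) = range (frt_class \<sigma>)"
  by (simp add: frt_def frt_class_def [abs_def] alg_quot_carrier[OF complex_algebra_free ideal_frt])

lemma frt_class_closed [simp]: "frt_class \<sigma> p \<in> carrier (frt \<sigma>)"
  by (simp add: carrier_frt)

lemma frt_class_ops:
  "frt_class \<sigma> p \<oplus>\<^bsub>frt \<sigma>\<^esub> frt_class \<sigma> r = frt_class \<sigma> (p + r)"
  "frt_class \<sigma> p \<otimes>\<^bsub>frt \<sigma>\<^esub> frt_class \<sigma> r = frt_class \<sigma> (p * r)"
  "c \<odot>\<^bsub>frt \<sigma>\<^esub> frt_class \<sigma> p = frt_class \<sigma> (cscale c p)"
  "\<zero>\<^bsub>frt \<sigma>\<^esub> = frt_class \<sigma> 0" "\<one>\<^bsub>frt \<sigma>\<^esub> = frt_class \<sigma> 1"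
  using alg_quot_ops[OF complex_algebra_free ideal_frt, of p r]
    alg_quot_smult[OF complex_algebra_free ideal_frt, of p]
    alg_quot_zero_one[OF complex_algebra_free ideal_frt]
  by (simp_all add: frt_def frt_class_def)

lemma clin_frt_class: "clin free_algebra (frt \<sigma>) (frt_class \<sigma>)"
  by (rule clinI) (simp_all add: frt_class_ops)

lemma free_minus: "x \<ominus>\<^bsub>free_algebra\<^esub> y = x - y"
proof -
  interpret cvs free_algebra by (rule cvs_free_algebra)
  have "\<ominus>\<^bsub>free_algebra\<^esub> y = - y" by (rule minus_equality) auto
  then show ?thesis by (simp add: a_minus_def)
qed

lemma frt_class_eq_iff: "frt_class \<sigma> p = frt_class \<sigma> r \<longleftrightarrow> p - r \<in> frt_ideal \<sigma>"
  using coset_eq_iff[OF complex_algebra_free ideal_frt, of p r] by (simp add: frt_class_def free_minus)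

lemma T_gen_eq: "T_gen \<sigma> i j = frt_class \<sigma> (basis_vec [(i, j)])"
  by (simp add: T_gen_def frt_class_def)

lemma alg_prod_T_gen: "alg_prod (frt \<sigma>) (map (\<lambda>(j, i). T_gen \<sigma> j i) u) = frt_class \<sigma> (basis_vec u)"
  by (induction u) (auto simp: frt_class_ops T_gen_eq one_eq_basis basis_mult)

lemma T_mono_eq: "T_mono \<sigma> js is = frt_class \<sigma> (basis_vec (zip js is))"
  by (simp add: T_mono_def alg_prod_T_gen)

lemma T_mono_closed [simp]: "T_mono \<sigma> js is \<in> carrier (frt \<sigma>)"
  by (simp add: T_mono_eq)

lemma T_mono_append: "length js = length is \<Longrightarrow>
    T_mono \<sigma> (js @ js') (is @ is') = T_mono \<sigma> js is \<otimes>\<^bsub>frt \<sigma>\<^esub> T_mono \<sigma> js' is'"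
  by (simp add: T_mono_eq frt_class_ops basis_mult)

lemma T_mono_Nil: "T_mono \<sigma> [] [] = \<one>\<^bsub>frt \<sigma>\<^esub>"
  by (simp add: T_mono_eq frt_class_ops one_eq_basis)

definition T_monos :: "('i::finite) endo2 \<Rightarrow> 'i frt_elem set" where
  "T_monos \<sigma> = {T_mono \<sigma> js is |js is. length js = length is}"

text \<open>A word in the letters \<open>(j, i)\<close> is the \<open>zip\<close> of its upper and
  its lower indices, so every monomial in the generators is a matrix entry
  \<open>T_mono\<close>.\<close>

lemma frt_lspan: "carrier (frt \<sigma>) \<subseteq> lspan (frt \<sigma>) (T_monos \<sigma>)"
proof
  fix X assume "X \<in> carrier (frt \<sigma>)"
  then obtain p where p: "X = frt_class \<sigma> p" by (auto simp: carrier_frt)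
  have "frt_class \<sigma> p \<in> lspan (frt \<sigma>) (frt_class \<sigma> ` range basis_vec)"
    by (rule clin_image_lspan[OF cvs_free_algebra cvs_frt clin_frt_class])
      (use free_algebra_lspan in auto)
  moreover have "frt_class \<sigma> (basis_vec u) \<in> T_monos \<sigma>" for u unfolding T_monos_def T_mono_eq
    by (intro CollectI exI[of _ "map fst u"] exI[of _ "map snd u"]) (simp add: zip_map_fst_snd)
  ultimately show "X \<in> lspan (frt \<sigma>) (T_monos \<sigma>)"
    unfolding p by (elim lspan_subset[rotated]) (auto intro: lspan_base)
qed

lemma T_monos_closed: "T_monos \<sigma> \<subseteq> carrier (frt \<sigma>)"
  by (auto simp: T_monos_def)

text \<open>Index pairs become words of length two. Then the matrix of \<open>\<sigma>\<close> and
  the matrix \<open>T_mono\<close> are indexed alike, and a relation can be inserted into longer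
  words by concatenation.\<close>

definition coef_word :: "'i endo2 \<Rightarrow> 'i list \<Rightarrow> 'i list \<Rightarrow> complex" where
  "coef_word \<sigma> is ks = coef \<sigma> (is ! 0) (is ! 1) (ks ! 0) (ks ! 1)"

lemma sum_words_two: "(\<Sum>(k, l)\<in>UNIV. f k l) = (\<Sum>ks\<in>words 2. f (ks ! 0) (ks ! 1))"
  using sum.reindex_bij_betw[OF words_two_bij, of "\<lambda>ks. f (ks ! 0) (ks ! 1)"]
  by (simp add: case_prod_unfold)

lemma finsum_free_algebra: "finite A \<Longrightarrow> finsum free_algebra f A = sum f A"
proof (induction A rule: finite_induct)
  interpret cvs free_algebra by (rule cvs_free_algebra)
  {
    case empty
    show ?case by simp
  next
    case (insert x F)
    then show ?case by (subst finsum_insert) auto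
  }
qed

lemma clin_sum:
  assumes "cvs P" "clin free_algebra P f" "finite A"
  shows "f (sum g A) = finsum P (\<lambda>a. f (g a)) A"
  using clin_finsum[OF cvs_free_algebra assms(1,2), of A g] by (simp add: finsum_free_algebra assms(3))

lemma frt_relators_words:
  "frt_relators \<sigma> =
    {(\<Sum>ks\<in>words 2. cscale (coef_word \<sigma> is ks) (basis_vec (zip ms ks))) -
     (\<Sum>ks\<in>words 2. cscale (coef_word \<sigma> ks ms) (basis_vec (zip ks is))) |is ms. length is = 2 \<and> length ms = 2}"
proof -
  have 1: "(\<Sum>(k, l)\<in>UNIV. cscale (coef \<sigma> i j k l) (basis_vec [(m, k), (n, l)])) =
      (\<Sum>ks\<in>words 2. cscale (coef_word \<sigma> [i, j] ks) (basis_vec (zip [m, n] ks)))" for i j m n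
    unfolding sum_words_two coef_word_def
    by (rule sum.cong) (auto simp: numeral_2_eq_2 length_Suc_conv)
  have 2: "(\<Sum>(k, l)\<in>UNIV. cscale (coef \<sigma> k l m n) (basis_vec [(k, i), (l, j)])) =
      (\<Sum>ks\<in>words 2. cscale (coef_word \<sigma> ks [m, n]) (basis_vec (zip ks [i, j])))" for i j m n
    unfolding sum_words_two coef_word_def
    by (rule sum.cong) (auto simp: numeral_2_eq_2 length_Suc_conv)
  have 3: "(\<exists>is ms. P is ms \<and> length is = 2 \<and> length ms = 2) \<longleftrightarrow> (\<exists>i j m n. P [i, j] [m, n])"
    for P :: "'a list \<Rightarrow> 'a list \<Rightarrow> bool"
    by (auto simp: numeral_2_eq_2 length_Suc_conv) blast+
  show ?thesis unfolding frt_relators_def set_eq_iff mem_Collect_eq 1 2 3 by simp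
qed

text \<open>In entries, the statement that the matrix of the \<open>T_mono \<sigma> ms ks\<close> in
  degree two commutes with the matrix of \<open>\<sigma>\<close>.\<close>

lemma frt_relation:
  assumes "length is = 2" "length ms = 2"
  shows "finsum (frt \<sigma>) (\<lambda>ks. coef_word \<sigma> is ks \<odot>\<^bsub>frt \<sigma>\<^esub> T_mono \<sigma> ms ks) (words 2) =
    finsum (frt \<sigma>) (\<lambda>ks. coef_word \<sigma> ks ms \<odot>\<^bsub>frt \<sigma>\<^esub> T_mono \<sigma> ks is) (words 2)"
proof -
  let ?a = "\<Sum>ks\<in>words 2. cscale (coef_word \<sigma> is ks) (basis_vec (zip ms ks))"
  let ?b = "\<Sum>ks\<in>words 2. cscale (coef_word \<sigma> ks ms) (basis_vec (zip ks is))"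
  have "?a - ?b \<in> frt_relators \<sigma>"
    unfolding frt_relators_words using assms by blast
  then have "?a - ?b \<in> frt_ideal \<sigma>" unfolding frt_ideal_def
    using ring.genideal_self[OF complex_algebra_ring[OF complex_algebra_free], of "frt_relators \<sigma>"] by auto
  then have "frt_class \<sigma> ?a = frt_class \<sigma> ?b" by (simp add: frt_class_eq_iff)
  then show ?thesis by (simp add: clin_sum[OF cvs_frt clin_frt_class] T_mono_eq frt_class_ops)
qed

subsection \<open>Homomorphisms out of the FRT algebra\<close>

context
  fixes P :: "(complex, 'c) module" and g :: "('i::finite) \<times> 'i \<Rightarrow> 'c" and \<sigma> :: "'i endo2"
  assumes P: "complex_algebra P" and g: "\<And>a. g a \<in> carrier P"
    and rel: "\<And>is ms. length is = 2 \<Longrightarrow> length ms = 2 \<Longrightarrow>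
      finsum P (\<lambda>ks. coef_word \<sigma> is ks \<odot>\<^bsub>P\<^esub> alg_prod P (map g (zip ms ks))) (words 2) =
      finsum P (\<lambda>ks. coef_word \<sigma> ks ms \<odot>\<^bsub>P\<^esub> alg_prod P (map g (zip ks is))) (words 2)"
begin

interpretation P: ring P by (rule complex_algebra_ring[OF P])
interpretation PV: cvs P by (rule complex_algebra_cvs[OF P])

text \<open>Evaluation of noncommutative polynomials at \<open>g\<close>; the homomorphism out of
  the FRT algebra is induced by it.\<close>

private definition "ev = lc P (\<lambda>w. alg_prod P (map g w))"

private lemma prod_closed: "alg_prod P (map g w) \<in> carrier P"
  by (rule alg_prod_closed[OF P]) (use g in auto)

private lemma clin_ev: "clin free_algebra P ev"
  unfolding clin_free_algebra ev_def by (rule PV.clin_lc) (simp add: prod_closed)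

private lemma ev_basis: "ev (basis_vec w) = alg_prod P (map g w)"
  unfolding ev_def by (rule PV.lc_basis) (rule prod_closed)

private lemma ev_closed [simp]: "ev p \<in> carrier P"
  using clin_closed[OF clin_ev] by simp

private lemma ev_add: "ev (p + r) = ev p \<oplus>\<^bsub>P\<^esub> ev r"
  using clin_add[OF clin_ev, of p r] by simp

private lemma ev_cscale: "ev (cscale c p) = c \<odot>\<^bsub>P\<^esub> ev p"
  using clin_smult[OF clin_ev, of p c] by simp

private lemma ev_mult: "ev (p * r) = ev p \<otimes>\<^bsub>P\<^esub> ev r"
proof (rule free_algebra_ext[OF PV.cvs_axioms, of _ _ p])
  have mb: "bilin P P P (mult P)" by (rule bilin_mult[OF P])
  have fb: "bilin free_algebra free_algebra free_algebra (mult free_algebra)"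
    by (rule bilin_mult[OF complex_algebra_free])
  show "clin free_algebra P (\<lambda>p. ev (p * r))"
    using clin_comp[OF bilinD2[OF fb, of r] clin_ev] by simp
  show "clin free_algebra P (\<lambda>p. ev p \<otimes>\<^bsub>P\<^esub> ev r)"
    by (rule clin_comp[OF clin_ev bilinD2[OF mb]]) simp
  fix u
  show "ev (basis_vec u * r) = ev (basis_vec u) \<otimes>\<^bsub>P\<^esub> ev r"
  proof (rule free_algebra_ext[OF PV.cvs_axioms, of _ _ r])
    show "clin free_algebra P (\<lambda>r. ev (basis_vec u * r))"
      using clin_comp[OF bilinD1[OF fb, of "basis_vec u"] clin_ev] by simp
    show "clin free_algebra P (\<lambda>r. ev (basis_vec u) \<otimes>\<^bsub>P\<^esub> ev r)"
      by (rule clin_comp[OF clin_ev bilinD1[OF mb]]) simp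
    fix v
    show "ev (basis_vec u * basis_vec v) = ev (basis_vec u) \<otimes>\<^bsub>P\<^esub> ev (basis_vec v)"
      using alg_prod_append[OF P, of "map g u" "map g v"] g
      by (simp add: basis_mult ev_basis image_subset_iff)
  qed
qed

private lemma ev_zero: "ev 0 = \<zero>\<^bsub>P\<^esub>"
  using clin_zero[OF cvs_free_algebra PV.cvs_axioms clin_ev] by simp

private lemma ev_diff: "ev (p - r) = \<zero>\<^bsub>P\<^esub> \<longleftrightarrow> ev p = ev r"
  using ev_add[of "p - r" r] P.add.r_cancel_one[of "ev r" "ev (p - r)"] by auto

private lemma ideal_ev: "ideal {p. ev p = \<zero>\<^bsub>P\<^esub>} free_algebra"
proof (rule idealI[OF complex_algebra_ring[OF complex_algebra_free]])
  interpret F: cvs "free_algebra :: (complex, ('i \<times> 'i) list \<Rightarrow>\<^sub>0 complex) module" by (rule cvs_free_algebra)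
  show "subgroup {p. ev p = \<zero>\<^bsub>P\<^esub>} (add_monoid free_algebra)"
  proof (rule F.add.subgroupI)
    fix a assume "a \<in> {p. ev p = \<zero>\<^bsub>P\<^esub>}"
    moreover have "\<ominus>\<^bsub>free_algebra\<^esub> a = 0 - a" using free_minus[of 0 a] by (simp add: a_minus_def)
    ultimately show "\<ominus>\<^bsub>free_algebra\<^esub> a \<in> {p. ev p = \<zero>\<^bsub>P\<^esub>}"
      using ev_diff[of 0 a] by (simp add: ev_zero)
  qed (use ev_zero in \<open>auto simp: ev_add\<close>)
qed (auto simp: ev_mult)

text \<open>The kernel of the evaluation is a two-sided ideal and contains the relators by
  \<open>rel\<close>, so it contains the ideal generated by them.\<close>

private lemma ideal_le: "p \<in> frt_ideal \<sigma> \<Longrightarrow> ev p = \<zero>\<^bsub>P\<^esub>"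
proof -
  have "frt_relators \<sigma> \<subseteq> {p. ev p = \<zero>\<^bsub>P\<^esub>}"
    by (auto simp: frt_relators_words ev_diff clin_sum[OF PV.cvs_axioms clin_ev] ev_cscale ev_basis rel
        simp del: cscale_single)
  then have "frt_ideal \<sigma> \<subseteq> {p. ev p = \<zero>\<^bsub>P\<^esub>}" unfolding frt_ideal_def
    by (rule ring.genideal_minimal[OF complex_algebra_ring[OF complex_algebra_free] ideal_ev])
  then show "p \<in> frt_ideal \<sigma> \<Longrightarrow> ev p = \<zero>\<^bsub>P\<^esub>" by auto
qed

private lemma frt_lift_class: "frt_lift P g (frt_class \<sigma> p) = ev p"
proof -
  define r where "r = (SOME r. r \<in> frt_class \<sigma> p)"
  interpret I: ideal "frt_ideal \<sigma>" free_algebra by (rule ideal_frt)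
  have "p \<in> frt_class \<sigma> p"
    unfolding frt_class_def by (rule I.a_rcos_self) simp
  then have "r \<in> frt_class \<sigma> p" unfolding r_def by (rule someI)
  then obtain j where "j \<in> frt_ideal \<sigma>" "r = j + p" by (auto simp: frt_class_def a_r_coset_def')
  then have "ev r = ev p" by (simp add: ev_add ideal_le)
  moreover have "frt_lift P g (frt_class \<sigma> p) = ev r"
    unfolding frt_lift_def ev_def lc_def r_def[symmetric] Let_def ..
  ultimately show ?thesis by simp
qed

lemma frt_lift_hom: "frt_lift P g \<in> alg_hom (frt \<sigma>) P"
  unfolding alg_hom_def ring_hom_def
  by (auto simp: carrier_frt frt_class_ops frt_lift_class ev_add ev_mult ev_cscale one_eq_basis ev_basis)

lemma frt_lift_T_mono: "frt_lift P g (T_mono \<sigma> js is) = alg_prod P (map g (zip js is))"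
  by (simp add: T_mono_eq frt_lift_class ev_basis)

end

lemma alg_hom_clin: "f \<in> alg_hom A B \<Longrightarrow> clin A B f"
  by (auto simp: alg_hom_def ring_hom_def clin_def)

lemma bilin_finsum:
  assumes "cvs M" "cvs N" "cvs P" "bilin M N P B"
    and "\<And>a. a \<in> A \<Longrightarrow> f a \<in> carrier M" "\<And>b. b \<in> C \<Longrightarrow> g b \<in> carrier N"
  shows "B (finsum M f A) (finsum N g C) = finsum P (\<lambda>a. finsum P (\<lambda>b. B (f a) (g b)) C) A"
proof -
  have "B (finsum M f A) (finsum N g C) = finsum P (\<lambda>a. B (f a) (finsum N g C)) A"
    using clin_finsum[OF assms(1,3) bilinD2[OF assms(4)], of "finsum N g C" A f]
    by (simp add: finsum_cvs_closed[OF assms(2)] assms(5,6))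
  also have "\<dots> = finsum P (\<lambda>a. finsum P (\<lambda>b. B (f a) (g b)) C) A"
    by (intro finsum_cvs_cong[OF assms(3)] finsum_cvs_closed[OF assms(3)]
        clin_finsum[OF assms(2,3) bilinD1[OF assms(4)]] bilin_closed[OF assms(4)] assms(5,6))
  finally show ?thesis .
qed

lemma tensor_mult_finsum:
  assumes M: "complex_algebra M" and N: "complex_algebra N"
    and "\<And>a. a \<in> A \<Longrightarrow> x a \<in> carrier M" "\<And>a. a \<in> A \<Longrightarrow> y a \<in> carrier N"
    and "\<And>b. b \<in> B \<Longrightarrow> x' b \<in> carrier M" "\<And>b. b \<in> B \<Longrightarrow> y' b \<in> carrier N"
  shows "finsum (tensor_vs M N) (\<lambda>a. tens M N (x a) (y a)) A \<otimes>\<^bsub>tensor_alg M N\<^esub>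
      finsum (tensor_vs M N) (\<lambda>b. tens M N (x' b) (y' b)) B =
    finsum (tensor_vs M N) (\<lambda>a. finsum (tensor_vs M N)
      (\<lambda>b. tens M N (x a \<otimes>\<^bsub>M\<^esub> x' b) (y a \<otimes>\<^bsub>N\<^esub> y' b)) B) A" (is "?L = ?R")
proof -
  interpret M: ring M by (rule complex_algebra_ring[OF M])
  interpret N: ring N by (rule complex_algebra_ring[OF N])
  let ?T = "tensor_vs M N"
  have bil: "bilin ?T ?T ?T (mult (tensor_alg M N))"
    using bilin_mult[OF complex_algebra_tensor[OF M N]] by (simp add: bilin_def tensor_alg_simps)
  have "?L = finsum ?T (\<lambda>a. finsum ?T (\<lambda>b. tens M N (x a) (y a) \<otimes>\<^bsub>tensor_alg M N\<^esub> tens M N (x' b) (y' b)) B) A"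
    by (rule bilin_finsum[OF cvs_tensor_vs cvs_tensor_vs cvs_tensor_vs bil])
      (simp_all add: assms tens_closed)
  also have "\<dots> = ?R" by (intro tensor_sum_cong tensor_sum_closed tens_closed)
      (simp_all add: assms tensor_mult_tens[OF M N])
  finally show ?thesis .
qed

lemma bilin_tensor_alg [simp]:
  "bilin (tensor_alg M N) P Q = bilin (tensor_vs M N) P Q"
  "bilin P (tensor_alg M N) Q = bilin P (tensor_vs M N) Q"
  by (auto simp: fun_eq_iff bilin_def tensor_alg_simps)

context
  fixes M :: "(complex, 'a) module" and N :: "(complex, 'b) module" and P :: "(complex, 'c) module"
  assumes MNP: "cvs M" "cvs N" "cvs P"
begin

private abbreviation (input) "Q \<equiv> tensor_vs M (tensor_alg N P)"

private lemma bil1: "z \<in> carrier P \<Longrightarrow> bilin M N Q (\<lambda>x y. tens M (tensor_alg N P) x (tens N P y z))"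
  by (rule bilin_comp[OF bilin_tens clin_id]) (simp add: bilinD2[OF bilin_tens])

private lemma bil2: "bilin (tensor_alg M N) P Q
    (\<lambda>Z z. tensor_lift Q (\<lambda>x y. tens M (tensor_alg N P) x (tens N P y z)) Z)"
  unfolding bilin_tensor_alg
proof (rule bilin_tensor_lift[OF MNP cvs_tensor_vs bil1])
  fix x y assume "x \<in> carrier M" "y \<in> carrier N"
  then show "clin P Q (\<lambda>z. tens M (tensor_alg N P) x (tens N P y z))"
    by (metis bilinD1 bilin_tens clin_comp clin_tensor_alg(1))
qed

lemma clin_tensor_assoc: "clin (tensor_vs (tensor_alg M N) P) Q (tensor_assoc M N P)"
  unfolding tensor_assoc_def
  by (rule clin_tensor_lift[OF cvs_tensor_alg MNP(3) cvs_tensor_vs bil2])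

lemma tensor_assoc_tens:
  assumes "x \<in> carrier M" "y \<in> carrier N" "z \<in> carrier P"
  shows "tensor_assoc M N P (tens (tensor_alg M N) P (tens M N x y) z) = tens M (tensor_alg N P) x (tens N P y z)"
  unfolding tensor_assoc_def
  by (subst tensor_lift_tens[OF cvs_tensor_alg MNP(3) cvs_tensor_vs bil2])
    (simp_all add: assms tensor_alg_simps tens_closed tensor_lift_tens[OF MNP(1,2) cvs_tensor_vs bil1])

end

subsection \<open>Matrix coefficients\<close>

lemma finsum_unit_coeff:
  assumes fin: "finite I" and "cvs P" "\<And>t. t \<in> I \<Longrightarrow> f t \<in> carrier P" "s \<in> I"
  shows "finsum P (\<lambda>t. (if t = s then 1 else 0) \<odot>\<^bsub>P\<^esub> f t) I = f s"
proof -
  interpret P: cvs P by fact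
  have "finsum P (\<lambda>t. (if t = s then 1 else 0) \<odot>\<^bsub>P\<^esub> f t) I =
      finsum P (\<lambda>t. if s = t then f t else \<zero>\<^bsub>P\<^esub>) I"
    using assms(3,4) by (intro finsum_cvs_cong[OF assms(2)]) auto
  also have "\<dots> = f s" using assms(3,4) fin by (intro P.finsum_singleton) auto
  finally show ?thesis .
qed


context
  fixes M :: "(complex, 'm) module" and H :: "(complex, 'h) module"
    and \<delta> :: "'m \<Rightarrow> ('m \<times> 'h \<Rightarrow>\<^sub>0 complex) set" and \<Delta> :: "'h \<Rightarrow> ('h \<times> 'h \<Rightarrow>\<^sub>0 complex) set"
    and I :: "'s set" and a :: "'s \<Rightarrow> 'm" and b :: "'s \<Rightarrow> 's \<Rightarrow> 'h"
  assumes M: "cvs M" and H: "cvs H" and fin: "finite I"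
    and a: "\<And>t. t \<in> I \<Longrightarrow> a t \<in> carrier M"
    and b: "\<And>t s. t \<in> I \<Longrightarrow> s \<in> I \<Longrightarrow> b t s \<in> carrier H"
    and \<delta>: "\<And>s. s \<in> I \<Longrightarrow> \<delta> (a s) = finsum (tensor_vs M H) (\<lambda>t. tens M H (a t) (b t s)) I"
begin

text \<open>Both sides expand to the sum over \<open>t\<close> and \<open>u\<close> of
  \<open>a u\<close> tensored with \<open>b u t\<close> and \<open>b t s\<close>, with the
  summations in opposite order. Applied with \<open>a\<close> a row of the matrix
  \<open>T_mono\<close>, it is coassociativity of the coproduct; with \<open>a\<close> the
  antisymmetrized words, it is coassociativity of the coaction.\<close>

lemma matrix_coassoc:
  assumes lin: "clin M (tensor_vs M H) \<delta>" "clin H (tensor_vs H H) \<Delta>"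
    and \<Delta>: "\<And>t s. t \<in> I \<Longrightarrow> s \<in> I \<Longrightarrow>
      \<Delta> (b t s) = finsum (tensor_vs H H) (\<lambda>u. tens H H (b t u) (b u s)) I"
    and s: "s \<in> I"
  shows "tensor_assoc M H H (tensor_map (tensor_alg M H) H \<delta> (\<lambda>h. h) (\<delta> (a s))) =
    tensor_map M (tensor_alg H H) (\<lambda>y. y) \<Delta> (\<delta> (a s))"
proof -
  let ?Q = "tensor_vs M (tensor_alg H H)"
  let ?L = "tensor_vs (tensor_alg M H) H"
  have t3: "tens (tensor_alg M H) H (tens M H (a u) (b u t)) (b t s) \<in> carrier ?L"
    if "t \<in> I" "u \<in> I" for t u
    using that a b s by (intro tens_closed) (simp_all add: tensor_alg_simps tens_closed)
  have "tensor_map (tensor_alg M H) H \<delta> (\<lambda>h. h) (\<delta> (a s)) =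
      finsum ?L (\<lambda>t. tensor_map (tensor_alg M H) H \<delta> (\<lambda>h. h) (tens M H (a t) (b t s))) I"
    unfolding \<delta>[OF s] by (rule clin_finsum[OF cvs_tensor_vs cvs_tensor_vs clin_tensor_map[OF M H]])
      (simp_all add: lin clin_id a b s tens_closed)
  also have "\<dots> = finsum ?L (\<lambda>t. finsum ?L (\<lambda>u. tens (tensor_alg M H) H (tens M H (a u) (b u t)) (b t s)) I) I"
  proof (intro tensor_sum_cong tensor_sum_closed t3)
    fix t assume t: "t \<in> I"
    have "tensor_map (tensor_alg M H) H \<delta> (\<lambda>h. h) (tens M H (a t) (b t s)) =
        tens (tensor_alg M H) H (finsum (tensor_alg M H) (\<lambda>u. tens M H (a u) (b u t)) I) (b t s)"
      using t s a b by (subst tensor_map_tens[OF M H]) (simp_all add: lin clin_id finsum_tensor_alg \<delta>)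
    also have "\<dots> = finsum ?L (\<lambda>u. tens (tensor_alg M H) H (tens M H (a u) (b u t)) (b t s)) I"
      using t s a b by (intro tens_finsum_left cvs_tensor_alg) (simp_all add: tensor_alg_simps tens_closed)
    finally show "tensor_map (tensor_alg M H) H \<delta> (\<lambda>h. h) (tens M H (a t) (b t s)) = \<dots>" .
  qed
  finally have "tensor_assoc M H H (tensor_map (tensor_alg M H) H \<delta> (\<lambda>h. h) (\<delta> (a s))) =
      finsum ?Q (\<lambda>t. tensor_assoc M H H (finsum ?L (\<lambda>u. tens (tensor_alg M H) H (tens M H (a u) (b u t)) (b t s)) I)) I"
    by (simp only:)
      (intro clin_finsum[OF cvs_tensor_vs cvs_tensor_vs clin_tensor_assoc[OF M H H]]
        tensor_sum_closed t3)
  also have "\<dots> = finsum ?Q (\<lambda>t. finsum ?Q (\<lambda>u. tens M (tensor_alg H H) (a u) (tens H H (b u t) (b t s))) I) I"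
  proof (intro tensor_sum_cong tensor_sum_closed)
    fix t assume t: "t \<in> I"
    have "tensor_assoc M H H (finsum ?L (\<lambda>u. tens (tensor_alg M H) H (tens M H (a u) (b u t)) (b t s)) I) =
      finsum ?Q (\<lambda>u. tensor_assoc M H H (tens (tensor_alg M H) H (tens M H (a u) (b u t)) (b t s))) I"
      by (rule clin_finsum[OF cvs_tensor_vs cvs_tensor_vs clin_tensor_assoc[OF M H H] t3[OF t]])
    also have "\<dots> = finsum ?Q (\<lambda>u. tens M (tensor_alg H H) (a u) (tens H H (b u t) (b t s))) I"
      using t s a b by (intro tensor_sum_cong)
        (simp_all add: tensor_assoc_tens[OF M H H] tensor_alg_simps tens_closed)
    finally show "tensor_assoc M H H (finsum ?L (\<lambda>u. tens (tensor_alg M H) H (tens M H (a u) (b u t)) (b t s)) I) =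
      finsum ?Q (\<lambda>u. tens M (tensor_alg H H) (a u) (tens H H (b u t) (b t s))) I" .
  qed (use s a b in \<open>simp add: tensor_alg_simps tens_closed\<close>)
  also have "\<dots> = finsum ?Q (\<lambda>u. finsum ?Q (\<lambda>t. tens M (tensor_alg H H) (a u) (tens H H (b u t) (b t s))) I) I"
    using s a b by (intro finsum_swap[OF cvs_tensor_vs fin fin]) (simp add: tensor_alg_simps tens_closed)
  also have "\<dots> = finsum ?Q (\<lambda>u. tens M (tensor_alg H H) (a u) (\<Delta> (b u s))) I"
  proof (intro tensor_sum_cong)
    fix u assume u: "u \<in> I"
    show "finsum ?Q (\<lambda>t. tens M (tensor_alg H H) (a u) (tens H H (b u t) (b t s))) I =
        tens M (tensor_alg H H) (a u) (\<Delta> (b u s))"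
      using u s a b tens_finsum_right[OF cvs_tensor_alg, of I "\<lambda>t. tens H H (b u t) (b t s)" H H "a u" M]
      by (simp add: \<Delta> finsum_tensor_alg tensor_alg_simps tens_closed)
    show "tens M (tensor_alg H H) (a u) (\<Delta> (b u s)) \<in> carrier ?Q"
      using u s a b clin_closed[OF lin(2)] by (simp add: tensor_alg_simps tens_closed)
  qed
  also have "\<dots> = finsum ?Q (\<lambda>u. tensor_map M (tensor_alg H H) (\<lambda>y. y) \<Delta> (tens M H (a u) (b u s))) I"
    using s a b clin_closed[OF lin(2)] by (intro tensor_sum_cong)
      (simp_all add: tensor_map_tens[OF M H] clin_id lin tensor_alg_simps tens_closed)
  also have "\<dots> = tensor_map M (tensor_alg H H) (\<lambda>y. y) \<Delta> (\<delta> (a s))" unfolding \<delta>[OF s]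
    by (rule clin_finsum[OF cvs_tensor_vs cvs_tensor_vs clin_tensor_map[OF M H], symmetric])
      (simp_all add: lin clin_id a b s tens_closed)
  finally show ?thesis .
qed

text \<open>The contraction \<open>B\<close> turns column \<open>s\<close> of the matrix
  \<open>b\<close> into a unit vector, so only the term \<open>t = s\<close> survives.\<close>

lemma matrix_counit:
  assumes B: "bilin M H P B" and P: "cvs P"
    and e: "\<And>t. t \<in> I \<Longrightarrow> B (a t) (b t s) = (if t = s then 1 else 0) \<odot>\<^bsub>P\<^esub> f t"
    and f: "\<And>t. t \<in> I \<Longrightarrow> f t \<in> carrier P" and s: "s \<in> I"
  shows "tensor_lift P B (\<delta> (a s)) = f s"
proof -
  interpret P: cvs P by fact
  have "tensor_lift P B (\<delta> (a s)) = finsum P (\<lambda>t. tensor_lift P B (tens M H (a t) (b t s))) I"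
    unfolding \<delta>[OF s] by (rule clin_finsum[OF cvs_tensor_vs P clin_tensor_lift[OF M H P B]])
      (simp_all add: a b s tens_closed)
  also have "\<dots> = finsum P (\<lambda>t. (if t = s then 1 else 0) \<odot>\<^bsub>P\<^esub> f t) I"
    using s a b f by (intro finsum_cvs_cong[OF P])
      (simp_all add: tensor_lift_tens[OF M H P B] e)
  also have "\<dots> = f s" by (rule finsum_unit_coeff[OF fin P f s])
  finally show ?thesis .
qed

end

lemma words_Suc_bij: "bij_betw (\<lambda>(k, ks). k # ks) (UNIV \<times> words n) (words (Suc n))"
  by (rule bij_betw_byWitness[where f' = "\<lambda>w. (hd w, tl w)"]) (auto simp: length_Suc_conv)

lemma finsum_words_Suc:
  assumes "cvs P" "\<And>w. length w = Suc n \<Longrightarrow> f w \<in> carrier P"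
  shows "finsum P f (words (Suc n) :: ('i::finite) list set) =
    finsum P (\<lambda>k. finsum P (\<lambda>ks. f (k # ks)) (words n)) UNIV"
  using finsum_bij_Times[OF assms(1) words_Suc_bij finite finite_words, of n f] assms(2) by simp

lemma T_mono_Cons: "T_mono \<sigma> (j # js) (i # is) = T_gen \<sigma> j i \<otimes>\<^bsub>frt \<sigma>\<^esub> T_mono \<sigma> js is"
  by (simp add: T_mono_def)

lemma T_gen_closed [simp]: "T_gen \<sigma> i j \<in> carrier (frt \<sigma>)"
  by (simp add: T_gen_eq)

text \<open>The defining relation, pushed through linear maps that may depend on the upper indices.\<close>

lemma frt_exchange:
  assumes P: "cvs P" and K: "\<And>as. clin (frt \<sigma>) P (K as)" and len: "length is = 2"
  shows "finsum P (\<lambda>ks. coef_word \<sigma> is ks \<odot>\<^bsub>P\<^esub> finsum P (\<lambda>as. K as (T_mono \<sigma> as ks)) (words 2)) (words 2) =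
    finsum P (\<lambda>ks. finsum P (\<lambda>as. coef_word \<sigma> ks as \<odot>\<^bsub>P\<^esub> K as (T_mono \<sigma> ks is)) (words 2)) (words 2)"
proof -
  interpret P: cvs P by fact
  interpret H: cvs "frt \<sigma>" by (rule cvs_frt)
  have [simp]: "K as (T_mono \<sigma> js ks) \<in> carrier P" for as js ks by (rule clin_closed[OF K]) simp
  have "finsum P (\<lambda>ks. coef_word \<sigma> is ks \<odot>\<^bsub>P\<^esub> finsum P (\<lambda>as. K as (T_mono \<sigma> as ks)) (words 2)) (words 2) =
      finsum P (\<lambda>ks. finsum P (\<lambda>as. coef_word \<sigma> is ks \<odot>\<^bsub>P\<^esub> K as (T_mono \<sigma> as ks)) (words 2)) (words 2)"
    by (simp add: P.smult_finsum)
  also have "\<dots> = finsum P (\<lambda>as. finsum P (\<lambda>ks. coef_word \<sigma> is ks \<odot>\<^bsub>P\<^esub> K as (T_mono \<sigma> as ks)) (words 2)) (words 2)"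
    by (rule finsum_swap[OF P]) simp_all
  also have "\<dots> = finsum P (\<lambda>as. K as (finsum (frt \<sigma>) (\<lambda>ks. coef_word \<sigma> is ks \<odot>\<^bsub>frt \<sigma>\<^esub> T_mono \<sigma> as ks) (words 2))) (words 2)"
    by (simp add: clin_finsum[OF cvs_frt P K] clin_smult[OF K])
  also have "\<dots> = finsum P (\<lambda>as. K as (finsum (frt \<sigma>) (\<lambda>ks. coef_word \<sigma> ks as \<odot>\<^bsub>frt \<sigma>\<^esub> T_mono \<sigma> ks is) (words 2))) (words 2)"
    by (intro finsum_cvs_cong[OF P] clin_closed[OF K] finsum_cvs_closed[OF cvs_frt])
      (simp_all add: frt_relation[OF len])
  also have "\<dots> = finsum P (\<lambda>as. finsum P (\<lambda>ks. coef_word \<sigma> ks as \<odot>\<^bsub>P\<^esub> K as (T_mono \<sigma> ks is)) (words 2)) (words 2)"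
    by (simp add: clin_finsum[OF cvs_frt P K] clin_smult[OF K])
  also have "\<dots> = finsum P (\<lambda>ks. finsum P (\<lambda>as. coef_word \<sigma> ks as \<odot>\<^bsub>P\<^esub> K as (T_mono \<sigma> ks is)) (words 2)) (words 2)"
    by (rule finsum_swap[OF P]) simp_all
  finally show ?thesis .
qed

section \<open>The coproduct of the FRT algebra\<close>

context
  fixes \<sigma> :: "('i::finite) endo2"
begin

private abbreviation (input) "H \<equiv> frt \<sigma>"
private abbreviation (input) "HH \<equiv> tensor_vs (frt \<sigma>) (frt \<sigma>)"

private definition cop :: "'i \<times> 'i \<Rightarrow> ('i frt_elem \<times> 'i frt_elem \<Rightarrow>\<^sub>0 complex) set" where
  "cop = (\<lambda>(i, j). finsum (tensor_alg H H) (\<lambda>k. tens H H (T_gen \<sigma> i k) (T_gen \<sigma> k j)) UNIV)"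

private lemma cop_closed: "cop a \<in> carrier (tensor_alg H H)"
  unfolding cop_def case_prod_unfold
  by (rule finsum_cvs_closed[OF cvs_tensor_alg]) (simp add: tensor_alg_simps tens_closed)

lemma T_mono_tens_closed [simp]: "tens H H (T_mono \<sigma> js ks) (T_mono \<sigma> ks' is) \<in> carrier HH"
  by (simp add: tens_closed)

text \<open>The product of a sum over one middle index and a sum over words of middle indices is a
  sum over words longer by one; the letters of each factor multiply to a longer monomial.\<close>

private lemma cop_word:
  "length js = length is \<Longrightarrow> alg_prod (tensor_alg H H) (map cop (zip js is)) =
    finsum HH (\<lambda>ks. tens H H (T_mono \<sigma> js ks) (T_mono \<sigma> ks is)) (words (length js))"
proof (induction js "is" rule: list_induct2)
  case Nil
  interpret HH: cvs HH by (rule cvs_tensor_vs)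
  have "words 0 = {[] :: 'i list}" by auto
  then show ?case by (simp add: tensor_alg_simps HH.finsum_insert T_mono_Nil tens_closed flip: T_mono_Nil)
next
  case (Cons j js i "is")
  have "alg_prod (tensor_alg H H) (map cop (zip (j # js) (i # is))) =
      finsum HH (\<lambda>k. tens H H (T_gen \<sigma> j k) (T_gen \<sigma> k i)) UNIV \<otimes>\<^bsub>tensor_alg H H\<^esub>
      finsum HH (\<lambda>ks. tens H H (T_mono \<sigma> js ks) (T_mono \<sigma> ks is)) (words (length js))"
    by (simp add: Cons.IH) (simp add: cop_def finsum_tensor_alg)
  also have "\<dots> = finsum HH (\<lambda>k. finsum HH (\<lambda>ks.
      tens H H (T_gen \<sigma> j k \<otimes>\<^bsub>H\<^esub> T_mono \<sigma> js ks) (T_gen \<sigma> k i \<otimes>\<^bsub>H\<^esub> T_mono \<sigma> ks is)) (words (length js))) UNIV"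
    by (rule tensor_mult_finsum[OF complex_algebra_frt complex_algebra_frt]) simp_all
  also have "\<dots> = finsum HH (\<lambda>ks. tens H H (T_mono \<sigma> (j # js) ks) (T_mono \<sigma> ks (i # is))) (words (length (j # js)))"
    by (simp add: finsum_words_Suc[OF cvs_tensor_vs] T_mono_Cons)
  finally show ?case .
qed

text \<open>A matrix commuting with two matrices commutes with their product. Here the two are the
  copies of \<open>T_mono\<close> in the left and right tensor factors; the relation is used in the
  right factor, then in the left one.\<close>

private lemma cop_relation:
  assumes "length is = 2" "length ms = 2"
  shows "finsum (tensor_alg H H) (\<lambda>ks. coef_word \<sigma> is ks \<odot>\<^bsub>tensor_alg H H\<^esub>
        alg_prod (tensor_alg H H) (map cop (zip ms ks))) (words 2) =
      finsum (tensor_alg H H) (\<lambda>ks. coef_word \<sigma> ks ms \<odot>\<^bsub>tensor_alg H H\<^esub>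
        alg_prod (tensor_alg H H) (map cop (zip ks is))) (words 2)"
proof -
  interpret HH: cvs HH by (rule cvs_tensor_vs)
  interpret H: cvs H by (rule cvs_frt)
  let ?t = "\<lambda>a b c d. tens H H (T_mono \<sigma> a b) (T_mono \<sigma> c d)"
  have "finsum HH (\<lambda>ks. coef_word \<sigma> is ks \<odot>\<^bsub>HH\<^esub>
        alg_prod (tensor_alg H H) (map cop (zip ms ks))) (words 2) =
      finsum HH (\<lambda>ks. coef_word \<sigma> is ks \<odot>\<^bsub>HH\<^esub> finsum HH (\<lambda>as. ?t ms as as ks) (words 2)) (words 2)"
    by (intro tensor_sum_cong)
      (simp_all add: cop_word assms tensor_sum_closed)
  also have "\<dots> = finsum HH (\<lambda>ks. finsum HH (\<lambda>as. coef_word \<sigma> ks as \<odot>\<^bsub>HH\<^esub> ?t ms as ks is) (words 2)) (words 2)"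
    by (rule frt_exchange[OF cvs_tensor_vs bilinD1[OF bilin_tens] assms(1)]) simp
  also have "\<dots> = finsum HH (\<lambda>ks. finsum HH (\<lambda>as. coef_word \<sigma> as ms \<odot>\<^bsub>HH\<^esub> ?t as ks ks is) (words 2)) (words 2)"
  proof (rule tensor_sum_cong)
    fix ks :: "'i list" assume "ks \<in> words 2"
    then have ks: "length ks = 2" by simp
    have "finsum HH (\<lambda>as. coef_word \<sigma> ks as \<odot>\<^bsub>HH\<^esub> ?t ms as ks is) (words 2) =
        tens H H (finsum H (\<lambda>as. coef_word \<sigma> ks as \<odot>\<^bsub>H\<^esub> T_mono \<sigma> ms as) (words 2)) (T_mono \<sigma> ks is)"
      by (subst tens_finsum_left[OF cvs_frt]) (simp_all add: tens_smult_left)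
    also have "\<dots> = finsum HH (\<lambda>as. coef_word \<sigma> as ms \<odot>\<^bsub>HH\<^esub> ?t as ks ks is) (words 2)"
      unfolding frt_relation[OF ks assms(2)]
      by (subst tens_finsum_left[OF cvs_frt]) (simp_all add: tens_smult_left)
    finally show "finsum HH (\<lambda>as. coef_word \<sigma> ks as \<odot>\<^bsub>HH\<^esub> ?t ms as ks is) (words 2) = \<dots>" .
  qed (simp add: tensor_sum_closed)
  also have "\<dots> = finsum HH (\<lambda>as. finsum HH (\<lambda>ks. coef_word \<sigma> as ms \<odot>\<^bsub>HH\<^esub> ?t as ks ks is) (words 2)) (words 2)"
    by (rule finsum_swap[OF cvs_tensor_vs]) simp_all
  also have "\<dots> = finsum HH (\<lambda>as. coef_word \<sigma> as ms \<odot>\<^bsub>HH\<^esub>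
        alg_prod (tensor_alg H H) (map cop (zip as is))) (words 2)"
    by (intro tensor_sum_cong)
      (simp_all add: cop_word assms HH.smult_finsum tensor_sum_closed)
  finally show ?thesis by (simp add: finsum_tensor_alg tensor_alg_simps)
qed

private lemma frt_coproduct_eq: "frt_coproduct \<sigma> = frt_lift (tensor_alg H H) cop"
  unfolding frt_coproduct_def cop_def ..

lemma frt_coproduct_hom: "frt_coproduct \<sigma> \<in> alg_hom H (tensor_alg H H)"
  unfolding frt_coproduct_eq
  by (rule frt_lift_hom[OF complex_algebra_tensor[OF complex_algebra_frt complex_algebra_frt] cop_closed cop_relation])

lemma clin_frt_coproduct: "clin H HH (frt_coproduct \<sigma>)"
  using alg_hom_clin[OF frt_coproduct_hom] by simp

lemma frt_coproduct_T_mono: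
  assumes "length js = length is"
  shows "frt_coproduct \<sigma> (T_mono \<sigma> js is) =
    finsum HH (\<lambda>ks. tens H H (T_mono \<sigma> js ks) (T_mono \<sigma> ks is)) (words (length js))"
  unfolding frt_coproduct_eq cop_word[OF assms, symmetric]
  by (rule frt_lift_T_mono[OF complex_algebra_tensor[OF complex_algebra_frt complex_algebra_frt] cop_closed cop_relation])

end

section \<open>The counit and the bialgebra axioms\<close>

lemma complex_alg_simps [simp]:
  "carrier complex_alg = UNIV" "mult complex_alg = (*)" "one complex_alg = 1"
  "zero complex_alg = 0" "add complex_alg = (+)" "smult complex_alg = (*)"
  by (simp_all add: complex_alg_def)

lemma complex_algebra_complex_alg: "complex_algebra complex_alg"
proof (rule bilinear_algebraI)
  interpret cring complex_alg by (rule cring_complex_alg)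
  show "cvs complex_alg"
    by unfold_locales (auto simp: algebra_simps)
qed (auto simp: bilin_def clin_def algebra_simps)

lemmas cvs_complex_alg = complex_algebra_cvs[OF complex_algebra_complex_alg]

lemma alg_prod_counit:
  "length js = length is \<Longrightarrow>
    alg_prod complex_alg (map (\<lambda>(i, j). if i = j then 1 else 0) (zip js is)) = (if js = is then 1 else 0)"
  by (induction js "is" rule: list_induct2) auto

lemma finsum_complex_alg: "finite A \<Longrightarrow> finsum complex_alg f A = sum f A"
proof (induction A rule: finite_induct)
  interpret cvs complex_alg by (rule cvs_complex_alg)
  {
    case empty
    show ?case by simp
  next
    case (insert x F)
    then show ?case by (subst finsum_insert) auto
  }
qed

text \<open>The counit sends the matrix \<open>T_mono\<close> to the identity matrix, which commutes
  with that of \<open>\<sigma>\<close>: both sides are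
  \<open>coef_word \<sigma> is ms\<close>.\<close>

lemma counit_relation:
  assumes "length is = 2" "length ms = 2"
  shows "finsum complex_alg (\<lambda>ks. coef_word \<sigma> is ks \<odot>\<^bsub>complex_alg\<^esub>
        alg_prod complex_alg (map (\<lambda>(i, j). if i = j then 1 else 0) (zip ms ks))) (words 2) =
      finsum complex_alg (\<lambda>ks. coef_word \<sigma> ks ms \<odot>\<^bsub>complex_alg\<^esub>
        alg_prod complex_alg (map (\<lambda>(i, j). if i = j then 1 else 0) (zip ks (is :: ('i::finite) list)))) (words 2)"
proof -
  let ?d = "\<lambda>js is. alg_prod complex_alg (map (\<lambda>(i, j). if i = j then 1 else 0) (zip js (is :: 'i list)))"
  have "(\<Sum>ks\<in>words 2. coef_word \<sigma> is ks * ?d ms ks) = (\<Sum>ks\<in>words 2. if ms = ks then coef_word \<sigma> is ks else 0)"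
    by (rule sum.cong[OF refl]) (simp add: alg_prod_counit assms)
  also have "\<dots> = coef_word \<sigma> is ms" using assms by (simp add: sum.delta)
  also have "\<dots> = (\<Sum>ks\<in>words 2. if ks = is then coef_word \<sigma> ks ms else 0)"
    using assms by (simp add: sum.delta)
  also have "\<dots> = (\<Sum>ks\<in>words 2. coef_word \<sigma> ks ms * ?d ks is)"
    by (rule sum.cong[OF refl]) (simp add: alg_prod_counit assms)
  finally show ?thesis by (simp add: finsum_complex_alg)
qed

lemma frt_counit_hom: "frt_counit \<sigma> \<in> alg_hom (frt \<sigma>) complex_alg"
  unfolding frt_counit_def
  by (rule frt_lift_hom[OF complex_algebra_complex_alg _ counit_relation]) simp_all

lemma frt_counit_T_mono:
  assumes "length js = length is"
  shows "frt_counit \<sigma> (T_mono \<sigma> js is) = (if js = is then 1 else 0)"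
  unfolding frt_counit_def alg_prod_counit[OF assms, symmetric]
  by (rule frt_lift_T_mono[OF complex_algebra_complex_alg _ counit_relation]) simp_all

lemma bilin_counit_right:
  assumes "cvs M" "clin H complex_alg \<epsilon>"
  shows "bilin M H M (\<lambda>y h. \<epsilon> h \<odot>\<^bsub>M\<^esub> y)"
proof -
  interpret cvs M by fact
  show ?thesis unfolding bilin_def
    by (auto intro!: clinI simp: clin_add[OF assms(2)] clin_smult[OF assms(2)] smult_l_distr smult_r_distr
      mult.commute simp flip: smult_assoc)
qed

lemma bilin_counit_left:
  assumes "cvs M" "clin H complex_alg \<epsilon>"
  shows "bilin H M M (\<lambda>h y. \<epsilon> h \<odot>\<^bsub>M\<^esub> y)"
  using bilin_counit_right[OF assms] by (auto simp: bilin_def)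

text \<open>Each remaining axiom equates two linear maps, so it is checked on the monomials, where
  the coproduct is a matrix product and the counit a Kronecker delta.\<close>

lemma frt_bialgebra: "complex_bialgebra (frt \<sigma>) (frt_coproduct \<sigma>) (frt_counit \<sigma>)"
proof (rule complex_bialgebra.intro[OF complex_algebra_frt], unfold_locales)
  let ?H = "frt \<sigma>" and ?HH = "tensor_vs (frt \<sigma>) (frt \<sigma>)"
  let ?D = "frt_coproduct \<sigma>" and ?e = "frt_counit \<sigma>"
  note H = cvs_frt[of \<sigma>]
  note D = clin_frt_coproduct[of \<sigma>]
  have e: "clin ?H complex_alg ?e" by (rule alg_hom_clin[OF frt_counit_hom])
  have br: "bilin ?H ?H ?H (\<lambda>x y. ?e y \<odot>\<^bsub>?H\<^esub> x)" by (rule bilin_counit_right[OF H e])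
  have bl: "bilin ?H ?H ?H (\<lambda>x y. ?e x \<odot>\<^bsub>?H\<^esub> y)" by (rule bilin_counit_left[OF H e])
  note ext = clin_eq_on_lspan[OF H _ _ _ T_monos_closed _ subsetD[OF frt_lspan]]
  show "?D \<in> alg_hom ?H (tensor_alg ?H ?H)" by (rule frt_coproduct_hom)
  show "?e \<in> alg_hom ?H complex_alg" by (rule frt_counit_hom)
  fix h assume h: "h \<in> carrier ?H"
  show "tensor_assoc ?H ?H ?H (tensor_map (tensor_alg ?H ?H) ?H ?D (\<lambda>y. y) (?D h)) =
      tensor_map ?H (tensor_alg ?H ?H) (\<lambda>x. x) ?D (?D h)"
  proof (rule ext[OF cvs_tensor_vs _ _ _ h])
    show "clin ?H (tensor_vs ?H (tensor_alg ?H ?H))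
        (\<lambda>h. tensor_assoc ?H ?H ?H (tensor_map (tensor_alg ?H ?H) ?H ?D (\<lambda>y. y) (?D h)))"
      by (rule clin_comp[OF D clin_comp[OF clin_tensor_map[OF H H] clin_tensor_assoc[OF H H H]]])
        (simp_all add: D clin_id)
    show "clin ?H (tensor_vs ?H (tensor_alg ?H ?H))
        (\<lambda>h. tensor_map ?H (tensor_alg ?H ?H) (\<lambda>x. x) ?D (?D h))"
      by (rule clin_comp[OF D clin_tensor_map[OF H H]]) (simp_all add: D clin_id)
    fix x assume "x \<in> T_monos \<sigma>"
    then obtain js "is" where x: "x = T_mono \<sigma> js is" "length js = length is" by (auto simp: T_monos_def)
    show "tensor_assoc ?H ?H ?H (tensor_map (tensor_alg ?H ?H) ?H ?D (\<lambda>y. y) (?D x)) =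
        tensor_map ?H (tensor_alg ?H ?H) (\<lambda>x. x) ?D (?D x)"
      unfolding x(1)
      by (rule matrix_coassoc[OF H H _ _ _ _ D D, where a = "T_mono \<sigma> js" and I = "words (length js)" and b = "T_mono \<sigma>"])
        (simp_all add: frt_coproduct_T_mono x)
  qed
  show "tensor_lift ?H (\<lambda>x y. ?e x \<odot>\<^bsub>?H\<^esub> y) (?D h) = h"
  proof (rule ext[OF H _ _ _ h])
    show "clin ?H ?H (\<lambda>h. tensor_lift ?H (\<lambda>x y. ?e x \<odot>\<^bsub>?H\<^esub> y) (?D h))"
      by (rule clin_comp[OF D clin_tensor_lift[OF H H H bl]])
    fix x assume "x \<in> T_monos \<sigma>"
    then obtain js "is" where x: "x = T_mono \<sigma> js is" "length js = length is" by (auto simp: T_monos_def)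
    interpret V: cvs ?H by (rule H)
    \<comment> \<open>The counit meets the first factor \<open>T_mono \<sigma> js ks\<close> here,
      so the surviving index is the upper word \<open>js\<close>, whereas
      \<open>matrix_counit\<close> singles out the lower one.\<close>
    have "tensor_lift ?H (\<lambda>x y. ?e x \<odot>\<^bsub>?H\<^esub> y) (?D x) =
        finsum ?H (\<lambda>ks. tensor_lift ?H (\<lambda>x y. ?e x \<odot>\<^bsub>?H\<^esub> y) (tens ?H ?H (T_mono \<sigma> js ks) (T_mono \<sigma> ks is))) (words (length js))"
      unfolding x(1) frt_coproduct_T_mono[OF x(2)]
      by (rule clin_finsum[OF cvs_tensor_vs H clin_tensor_lift[OF H H H bl]]) simp
    also have "\<dots> = finsum ?H (\<lambda>ks. (if ks = js then 1 else 0) \<odot>\<^bsub>?H\<^esub> T_mono \<sigma> ks is) (words (length js))"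
      by (intro finsum_cvs_cong[OF H])
        (auto simp: tensor_lift_tens[OF H H H bl] frt_counit_T_mono)
    also have "\<dots> = x"
      unfolding x(1) by (rule finsum_unit_coeff[OF _ H, where f = "\<lambda>ks. T_mono \<sigma> ks is"]) simp_all
    finally show "tensor_lift ?H (\<lambda>x y. ?e x \<odot>\<^bsub>?H\<^esub> y) (?D x) = x" .
  qed (simp_all add: clin_id)
  show "tensor_lift ?H (\<lambda>x y. ?e y \<odot>\<^bsub>?H\<^esub> x) (?D h) = h"
  proof (rule ext[OF H _ _ _ h])
    show "clin ?H ?H (\<lambda>h. tensor_lift ?H (\<lambda>x y. ?e y \<odot>\<^bsub>?H\<^esub> x) (?D h))"
      by (rule clin_comp[OF D clin_tensor_lift[OF H H H br]])
    fix x assume "x \<in> T_monos \<sigma>"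
    then obtain js "is" where x: "x = T_mono \<sigma> js is" "length js = length is" by (auto simp: T_monos_def)
    show "tensor_lift ?H (\<lambda>x y. ?e y \<odot>\<^bsub>?H\<^esub> x) (?D x) = x"
      unfolding x(1)
      by (rule matrix_counit[OF H H _ _ _ _ br H, where a = "T_mono \<sigma> js" and I = "words (length js)" and b = "T_mono \<sigma>"
            and f = "T_mono \<sigma> js"])
        (simp_all add: frt_coproduct_T_mono frt_counit_T_mono x)
  qed (simp_all add: clin_id)
qed

section \<open>Reduced words of permutations\<close>

abbreviation pinv :: "('a \<Rightarrow> 'a) \<Rightarrow> 'a \<Rightarrow> 'a" where
  "pinv \<equiv> inv_into UNIV"

definition invs :: "nat \<Rightarrow> (nat \<Rightarrow> nat) \<Rightarrow> (nat \<times> nat) set" where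
  "invs n w = {(i, j). i \<in> {1..n} \<and> j \<in> {1..n} \<and> i < j \<and> w j < w i}"

lemma finite_invs [simp]: "finite (invs n w)"
  by (rule finite_subset[of _ "{1..n} \<times> {1..n}"]) (auto simp: invs_def)

lemma perm_of_word_simps [simp]:
  "perm_of_word [] = id" "perm_of_word (r # rs) = transpose r (r + 1) \<circ> perm_of_word rs"
  by (simp_all add: perm_of_word_def)

lemma perm_of_word_append: "perm_of_word (rs @ ss) = perm_of_word rs \<circ> perm_of_word ss"
  by (induction rs) (simp_all add: comp_assoc)

lemma transpose_adjacent_permutes: "r \<in> {1..<n} \<Longrightarrow> transpose r (r + 1) permutes {1..n :: nat}"
  by (rule permutes_swap_id) auto

lemma perm_of_word_permutes: "set rs \<subseteq> {1..<n} \<Longrightarrow> perm_of_word rs permutes {1..n}"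
proof (induction rs)
  case Nil
  then show ?case using permutes_id[of "{1..n}"] by (simp add: id_def)
next
  case (Cons r rs)
  then show ?case
    unfolding perm_of_word_simps by (intro permutes_compose transpose_adjacent_permutes) auto
qed

text \<open>An adjacent transposition reverses the order of the values \<open>r\<close> and
  \<open>r + 1\<close> and of no other pair.\<close>

lemma transpose_adjacent_less:
  fixes r :: nat
  assumes "x \<noteq> y"
  shows "transpose r (r + 1) y < transpose r (r + 1) x \<longleftrightarrow>
    (y < x \<and> \<not> (x = r + 1 \<and> y = r)) \<or> (x = r \<and> y = r + 1)"
  using assms by (auto simp: transpose_def)

lemma inv_transpose_comp:
  assumes "w permutes S"
  shows "pinv (transpose r s \<circ> w) = pinv w \<circ> transpose r s"
  using assms by (simp add: o_inv_distrib permutes_bij)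

lemma permutes_transpose_comp:
  "w permutes {1..n} \<Longrightarrow> r \<in> {1..<n} \<Longrightarrow> transpose r (r + 1) \<circ> w permutes {1..n :: nat}"
  by (intro permutes_compose transpose_adjacent_permutes)

text \<open>Composing on the left permutes values, so only the pair of positions holding the values
  \<open>r\<close> and \<open>r + 1\<close> changes its status. Those positions are
  \<open>pinv w r\<close> and \<open>pinv w (r + 1)\<close>, which is why left ascents and descents
  are read off the inverse.\<close>

lemma card_invs_ascent:
  assumes w: "w permutes {1..n}" and r: "r \<in> {1..<n}" and asc: "pinv w r < pinv w (r + 1)"
  shows "card (invs n (transpose r (r + 1) \<circ> w)) = Suc (card (invs n w))"
proof -
  let ?x = "pinv w r" and ?y = "pinv w (r + 1)"
  have x: "w ?x = r" and y: "w ?y = r + 1" using w by (simp_all add: permutes_inverses)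
  have xy: "?x \<in> {1..n}" "?y \<in> {1..n}" using permutes_in_image[OF permutes_inv[OF w]] r by auto
  have ix: "i = ?x" if "w i = r" for i using injD[OF permutes_inj[OF w], of i ?x] that x by simp
  have iy: "i = ?y" if "w i = r + 1" for i using injD[OF permutes_inj[OF w], of i ?y] that y by simp
  have "(i, j) \<in> invs n (transpose r (r + 1) \<circ> w) \<longleftrightarrow> (i, j) \<in> insert (?x, ?y) (invs n w)" for i j
  proof (cases "i \<in> {1..n} \<and> j \<in> {1..n} \<and> i < j")
    case True
    then have ne: "w i \<noteq> w j" using injD[OF permutes_inj[OF w], of i j] by auto
    have "\<not> (w i = r + 1 \<and> w j = r)" using True asc ix[of j] iy[of i] by linarith
    moreover have "(w i = r \<and> w j = r + 1) \<longleftrightarrow> (i, j) = (?x, ?y)" using ix[of i] iy[of j] x y by blast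
    ultimately show ?thesis
      using True transpose_adjacent_less[OF ne, of r] unfolding invs_def by auto
  next
    case False
    then show ?thesis using xy asc by (auto simp: invs_def)
  qed
  then have "invs n (transpose r (r + 1) \<circ> w) = insert (?x, ?y) (invs n w)" by auto
  moreover have "(?x, ?y) \<notin> invs n w" using x y by (auto simp: invs_def)
  ultimately show ?thesis by simp
qed

lemma card_invs_descent:
  assumes w: "w permutes {1..n}" and r: "r \<in> {1..<n}" and desc: "pinv w (r + 1) < pinv w r"
  shows "card (invs n w) = Suc (card (invs n (transpose r (r + 1) \<circ> w)))"
proof -
  let ?v = "transpose r (r + 1) \<circ> w"
  have "pinv ?v r < pinv ?v (r + 1)" using desc by (simp add: inv_transpose_comp[OF w])
  from card_invs_ascent[OF permutes_transpose_comp[OF w r] r this]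
  show ?thesis by (simp flip: comp_assoc)
qed

lemma inv_adjacent_cases:
  fixes n :: nat
  assumes "w permutes {1..n}"
  obtains "pinv w r < pinv w (r + 1)" | "pinv w (r + 1) < pinv w r"
proof -
  have "pinv w r \<noteq> pinv w (r + 1)"
    using injD[OF permutes_inj[OF permutes_inv[OF assms]], of r "r + 1"] by auto
  then show ?thesis using that by linarith
qed

lemma invs_id [simp]: "invs n id = {}" "invs n (\<lambda>i. i) = {}"
  by (auto simp: invs_def)

lemma card_invs_le_length:
  "set rs \<subseteq> {1..<n} \<Longrightarrow> card (invs n (perm_of_word rs)) \<le> length rs"
proof (induction rs)
  case Nil
  then show ?case by simp
next
  case (Cons r rs)
  then have w: "perm_of_word rs permutes {1..n}" and r: "r \<in> {1..<n}"
    using perm_of_word_permutes[of rs n] by auto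
  have "card (invs n (transpose r (r + 1) \<circ> perm_of_word rs)) \<le> Suc (card (invs n (perm_of_word rs)))"
    by (rule inv_adjacent_cases[OF w, of r])
      (use card_invs_ascent[OF w r] card_invs_descent[OF w r] in simp_all)
  then show ?case using Cons by (simp add: comp_def)
qed

lemma strict_mono_on_adjacent:
  fixes f :: "nat \<Rightarrow> nat"
  assumes "\<And>r. r \<in> {a..<b} \<Longrightarrow> f r < f (r + 1)"
  shows "strict_mono_on {a..b} f"
proof (rule strict_mono_onI)
  fix i j assume *: "i \<in> {a..b}" "j \<in> {a..b}" "i < j"
  have "Suc i \<le> j" using * by simp
  then show "f i < f j" using *(1,2)
  proof (induction j rule: dec_induct)
    case base
    then show ?case using assms[of i] by simp
  next
    case (step k)
    then show ?case using assms[of k] by fastforce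
  qed
qed

text \<open>Strong induction gives \<open>i \<le> d i\<close> on \<open>S\<close>: otherwise
  \<open>d i\<close> would itself be a smaller element that is moved down. A bijection preserves the
  sum over \<open>S\<close>, so none of these inequalities is strict.\<close>

lemma strict_mono_on_bij_fixed:
  fixes d :: "nat \<Rightarrow> nat"
  assumes "finite S" and bij: "bij_betw d S S" and mono: "strict_mono_on S d" and "i \<in> S"
  shows "d i = i"
proof -
  have ge: "d i \<ge> i" if "i \<in> S" for i using that
  proof (induction i rule: less_induct)
    case (less i)
    show ?case
    proof (rule ccontr)
      assume "\<not> i \<le> d i"
      moreover have "d i \<in> S" using less.prems bij by (auto simp: bij_betw_def)
      ultimately have "d i \<le> d (d i)" "d (d i) < d i"
        using less strict_mono_onD[OF mono, of "d i" i] by auto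
      then show False by simp
    qed
  qed
  have "(\<Sum>i\<in>S. d i) = (\<Sum>i\<in>S. i)"
    by (rule sum.reindex_bij_betw[OF bij])
  then show ?thesis using sum_mono_inv[of "\<lambda>i. i" S d i] ge assms(1,4) by simp
qed

text \<open>Without a descent the inverse is increasing on \<open>{1..n}\<close>, and an increasing
  bijection of a finite set of numbers is the identity.\<close>

lemma exists_descent:
  assumes w: "w permutes {1..n :: nat}" and "w \<noteq> id"
  shows "\<exists>r\<in>{1..<n}. pinv w (r + 1) < pinv w r"
proof (rule ccontr)
  assume "\<not> ?thesis"
  then have "pinv w r < pinv w (r + 1)" if "r \<in> {1..<n}" for r
    using inv_adjacent_cases[OF w, of r] that by blast
  then have mono: "strict_mono_on {1..n} (pinv w)" by (intro strict_mono_on_adjacent)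
  have "pinv w i = i" for i
  proof (cases "i \<in> {1..n}")
    case True
    then show ?thesis
      by (intro strict_mono_on_bij_fixed[OF _ _ mono] permutes_imp_bij permutes_inv[OF w]) auto
  next
    case False
    then show ?thesis using permutes_not_in[OF permutes_inv[OF w]] by blast
  qed
  then have "w i = i" for i using permutes_inverses(1)[OF w, of i] by simp
  then show False using assms(2) by auto
qed

text \<open>Bubble sort: stripping a left descent removes exactly one inversion, until the identity
  is reached.\<close>

lemma exists_word:
  assumes "w permutes {1..n}"
  shows "\<exists>rs. set rs \<subseteq> {1..<n} \<and> perm_of_word rs = w \<and> length rs = card (invs n w)"
  using assms
proof (induction "card (invs n w)" arbitrary: w rule: less_induct)
  case less
  show ?case
  proof (cases "w = id")
    case True
    then show ?thesis by (intro exI[of _ "[]"]) simp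
  next
    case False
    then obtain r where r: "r \<in> {1..<n}" "pinv w (r + 1) < pinv w r"
      using exists_descent[OF less.prems] by blast
    note d = card_invs_descent[OF less.prems r]
    then obtain rs where rs: "set rs \<subseteq> {1..<n}" "perm_of_word rs = transpose r (r + 1) \<circ> w"
        "length rs = card (invs n (transpose r (r + 1) \<circ> w))"
      using less.hyps[OF _ permutes_transpose_comp[OF less.prems r(1)]] by auto
    show ?thesis by (rule exI[of _ "r # rs"]) (use rs r d in \<open>simp flip: comp_assoc\<close>)
  qed
qed

lemma perm_length_eq:
  assumes "w permutes {1..n}"
  shows "perm_length n w = card (invs n w)"
  unfolding perm_length_def
proof (rule Least_equality)
  show "\<exists>rs. set rs \<subseteq> {1..<n} \<and> perm_of_word rs = w \<and> length rs = card (invs n w)"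
    by (rule exists_word[OF assms])
qed (use card_invs_le_length in blast)

lemma reduced_word_iff:
  "reduced_word n w rs \<longleftrightarrow> set rs \<subseteq> {1..<n} \<and> perm_of_word rs = w \<and> length rs = card (invs n w)"
  unfolding reduced_word_def using perm_length_eq perm_of_word_permutes by metis

lemma exists_reduced_word: "w permutes {1..n} \<Longrightarrow> \<exists>rs. reduced_word n w rs"
  using exists_word by (simp add: reduced_word_iff)

lemma reduced_word_permutes: "reduced_word n w rs \<Longrightarrow> w permutes {1..n}"
  using perm_of_word_permutes by (auto simp: reduced_word_iff)

text \<open>If \<open>r\<close> were an ascent, stripping it would create an inversion, and the
  remaining word would be too short for a permutation with that many.\<close>

lemma reduced_word_ConsD:
  assumes "reduced_word n w (r # rs)"
  shows "r \<in> {1..<n}" "reduced_word n (transpose r (r + 1) \<circ> w) rs" "pinv w (r + 1) < pinv w r"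
proof -
  have rs: "set rs \<subseteq> {1..<n}" and w: "transpose r (r + 1) \<circ> perm_of_word rs = w"
    and len: "Suc (length rs) = card (invs n w)"
    using assms by (auto simp: reduced_word_iff)
  show r: "r \<in> {1..<n}" using assms by (auto simp: reduced_word_iff)
  have p: "transpose r (r + 1) \<circ> w = perm_of_word rs" by (simp add: w[symmetric] flip: comp_assoc)
  have le: "card (invs n (transpose r (r + 1) \<circ> w)) \<le> length rs"
    unfolding p by (rule card_invs_le_length[OF rs])
  note wp = reduced_word_permutes[OF assms]
  show desc: "pinv w (r + 1) < pinv w r"
    by (rule inv_adjacent_cases[OF wp, of r]) (use card_invs_ascent[OF wp r] le len in auto)
  show "reduced_word n (transpose r (r + 1) \<circ> w) rs"
    unfolding reduced_word_iff using rs p len card_invs_descent[OF wp r desc] by simp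
qed

lemma reduced_word_ConsI:
  assumes "w permutes {1..n}" "r \<in> {1..<n}" "pinv w (r + 1) < pinv w r"
    and "reduced_word n (transpose r (r + 1) \<circ> w) rs"
  shows "reduced_word n w (r # rs)"
  using assms card_invs_descent[OF assms(1-3)] unfolding reduced_word_iff
  by (auto simp flip: comp_assoc)

section \<open>Matsumoto's theorem for operators satisfying the braid relations on a set\<close>

definition act_word :: "(nat \<Rightarrow> 'x \<Rightarrow> 'x) \<Rightarrow> nat list \<Rightarrow> 'x \<Rightarrow> 'x" where
  "act_word F rs = foldr (\<lambda>r f. F r \<circ> f) rs id"

lemma act_word_simps [simp]: "act_word F [] x = x" "act_word F (r # rs) x = F r (act_word F rs x)"
  by (simp_all add: act_word_def)

lemma act_word_closed:
  "(\<And>r x. r \<in> {1..<n} \<Longrightarrow> x \<in> X \<Longrightarrow> F r x \<in> X) \<Longrightarrow> set rs \<subseteq> {1..<n} \<Longrightarrow> x \<in> X \<Longrightarrow> act_word F rs x \<in> X"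
  by (induction rs) auto

text \<open>
  If reduced words of \<open>w\<close> start with \<open>r < s\<close>, then both \<open>r\<close> and \<open>s\<close> are left descents of \<open>w\<close>, so \<open>w\<close>
  also has reduced words starting with \<open>r s\<close> and \<open>s r\<close> (with \<open>r s r\<close> and \<open>s r s\<close> if \<open>s = r + 1\<close>) and
  equal remainders; the induction hypothesis links these to the given words.
\<close>

theorem matsumoto:
  assumes closed: "\<And>r x. r \<in> {1..<n} \<Longrightarrow> x \<in> X \<Longrightarrow> F r x \<in> X"
    and far: "\<And>r s x. r \<in> {1..<n} \<Longrightarrow> s \<in> {1..<n} \<Longrightarrow> r + 1 < s \<Longrightarrow> x \<in> X \<Longrightarrow> F r (F s x) = F s (F r x)"
    and braid: "\<And>r x. 1 \<le> r \<Longrightarrow> r + 1 < n \<Longrightarrow> x \<in> X \<Longrightarrow>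
      F r (F (r + 1) (F r x)) = F (r + 1) (F r (F (r + 1) x))"
    and "reduced_word n w rs" "reduced_word n w ss" "x \<in> X"
  shows "act_word F rs x = act_word F ss x"
  using assms(4,5)
proof (induction "length rs" arbitrary: w rs ss rule: less_induct)
  case less
  note red = less.prems
  note wp = reduced_word_permutes[OF red(1)]
  have len: "length rs = length ss" using red by (simp add: reduced_word_iff)
  note IH = less.hyps
  \<comment> \<open>The last premise ties the lengths to the induction measure without mentioning
    \<open>ss\<close>, so the roles of the two words can be exchanged when
    \<open>s < r\<close>.\<close>
  have key: "act_word F (r # rs') x = act_word F (s # ss') x"
    if rs: "r < s" "reduced_word n w (r # rs')" "reduced_word n w (s # ss')" "Suc (length rs') = length rs"
    for r s rs' ss'
  proof -
    note R = reduced_word_ConsD[OF rs(2)] and S = reduced_word_ConsD[OF rs(3)]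
    let ?r = "transpose r (r + 1)" and ?s = "transpose s (s + 1)"
    have pr: "?r \<circ> w permutes {1..n}" and ps: "?s \<circ> w permutes {1..n}"
      by (rule permutes_transpose_comp[OF wp R(1)] permutes_transpose_comp[OF wp S(1)])+
    have len': "length rs' < length rs" "length ss' < length rs"
      using rs(2-4) by (auto simp: reduced_word_iff)
    show ?thesis
    proof (cases "r + 1 < s")
      case True
      have comm: "?r \<circ> (?s \<circ> w) = ?s \<circ> (?r \<circ> w)" using True by (auto simp: fun_eq_iff transpose_def)
      obtain t where t: "reduced_word n (?s \<circ> (?r \<circ> w)) t"
        using exists_reduced_word[OF permutes_transpose_comp[OF pr S(1)]] by blast
      \<comment> \<open>\<open>s\<close> remains a descent once \<open>r\<close> is stripped,
        because \<open>s\<close> and \<open>s + 1\<close> are fixed by the transposition of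
        \<open>r\<close> and \<open>r + 1\<close>.\<close>
      have st: "reduced_word n (?r \<circ> w) (s # t)" by (rule reduced_word_ConsI[OF pr S(1) _ t])
          (use S(3) True in \<open>simp add: inv_transpose_comp[OF wp]\<close>)
      have rt: "reduced_word n (?s \<circ> w) (r # t)" by (rule reduced_word_ConsI[OF ps R(1)])
          (use R(3) True t in \<open>simp_all only: comm inv_transpose_comp[OF wp], simp\<close>)
      have tX: "act_word F t x \<in> X"
        by (rule act_word_closed[OF closed _ \<open>x \<in> X\<close>]) (use t in \<open>auto simp: reduced_word_iff\<close>)
      have "act_word F rs' x = F s (act_word F t x)" using IH[OF len'(1) R(2) st] by simp
      moreover have "act_word F ss' x = F r (act_word F t x)" using IH[OF len'(2) S(2) rt] by simp
      ultimately show ?thesis using far[OF R(1) S(1) True tX] by simp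
    next
      case False
      then have s: "s = r + 1" using rs(1) by simp
      have rn: "r + 1 < n" "1 \<le> r" using S(1) R(1) s by auto
      \<comment> \<open>Now \<open>pinv w (r + 2) < pinv w (r + 1) < pinv w r\<close>. The three
        values occur in reversed order, so three descents can be stripped along \<open>r s r\<close>
        as well as along \<open>s r s\<close>, and both leave the same permutation, with reduced
        word \<open>t\<close>.\<close>
      have comm: "?s \<circ> (?r \<circ> (?s \<circ> w)) = ?r \<circ> (?s \<circ> (?r \<circ> w))"
        unfolding s by (auto simp: fun_eq_iff transpose_def)
      note psr = permutes_transpose_comp[OF pr S(1)] and prs = permutes_transpose_comp[OF ps R(1)]
      obtain t where t: "reduced_word n (?r \<circ> (?s \<circ> (?r \<circ> w))) t"
        using exists_reduced_word[OF permutes_transpose_comp[OF psr R(1)]] by blast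
      have "reduced_word n (?s \<circ> (?r \<circ> w)) (r # t)"
        by (rule reduced_word_ConsI[OF psr R(1) _ t])
          (unfold inv_transpose_comp[OF pr] inv_transpose_comp[OF wp], use S(3) s in simp)
      then have srt: "reduced_word n (?r \<circ> w) (s # r # t)"
        by (rule reduced_word_ConsI[OF pr S(1), rotated])
          (use S(3) R(3) s in \<open>simp add: inv_transpose_comp[OF wp]\<close>)
      have "reduced_word n (?r \<circ> (?s \<circ> w)) (s # t)"
        by (rule reduced_word_ConsI[OF prs S(1)], unfold inv_transpose_comp[OF ps] inv_transpose_comp[OF wp] comm)
          (use R(3) s t in simp_all)
      then have rst: "reduced_word n (?s \<circ> w) (r # s # t)"
        by (rule reduced_word_ConsI[OF ps R(1), rotated])
          (use S(3) R(3) s in \<open>simp add: inv_transpose_comp[OF wp]\<close>)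
      have tX: "act_word F t x \<in> X"
        by (rule act_word_closed[OF closed _ \<open>x \<in> X\<close>]) (use t in \<open>auto simp: reduced_word_iff\<close>)
      have "act_word F rs' x = F s (F r (act_word F t x))" using IH[OF len'(1) R(2) srt] by simp
      moreover have "act_word F ss' x = F r (F s (act_word F t x))" using IH[OF len'(2) S(2) rst] by simp
      ultimately show ?thesis using braid[OF rn(2,1) tX] by (simp add: s)
    qed
  qed
  show ?case
  proof (cases rs)
    case Nil
    then show ?thesis using len by simp
  next
    case (Cons r rs')
    then obtain s ss' where ss: "ss = s # ss'" using len by (cases ss) auto
    consider "r < s" | "r = s" | "s < r" by linarith
    then show ?thesis
    proof cases
      case 1
      then show ?thesis using key[of r s rs' ss'] red Cons ss by simp
    next
      case 2
      then show ?thesis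
        using IH[of rs' _ ss'] reduced_word_ConsD(2)[of n w r rs'] reduced_word_ConsD(2)[of n w s ss'] red Cons ss
        by auto
    next
      case 3
      then show ?thesis using key[of s r ss' rs'] red Cons ss len by simp
    qed
  qed
qed

subsection \<open>Block decomposition\<close>

text \<open>The embedding of the permutations of \<open>{1..n}\<close> into those of
  \<open>{1..m + n}\<close> that acts on the last \<open>n\<close> points;
  \<open>block_perm m a b\<close> is the pair \<open>(a, b)\<close> as an element of the block
  subgroup.\<close>

definition shift_perm :: "nat \<Rightarrow> (nat \<Rightarrow> nat) \<Rightarrow> nat \<Rightarrow> nat" where
  "shift_perm m b j = (if m < j then m + b (j - m) else j)"

abbreviation block_perm :: "nat \<Rightarrow> (nat \<Rightarrow> nat) \<Rightarrow> (nat \<Rightarrow> nat) \<Rightarrow> nat \<Rightarrow> nat" where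
  "block_perm m a b \<equiv> a \<circ> shift_perm m b"

lemma shift_perm_id [simp]: "shift_perm m id = id" "shift_perm m (\<lambda>i. i) = (\<lambda>i. i)"
  by (auto simp: shift_perm_def fun_eq_iff)

text \<open>Keeps shifted values above \<open>m\<close>, so that the case distinction in
  \<open>shift_perm\<close> goes the same way after each factor of a composition.\<close>

lemma permutes_pos: "b permutes {1..n :: nat} \<Longrightarrow> 0 < j \<Longrightarrow> 0 < b j"
  by (metis atLeastAtMost_iff less_eq_Suc_le One_nat_def permutes_def permutes_in_image)

lemma shift_perm_comp:
  assumes "c permutes {1..n}"
  shows "shift_perm m (b \<circ> c) = shift_perm m b \<circ> shift_perm m c"
  using permutes_pos[OF assms] by (auto simp: shift_perm_def fun_eq_iff)

lemma shift_perm_block_permutes: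
  assumes "b permutes {1..n}"
  shows "shift_perm m b permutes {m + 1..m + n}"
proof (rule bij_imp_permutes)
  note inv = permutes_inv[OF assms]
  have img: "b i \<in> {1..n} \<longleftrightarrow> i \<in> {1..n}" "pinv b i \<in> {1..n} \<longleftrightarrow> i \<in> {1..n}" for i
    using permutes_in_image[OF assms] permutes_in_image[OF inv] by auto
  show "bij_betw (shift_perm m b) {m + 1..m + n} {m + 1..m + n}"
  proof (rule bij_betw_byWitness[where f' = "shift_perm m (pinv b)"])
    have *: "shift_perm m (pinv b) \<circ> shift_perm m b = id" "shift_perm m b \<circ> shift_perm m (pinv b) = id"
      using shift_perm_comp[OF assms, of m "pinv b"] shift_perm_comp[OF inv, of m b]
      by (simp_all add: permutes_inv_o[OF assms])
    show "\<forall>a\<in>{m + 1..m + n}. shift_perm m (pinv b) (shift_perm m b a) = a"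
      "\<forall>a\<in>{m + 1..m + n}. shift_perm m b (shift_perm m (pinv b) a) = a"
      using * by (metis comp_apply id_apply)+
    have "shift_perm m c j \<in> {m + 1..m + n}"
      if "j \<in> {m + 1..m + n}" "\<And>i. i \<in> {1..n} \<Longrightarrow> c i \<in> {1..n}" for c j
    proof -
      have "j - m \<in> {1..n}" using that(1) by auto
      from that(2)[OF this] show ?thesis using that(1) by (auto simp: shift_perm_def)
    qed
    then show "shift_perm m b ` {m + 1..m + n} \<subseteq> {m + 1..m + n}"
      "shift_perm m (pinv b) ` {m + 1..m + n} \<subseteq> {m + 1..m + n}"
      using img by blast+
  qed
  show "shift_perm m b x = x" if "x \<notin> {m + 1..m + n}" for x
  proof (cases "m < x")
    case True
    then have "x - m \<notin> {1..n}" using that by auto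
    from permutes_not_in[OF assms this] True show ?thesis by (simp add: shift_perm_def)
  qed (simp add: shift_perm_def)
qed

lemma shift_perm_permutes:
  "b permutes {1..n} \<Longrightarrow> shift_perm m b permutes {1..m + n}"
  by (rule permutes_subset[OF shift_perm_block_permutes]) auto

lemma perm_of_word_shift:
  "set rs \<subseteq> {1..<n} \<Longrightarrow> perm_of_word (map (\<lambda>r. m + r) rs) = shift_perm m (perm_of_word rs)"
proof (induction rs)
  case Nil
  then show ?case by simp
next
  case (Cons r rs)
  have "shift_perm m (transpose r (r + 1)) = transpose (m + r) (m + r + 1)"
    using Cons.prems by (auto simp: shift_perm_def transpose_def fun_eq_iff)
  then have "shift_perm m (perm_of_word (r # rs)) = transpose (m + r) (m + r + 1) \<circ> shift_perm m (perm_of_word rs)"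
    unfolding perm_of_word_simps using Cons.prems
    by (subst shift_perm_comp[OF perm_of_word_permutes]) auto
  then show ?case using Cons by (simp add: comp_def)
qed

lemma permutes_outside:
  assumes "a permutes {1..m :: nat}" "m < j"
  shows "a j = j"
  using permutes_not_in[OF assms(1), of j] assms(2) by simp

lemma block_apply_left:
  assumes "a permutes {1..m}" "i \<le> m"
  shows "block_perm m a b i = a i"
  using assms by (simp add: shift_perm_def)

lemma block_apply_right:
  assumes "a permutes {1..m}" "b permutes {1..n}" "m < j"
  shows "block_perm m a b j = shift_perm m b j"
  using permutes_pos[OF assms(2), of "j - m"] assms(3)
  by (simp add: shift_perm_def permutes_outside[OF assms(1)])

lemma block_commute:
  assumes "a permutes {1..m}" "b permutes {1..n}"
  shows "block_perm m a b = shift_perm m b \<circ> a"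
proof
  fix j
  show "block_perm m a b j = (shift_perm m b \<circ> a) j"
  proof (cases "m < j")
    case True
    show ?thesis
      by (subst block_apply_right[OF assms True]) (simp add: permutes_outside[OF assms(1) True])
  next
    case False
    then have "\<not> m < a j" using permutes_in_image[OF assms(1), of j] permutes_not_in[OF assms(1), of j]
      by (cases "j \<in> {1..m}") auto
    then show ?thesis using False by (simp add: shift_perm_def)
  qed
qed

lemma block_permutes:
  assumes "a permutes {1..m}" "b permutes {1..n}"
  shows "block_perm m a b permutes {1..m + n}"
  by (rule permutes_compose[OF shift_perm_permutes[OF assms(2)] permutes_subset[OF assms(1)]]) auto

lemma block_bij_left:
  assumes "a permutes {1..m}"
  shows "bij_betw (block_perm m a b) {1..m} {1..m}"
proof -
  have "bij_betw (block_perm m a b) {1..m} {1..m} = bij_betw a {1..m} {1..m}"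
    by (rule bij_betw_cong) (simp add: shift_perm_def)
  then show ?thesis using permutes_imp_bij[OF assms] by simp
qed

lemma block_bij_right:
  assumes "a permutes {1..m}" "b permutes {1..n}"
  shows "bij_betw (block_perm m a b) {m + 1..m + n} {m + 1..m + n}"
proof -
  have "bij_betw (block_perm m a b) {m + 1..m + n} {m + 1..m + n} =
      bij_betw (shift_perm m b) {m + 1..m + n} {m + 1..m + n}"
    by (rule bij_betw_cong) (rule block_apply_right[OF assms], simp)
  then show ?thesis using permutes_imp_bij[OF shift_perm_block_permutes[OF assms(2)]] by simp
qed

lemma exists_sorting_perm:
  fixes f :: "nat \<Rightarrow> nat"
  assumes "inj_on f {1..m}"
  shows "\<exists>a. a permutes {1..m} \<and> strict_mono_on {1..m} (\<lambda>i. f (a i))"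
proof -
  obtain h where h: "bij_betw h {..<card (f ` {1..m})} (f ` {1..m})" "strict_mono_on {..<card (f ` {1..m})} h"
    using ex_bij_betw_strict_mono_card[of "f ` {1..m}"] by auto
  have card: "card (f ` {1..m}) = m" using card_image[OF assms] by simp
  let ?g = "inv_into {1..m} f"
  \<comment> \<open>\<open>h\<close> enumerates the values of \<open>f\<close> increasingly from
    index \<open>0\<close>, hence the \<open>i - 1\<close>: position \<open>i\<close> receives the
    argument whose value is the \<open>i\<close>-th smallest.\<close>
  define a where "a = (\<lambda>i. if i \<in> {1..m} then ?g (h (i - 1)) else i)"
  have pred: "bij_betw (\<lambda>i. i - 1) {1..m} {..<m}" by (rule bij_betw_byWitness[where f' = Suc]) auto
  have "bij_betw (?g \<circ> h \<circ> (\<lambda>i. i - 1)) {1..m} {1..m}"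
    using h(1) unfolding card
    by (intro bij_betw_trans[OF pred] bij_betw_trans[OF _ bij_betw_inv_into[OF inj_on_imp_bij_betw[OF assms]]])
  then have "bij_betw a {1..m} {1..m}"
    by (rule bij_betw_cong[THEN iffD1, rotated]) (simp add: a_def)
  then have "a permutes {1..m}" by (rule bij_imp_permutes) (auto simp: a_def)
  moreover have fa: "f (a i) = h (i - 1)" if "i \<in> {1..m}" for i
  proof -
    have "h (i - 1) \<in> f ` {1..m}" using h(1) that unfolding card bij_betw_def by auto
    then show ?thesis using that by (simp add: a_def f_inv_into_f)
  qed
  have "strict_mono_on {1..m} (\<lambda>i. f (a i))"
  proof (rule strict_mono_onI)
    fix i j assume "i \<in> {1..m}" "j \<in> {1..m}" "i < j"
    then show "f (a i) < f (a j)"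
      using strict_mono_onD[OF h(2), of "i - 1" "j - 1"] by (simp only: fa card) auto
  qed
  ultimately show ?thesis by blast
qed

text \<open>Sorting the values of \<open>p\<close> on each of the two blocks separately is
  composition with a block permutation on the right and yields a shuffle; the sorting is then
  undone.\<close>

lemma shuffle_decomposition_exists:
  assumes p: "p permutes {1..m + n}"
  shows "\<exists>w a b. w \<in> shuffle_perms m n \<and> a permutes {1..m} \<and> b permutes {1..n} \<and> p = w \<circ> block_perm m a b"
proof -
  have inj: "inj_on p S" for S using permutes_inj[OF p] by (rule inj_on_subset) simp
  obtain a where a: "a permutes {1..m}" "strict_mono_on {1..m} (\<lambda>i. p (a i))"
    using exists_sorting_perm[OF inj] by blast
  have "inj_on (\<lambda>j. p (m + j)) {1..n}" 
    using injD[OF permutes_inj[OF p]] by (intro inj_onI) force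
  then obtain b where b: "b permutes {1..n}" "strict_mono_on {1..n} (\<lambda>j. p (m + b j))"
    using exists_sorting_perm[of "\<lambda>j. p (m + j)"] by blast
  note ia = permutes_inv[OF a(1)] and ib = permutes_inv[OF b(1)]
  let ?c = "block_perm m a b"
  define w where "w = p \<circ> ?c"
  have w: "w \<in> shuffle_perms m n" unfolding shuffle_perms_def
  proof (intro CollectI conjI)
    show "w permutes {1..m + n}"
      unfolding w_def by (rule permutes_compose[OF block_permutes[OF a(1) b(1)] p])
    show "strict_mono_on {1..m} w"
      using strict_mono_onD[OF a(2)] by (intro strict_mono_onI) (auto simp: w_def shift_perm_def)
    show "strict_mono_on {m + 1..m + n} w"
    proof (rule strict_mono_onI)
      fix i j assume *: "i \<in> {m + 1..m + n}" "j \<in> {m + 1..m + n}" "i < j"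
      have "w k = p (m + b (k - m))" if "k \<in> {m + 1..m + n}" for k
        unfolding w_def comp_apply[of p] using that
        by (subst block_apply_right[OF a(1) b(1)]) (simp_all add: shift_perm_def)
      then show "w i < w j" using strict_mono_onD[OF b(2), of "i - m" "j - m"] * by auto
    qed
  qed
  \<comment> \<open>The two factors of a block permutation commute, so its inverse is the block
    permutation of the inverses.\<close>
  have "shift_perm m b \<circ> shift_perm m (pinv b) = id"
    using shift_perm_comp[OF ib, of m b] by (simp add: permutes_inv_o[OF b(1)])
  moreover have "shift_perm m b \<circ> pinv a = pinv a \<circ> shift_perm m b"
    by (rule block_commute[OF ia b(1), symmetric])
  moreover have "a \<circ> pinv a = id" by (rule permutes_inv_o[OF a(1)])
  ultimately have "?c \<circ> block_perm m (pinv a) (pinv b) = id"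
    by (metis (no_types, lifting) comp_assoc comp_id)
  then have "p = w \<circ> block_perm m (pinv a) (pinv b)" unfolding w_def by (metis comp_assoc comp_id)
  then show ?thesis using w ia ib by blast
qed

text \<open>The inverse of \<open>g\<close> after \<open>f\<close> is an increasing bijection of
  \<open>S\<close>, hence the identity there.\<close>

lemma strict_mono_on_image_unique:
  fixes f g :: "nat \<Rightarrow> nat"
  assumes "finite S" and f: "strict_mono_on S f" and g: "strict_mono_on S g" and "f ` S = g ` S" and "i \<in> S"
  shows "f i = g i"
proof -
  have inj: "inj_on f S" "inj_on g S" using f g by (simp_all add: strict_mono_on_imp_inj_on)
  let ?d = "inv_into S g \<circ> f"
  have "bij_betw f S (g ` S)" using inj(1) assms(4) by (simp add: bij_betw_def)
  then have bij: "bij_betw ?d S S"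
    by (rule bij_betw_trans[OF _ bij_betw_inv_into[OF inj_on_imp_bij_betw[OF inj(2)]]])
  have gd: "g (?d j) = f j" if "j \<in> S" for j using that assms(4) by (auto intro!: f_inv_into_f)
  have "strict_mono_on S ?d"
  proof (rule strict_mono_onI)
    fix j k assume jk: "j \<in> S" "k \<in> S" "j < k"
    then have "g (?d j) < g (?d k)" using strict_mono_onD[OF f] by (simp only: gd)
    then show "?d j < ?d k"
      using strict_mono_on_less[OF g, of "?d j" "?d k"] bij jk unfolding bij_betw_def by blast
  qed
  then have "?d i = i" by (rule strict_mono_on_bij_fixed[OF assms(1) bij _ assms(5)])
  then show ?thesis using gd[OF assms(5)] by simp
qed

text \<open>A block permutation preserves both blocks, so both shuffles have the same image on each
  block; an increasing map is determined by its image. Cancelling the shuffle leaves equal block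
  permutations.\<close>

lemma shuffle_decomposition_unique:
  assumes w: "w \<in> shuffle_perms m n" "a permutes {1..m}" "b permutes {1..n}"
    and w': "w' \<in> shuffle_perms m n" "a' permutes {1..m}" "b' permutes {1..n}"
    and eq: "w \<circ> block_perm m a b = w' \<circ> block_perm m a' b'"
  shows "w = w'" "a = a'" "b = b'"
proof -
  let ?c = "block_perm m a b" and ?c' = "block_perm m a' b'"
  have wp: "w permutes {1..m + n}" "w' permutes {1..m + n}"
    and sw: "strict_mono_on {1..m} w" "strict_mono_on {m + 1..m + n} w"
      "strict_mono_on {1..m} w'" "strict_mono_on {m + 1..m + n} w'"
    using w w' by (auto simp: shuffle_perms_def)
  have img: "w ` S = w' ` S" if "bij_betw ?c S S" "bij_betw ?c' S S" for S
  proof -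
    have "w ` (?c ` S) = w' ` (?c' ` S)"
      using arg_cong[OF eq, of "\<lambda>f. f ` S"] by (simp only: image_comp)
    then show ?thesis by (simp only: that[THEN bij_betw_imp_surj_on])
  qed
  have "w i = w' i" for i
  proof -
    consider "i \<notin> {1..m + n}" | "i \<in> {1..m}" | "i \<in> {m + 1..m + n}" by fastforce
    then show ?thesis
    proof cases
      case 1
      then show ?thesis using permutes_not_in[OF wp(1)] permutes_not_in[OF wp(2)] by metis
    next
      case 2
      show ?thesis
        by (rule strict_mono_on_image_unique[OF _ sw(1,3) img[OF block_bij_left[OF w(2)] block_bij_left[OF w'(2)]] 2]) simp
    next
      case 3
      show ?thesis
        by (rule strict_mono_on_image_unique[OF _ sw(2,4) img[OF block_bij_right[OF w(2,3)] block_bij_right[OF w'(2,3)]] 3]) simp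
    qed
  qed
  then show ww: "w = w'" by blast
  have cc: "?c = ?c'"
  proof
    fix i
    show "?c i = ?c' i"
      using fun_cong[OF eq, of i] injD[OF permutes_inj[OF wp(1)], of "?c i" "?c' i"] by (simp add: ww)
  qed
  show "a = a'"
  proof
    fix i
    show "a i = a' i"
    proof (cases "i \<le> m")
      case True
      then show ?thesis using fun_cong[OF cc, of i] by (simp add: shift_perm_def)
    next
      case False
      then show ?thesis by (simp add: permutes_outside[OF w(2)] permutes_outside[OF w'(2)])
    qed
  qed
  show "b = b'"
  proof
    fix j
    show "b j = b' j"
    proof (cases "0 < j")
      case True
      then show ?thesis using fun_cong[OF cc, of "m + j"] block_apply_right[OF w(2,3), of "m + j"]
          block_apply_right[OF w'(2,3), of "m + j"] by (simp add: shift_perm_def)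
    next
      case False
      then show ?thesis using permutes_not_in[OF w(3), of j] permutes_not_in[OF w'(3), of j] by simp
    qed
  qed
qed

lemma shuffle_decomposition_bij:
  "bij_betw (\<lambda>(w, a, b). w \<circ> block_perm m a b)
    (shuffle_perms m n \<times> {a. a permutes {1..m}} \<times> {b. b permutes {1..n}}) {p. p permutes {1..m + n}}"
  unfolding bij_betw_def
proof
  show "inj_on (\<lambda>(w, a, b). w \<circ> block_perm m a b)
      (shuffle_perms m n \<times> {a. a permutes {1..m}} \<times> {b. b permutes {1..n}})"
    by (rule inj_onI) (use shuffle_decomposition_unique in \<open>auto simp del: comp_apply\<close>)
  show "(\<lambda>(w, a, b). w \<circ> block_perm m a b) `
      (shuffle_perms m n \<times> {a. a permutes {1..m}} \<times> {b. b permutes {1..n}}) = {p. p permutes {1..m + n}}"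
  proof (intro Set.set_eqI iffI)
    fix p assume "p \<in> {p. p permutes {1..m + n}}"
    then obtain w a b where "w \<in> shuffle_perms m n" "a permutes {1..m}" "b permutes {1..n}"
        "p = w \<circ> block_perm m a b"
      using shuffle_decomposition_exists by blast
    then show "p \<in> (\<lambda>(w, a, b). w \<circ> block_perm m a b) `
        (shuffle_perms m n \<times> {a. a permutes {1..m}} \<times> {b. b permutes {1..n}})"
      by (intro image_eqI[of _ _ "(w, a, b)"]) auto
  next
    fix p assume "p \<in> (\<lambda>(w, a, b). w \<circ> block_perm m a b) `
        (shuffle_perms m n \<times> {a. a permutes {1..m}} \<times> {b. b permutes {1..n}})"
    then obtain w a b where *: "w permutes {1..m + n}" "a permutes {1..m}" "b permutes {1..n}"
        "p = w \<circ> block_perm m a b"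
      by (auto simp: shuffle_perms_def)
    show "p \<in> {p. p permutes {1..m + n}}"
      unfolding *(4) mem_Collect_eq by (rule permutes_compose[OF block_permutes[OF *(2,3)] *(1)])
  qed
qed

text \<open>Inversions are sorted by the blocks of their positions. Inside a block \<open>w\<close>
  is increasing, so they are the inversions of \<open>a\<close> or of \<open>b\<close>. Between the
  blocks, the block permutation applied to both positions matches them with those of
  \<open>w\<close>, and a shuffle has no others.\<close>

lemma card_invs_block:
  assumes "w \<in> shuffle_perms m n" and a: "a permutes {1..m}" and b: "b permutes {1..n}"
  shows "card (invs (m + n) (w \<circ> block_perm m a b)) =
    card (invs (m + n) w) + card (invs m a) + card (invs n b)"
proof -
  let ?c = "block_perm m a b"
  have sw: "strict_mono_on {1..m} w" "strict_mono_on {m + 1..m + n} w"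
    using assms(1) by (auto simp: shuffle_perms_def)
  have less1: "w i < w j \<longleftrightarrow> i < j" if "i \<in> {1..m}" "j \<in> {1..m}" for i j
    using strict_mono_on_less[OF sw(1)] that by blast
  have less2: "w i < w j \<longleftrightarrow> i < j" if "i \<in> {m + 1..m + n}" "j \<in> {m + 1..m + n}" for i j
    using strict_mono_on_less[OF sw(2)] that by blast
  \<comment> \<open>The condition \<open>i < j\<close> of an inversion is automatic for positions in
    different blocks.\<close>
  define cross where "cross = (\<lambda>p :: nat \<Rightarrow> nat. {(i, j). i \<in> {1..m} \<and> j \<in> {m + 1..m + n} \<and> p j < p i})"
  have fin: "finite (cross p)" for p
    by (rule finite_subset[of _ "{1..m} \<times> {m + 1..m + n}"]) (auto simp: cross_def)
  let ?sh = "\<lambda>(i, j). (m + i, m + j)"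
  have ca: "?c i = a i" "a i \<in> {1..m}" if "i \<in> {1..m}" for i
    using that block_apply_left[OF a, of i b] permutes_in_image[OF a, of i] by auto
  have cb: "?c j = m + b (j - m)" "m + b (j - m) \<in> {m + 1..m + n}" if "j \<in> {m + 1..m + n}" for j
    using that block_apply_right[OF a b, of j] permutes_in_image[OF b, of "j - m"]
    by (auto simp: shift_perm_def)
  have cross_w: "invs (m + n) w = cross w"
  proof (intro Set.set_eqI, clarify)
    fix i j
    consider "i \<in> {1..m}" "j \<in> {1..m}" | "i \<in> {1..m}" "j \<in> {m + 1..m + n}"
      | "i \<in> {m + 1..m + n}" "j \<in> {m + 1..m + n}" | "j < i" | "i \<notin> {1..m + n}" | "j \<notin> {1..m + n}"
      by fastforce
    then show "(i, j) \<in> invs (m + n) w \<longleftrightarrow> (i, j) \<in> cross w"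
      by cases (auto simp: invs_def cross_def less1 less2)
  qed
  have split: "invs (m + n) (w \<circ> ?c) = (invs m a \<union> ?sh ` invs n b) \<union> cross (w \<circ> ?c)"
  proof (intro Set.set_eqI, clarify)
    fix i j
    have sh: "(i, j) \<in> ?sh ` invs n b \<longleftrightarrow>
        i \<in> {m + 1..m + n} \<and> j \<in> {m + 1..m + n} \<and> i < j \<and> b (j - m) < b (i - m)"
    proof
      assume "i \<in> {m + 1..m + n} \<and> j \<in> {m + 1..m + n} \<and> i < j \<and> b (j - m) < b (i - m)"
      then show "(i, j) \<in> ?sh ` invs n b"
        by (intro image_eqI[of _ _ "(i - m, j - m)"]) (auto simp: invs_def)
    qed (auto simp: invs_def)
    have mem: "(i, j) \<in> invs (m + n) (w \<circ> ?c) \<longleftrightarrow>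
          i \<in> {1..m + n} \<and> j \<in> {1..m + n} \<and> i < j \<and> w (?c j) < w (?c i)"
        "(i, j) \<in> invs m a \<longleftrightarrow> i \<in> {1..m} \<and> j \<in> {1..m} \<and> i < j \<and> a j < a i"
        "(i, j) \<in> cross (w \<circ> ?c) \<longleftrightarrow> i \<in> {1..m} \<and> j \<in> {m + 1..m + n} \<and> w (?c j) < w (?c i)"
      by (simp_all add: invs_def cross_def)
    consider "i \<in> {1..m}" "j \<in> {1..m}" | "i \<in> {1..m}" "j \<in> {m + 1..m + n}"
      | "i \<in> {m + 1..m + n}" "j \<in> {m + 1..m + n}" | "i \<in> {m + 1..m + n}" "j \<in> {1..m}"
      | "i \<notin> {1..m + n}" | "j \<notin> {1..m + n}"
      by fastforce
    then show "(i, j) \<in> invs (m + n) (w \<circ> ?c) \<longleftrightarrow> (i, j) \<in> invs m a \<union> ?sh ` invs n b \<union> cross (w \<circ> ?c)"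
    proof cases
      case 1
      have "w (?c j) < w (?c i) \<longleftrightarrow> a j < a i" by (simp only: ca[OF 1(1)] ca[OF 1(2)] less1)
      then show ?thesis using 1 unfolding Un_iff sh mem by auto
    next
      case 3
      have "w (?c j) < w (?c i) \<longleftrightarrow> b (j - m) < b (i - m)"
        unfolding cb(1)[OF 3(1)] cb(1)[OF 3(2)] less2[OF cb(2)[OF 3(2)] cb(2)[OF 3(1)]] by simp
      then show ?thesis using 3 unfolding Un_iff sh mem by auto
    qed (unfold Un_iff sh mem, auto)
  qed
  have "card (invs (m + n) (w \<circ> ?c)) = card (invs m a) + card (?sh ` invs n b) + card (cross (w \<circ> ?c))"
  proof -
    have "invs m a \<inter> ?sh ` invs n b = {}" "(invs m a \<union> ?sh ` invs n b) \<inter> cross (w \<circ> ?c) = {}"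
      by (auto simp: invs_def cross_def)
    then show ?thesis unfolding split by (subst card_Un_disjoint; simp add: fin card_Un_disjoint)
  qed
  also have "card (?sh ` invs n b) = card (invs n b)" by (rule card_image) (auto simp: inj_on_def)
  also have "card (cross (w \<circ> ?c)) = card (cross w)"
  proof (rule bij_betw_same_card[of "map_prod ?c ?c"])
    have bij: "bij_betw (map_prod ?c ?c) ({1..m} \<times> {m + 1..m + n}) ({1..m} \<times> {m + 1..m + n})"
      by (rule bij_betw_map_prod[OF block_bij_left[OF a] block_bij_right[OF a b]])
    have img: "map_prod ?c ?c ` cross (w \<circ> ?c) = cross w"
    proof -
      have "cross w \<subseteq> map_prod ?c ?c ` cross (w \<circ> ?c)"
      proof
        fix x assume x: "x \<in> cross w"
        then have "x \<in> {1..m} \<times> {m + 1..m + n}" by (auto simp: cross_def)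
        then have "x \<in> map_prod ?c ?c ` ({1..m} \<times> {m + 1..m + n})"
          unfolding bij_betw_imp_surj_on[OF bij] .
        then show "x \<in> map_prod ?c ?c ` cross (w \<circ> ?c)"
        proof (rule imageE)
          fix y assume y: "x = map_prod ?c ?c y" "y \<in> {1..m} \<times> {m + 1..m + n}"
          have "y \<in> cross (w \<circ> ?c)"
            using x y by (cases y) (simp add: cross_def)
          then show ?thesis unfolding y(1) by (rule imageI)
        qed
      qed
      moreover have "map_prod ?c ?c y \<in> cross w" if y: "y \<in> cross (w \<circ> ?c)" for y
      proof -
        obtain i j where ij: "y = (i, j)" "i \<in> {1..m}" "j \<in> {m + 1..m + n}" "w (?c j) < w (?c i)"
          using y by (auto simp: cross_def)
        show ?thesis
          using ij(4) ca(2)[OF ij(2)] cb(2)[OF ij(3)] unfolding ij(1) map_prod_simp ca(1)[OF ij(2)] cb(1)[OF ij(3)]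
          by (simp add: cross_def)
      qed
      ultimately show ?thesis by (intro equalityI image_subsetI)
    qed
    show "bij_betw (map_prod ?c ?c) (cross (w \<circ> ?c)) (cross w)"
      by (rule bij_betw_subset[OF bij _ img]) (auto simp: cross_def)
  qed
  finally show ?thesis unfolding cross_w by linarith
qed

section \<open>The braid action on tensor powers\<close>

abbreviation lin_end :: "(('a list \<Rightarrow>\<^sub>0 complex) \<Rightarrow> ('b list \<Rightarrow>\<^sub>0 complex)) \<Rightarrow> bool" where
  "lin_end \<equiv> clin free_algebra free_algebra"

lemma lin_endI: "(\<And>x y. f (x + y) = f x + f y) \<Longrightarrow> (\<And>c x. f (cscale c x) = cscale c (f x)) \<Longrightarrow> lin_end f"
  by (rule clinI) simp_all

lemma lin_end_add: "lin_end f \<Longrightarrow> f (x + y) = f x + f y"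
  and lin_end_cscale: "lin_end f \<Longrightarrow> f (cscale c x) = cscale c (f x)"
  using clin_add[of free_algebra free_algebra f x y] clin_smult[of free_algebra free_algebra f x c] by auto

lemma lin_end_zero: "lin_end f \<Longrightarrow> f 0 = 0"
  using clin_zero[OF cvs_free_algebra cvs_free_algebra, of f] by simp

lemma lin_end_sum: "lin_end f \<Longrightarrow> f (sum g A) = (\<Sum>a\<in>A. f (g a))"
  by (induction A rule: infinite_finite_induct) (simp_all add: lin_end_zero lin_end_add)

lemma lin_end_sum_fun: "(\<And>a. a \<in> A \<Longrightarrow> lin_end (f a)) \<Longrightarrow> lin_end (\<lambda>x. \<Sum>a\<in>A. f a x)"
  by (rule lin_endI) (simp_all add: lin_end_add lin_end_cscale sum.distrib pm.scale_sum_right)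

lemma lin_end_cscale_fun: "lin_end f \<Longrightarrow> lin_end (\<lambda>x. cscale c (f x))"
  by (rule lin_endI) (simp_all add: lin_end_add lin_end_cscale pm.scale_right_distrib mult.commute)

lemma lin_ext_eq_lc: "lin_ext f p = lc free_algebra f p"
  by (simp add: lin_ext_def lc_def finsum_free_algebra)

lemma lin_end_lin_ext: "lin_end (lin_ext f)"
proof -
  have "clin (free_vs UNIV) free_algebra (lc free_algebra f)"
    by (rule cvs.clin_lc[OF cvs_free_algebra]) simp
  then show ?thesis by (simp add: clin_free_algebra lin_ext_eq_lc[abs_def])
qed

lemma lin_ext_basis [simp]:
  fixes f :: "'a \<Rightarrow> 'b list \<Rightarrow>\<^sub>0 complex"
  shows "lin_ext f (basis_vec w) = f w"
  unfolding lin_ext_eq_lc by (rule cvs.lc_basis[OF cvs_free_algebra]) simp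

lemma tensor_power_eq: "tensor_power n = {x. Poly_Mapping.keys x \<subseteq> words n}"
  by (auto simp: tensor_power_def)

lemma tensor_power_basis [simp]: "basis_vec w \<in> tensor_power n \<longleftrightarrow> length w = n"
  by (simp add: tensor_power_def)

lemma tensor_power_zero: "0 \<in> tensor_power n"
  by (simp add: tensor_power_def)

lemma tensor_power_add: "x \<in> tensor_power n \<Longrightarrow> y \<in> tensor_power n \<Longrightarrow> x + y \<in> tensor_power n"
  using keys_add[of x y] by (fastforce simp: tensor_power_def)

lemma tensor_power_cscale: "x \<in> tensor_power n \<Longrightarrow> cscale c x \<in> tensor_power n"
  using keys_cscale[of c x] by (auto simp: tensor_power_def)

lemma tensor_power_sum: "(\<And>a. a \<in> A \<Longrightarrow> f a \<in> tensor_power n) \<Longrightarrow> sum f A \<in> tensor_power n"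
  by (induction A rule: infinite_finite_induct) (simp_all add: tensor_power_zero tensor_power_add)

lemma tensor_power_mult: "x \<in> tensor_power m \<Longrightarrow> y \<in> tensor_power n \<Longrightarrow> x * y \<in> tensor_power (m + n)"
  using keys_mult[of x y] by (fastforce simp: tensor_power_def plus_list_def)

lemma tensor_power_ext:
  assumes "cvs P" "clin free_algebra P f" "clin free_algebra P g" "x \<in> tensor_power n"
    and "\<And>w. length w = n \<Longrightarrow> f (basis_vec w) = g (basis_vec w)"
  shows "f x = g x"
  by (rule clin_free_unique[OF assms(1), where C = "words n"])
    (use assms in \<open>auto simp: clin_def tensor_power_eq\<close>)

lemma lin_end_tensor_power:
  assumes "lin_end f" "x \<in> tensor_power n" "\<And>w. length w = n \<Longrightarrow> f (basis_vec w) \<in> tensor_power k"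
  shows "f x \<in> tensor_power k"
proof -
  have "f x = (\<Sum>w\<in>Poly_Mapping.keys x. cscale (Poly_Mapping.lookup x w) (f (basis_vec w)))"
    by (subst poly_mapping_sum_basis) (simp add: lin_end_sum[OF assms(1)] lin_end_cscale[OF assms(1)] del: cscale_single)
  also have "\<dots> \<in> tensor_power k"
    using assms(2,3) by (intro tensor_power_sum tensor_power_cscale) (auto simp: tensor_power_def)
  finally show ?thesis .
qed

lemma lin_end_mult_left: "lin_end (\<lambda>x. y * x)"
  by (rule lin_endI) (simp_all add: distrib_left cscale_mult_right)

lemma lin_end_mult_right: "lin_end (\<lambda>x. x * y)"
  by (rule lin_endI) (simp_all add: distrib_right cscale_mult_left)

lemma lin_end_braid_at: "lin_end (braid_at \<sigma> r)"
  unfolding braid_at_def by (rule lin_end_lin_ext)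

lemma braid_at_basis:
  assumes "length is = 2"
  shows "braid_at \<sigma> (Suc (length u)) (basis_vec (u @ is @ v)) =
    (\<Sum>ks\<in>words 2. cscale (coef_word \<sigma> is ks) (basis_vec (u @ ks @ v)))"
proof -
  obtain a b where "is": "is = [a, b]" using assms by (auto simp: numeral_2_eq_2 length_Suc_conv)
  have "braid_at \<sigma> (Suc (length u)) (basis_vec (u @ is @ v)) =
    (\<Sum>(k, l)\<in>UNIV. cscale (coef \<sigma> a b k l) (basis_vec (u @ [k, l] @ v)))"
    by (simp add: braid_at_def "is" nth_append)
  also have "\<dots> = (\<Sum>ks\<in>words 2. cscale (coef \<sigma> a b (ks ! 0) (ks ! 1)) (basis_vec (u @ [ks ! 0, ks ! 1] @ v)))"
    by (rule sum_words_two)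
  also have "\<dots> = (\<Sum>ks\<in>words 2. cscale (coef_word \<sigma> is ks) (basis_vec (u @ ks @ v)))"
    by (intro sum.cong refl) (auto simp: numeral_2_eq_2 length_Suc_conv coef_word_def "is")
  finally show ?thesis .
qed

text \<open>Positions count from 1, so \<open>r - 1\<close> letters precede the pair on which
  \<open>braid_at \<sigma> r\<close> acts.\<close>

lemma word_split_at:
  assumes "r \<in> {1..<n}" "length w = n"
  obtains u "is" v where "w = u @ is @ v" "length is = 2" "r = Suc (length u)" "length v = n - r - 1"
proof
  show "w = take (r - 1) w @ take 2 (drop (r - 1) w) @ drop (r + 1) w"
  proof -
    have "2 + (r - 1) = r + 1" using assms by auto
    then have "drop 2 (drop (r - 1) w) = drop (r + 1) w" by (simp only: drop_drop)
    then show ?thesis by (metis append_take_drop_id)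
  qed
qed (use assms in auto)

lemma braid_at_closed:
  assumes "r \<in> {1..<n}" "x \<in> tensor_power n"
  shows "braid_at \<sigma> r x \<in> tensor_power n"
proof (rule lin_end_tensor_power[OF lin_end_braid_at assms(2)])
  fix w :: "'a list" assume "length w = n"
  from word_split_at[OF assms(1) this] obtain u "is" v
    where w: "w = u @ is @ v" "length is = 2" "r = Suc (length u)" "length v = n - r - 1" .
  show "braid_at \<sigma> r (basis_vec w) \<in> tensor_power n"
    unfolding w(1,3) braid_at_basis[OF w(2)]
    by (intro tensor_power_sum tensor_power_cscale) (use w \<open>length w = n\<close> in auto)
qed

lemma bilinear_tensor_power_ext:
  assumes "\<And>y. lin_end (\<lambda>x. f x y)" "\<And>x. lin_end (f x)" "\<And>y. lin_end (\<lambda>x. g x y)" "\<And>x. lin_end (g x)"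
    and "\<And>u v. length u = m \<Longrightarrow> length v = n \<Longrightarrow> f (basis_vec u) (basis_vec v) = g (basis_vec u) (basis_vec v)"
    and "x \<in> tensor_power m" "y \<in> tensor_power n"
  shows "f x y = g x y"
  by (rule tensor_power_ext[OF cvs_free_algebra assms(1,3) assms(6)])
    (rule tensor_power_ext[OF cvs_free_algebra assms(2,4) assms(7)], rule assms(5))

lemma braid_at_mult_right:
  assumes "r \<in> {1..<m}" "x \<in> tensor_power m"
  shows "braid_at \<sigma> r (x * y) = braid_at \<sigma> r x * y"
proof (rule tensor_power_ext[OF cvs_free_algebra _ _ assms(2)])
  show "lin_end (\<lambda>x. braid_at \<sigma> r (x * y))"
    by (rule clin_comp[OF lin_end_mult_right lin_end_braid_at])
  show "lin_end (\<lambda>x. braid_at \<sigma> r x * y)"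
    by (rule clin_comp[OF lin_end_braid_at lin_end_mult_right])
  fix w :: "'a list" assume "length w = m"
  from word_split_at[OF assms(1) this] obtain u "is" v
    where w: "w = u @ is @ v" "length is = 2" "r = Suc (length u)" "length v = m - r - 1" .
  show "braid_at \<sigma> r (basis_vec w * y) = braid_at \<sigma> r (basis_vec w) * y"
  proof (rule free_algebra_ext[OF cvs_free_algebra, where p = y
        and f = "\<lambda>y. braid_at \<sigma> r (basis_vec w * y)" and g = "\<lambda>y. braid_at \<sigma> r (basis_vec w) * y"])
    show "lin_end (\<lambda>y. braid_at \<sigma> r (basis_vec w * y))"
      by (rule clin_comp[OF lin_end_mult_left lin_end_braid_at])
    show "lin_end ((*) (braid_at \<sigma> r (basis_vec w)))"
      by (rule lin_end_mult_left)
    fix t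
    show "braid_at \<sigma> r (basis_vec w * basis_vec t) = braid_at \<sigma> r (basis_vec w) * basis_vec t"
      using braid_at_basis[OF w(2), of \<sigma> u "v @ t"] braid_at_basis[OF w(2), of \<sigma> u v]
      by (simp add: w(1,3) basis_mult sum_distrib_right cscale_mult_left del: cscale_single)
  qed
qed

lemma braid_at_mult_left:
  assumes "r \<in> {1..<n}" "x \<in> tensor_power m" "y \<in> tensor_power n"
  shows "braid_at \<sigma> (m + r) (x * y) = x * braid_at \<sigma> r y"
proof (rule bilinear_tensor_power_ext[OF _ _ _ _ _ assms(2,3)])
  show "lin_end (\<lambda>x. braid_at \<sigma> (m + r) (x * y))" "lin_end (\<lambda>y. braid_at \<sigma> (m + r) (x * y))" for x y
    by (rule clin_comp[OF lin_end_mult_right lin_end_braid_at] clin_comp[OF lin_end_mult_left lin_end_braid_at])+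
  show "lin_end (\<lambda>x. x * braid_at \<sigma> r y)" "lin_end (\<lambda>y. x * braid_at \<sigma> r y)" for x y
    by (rule lin_end_mult_right clin_comp[OF lin_end_braid_at lin_end_mult_left])+
  fix t w :: "'a list" assume t: "length t = m" and "length w = n"
  from word_split_at[OF assms(1) this(2)] obtain u "is" v
    where w: "w = u @ is @ v" "length is = 2" "r = Suc (length u)" "length v = n - r - 1" .
  show "braid_at \<sigma> (m + r) (basis_vec t * basis_vec w) = basis_vec t * braid_at \<sigma> r (basis_vec w)"
    using braid_at_basis[OF w(2), of \<sigma> "t @ u" v] braid_at_basis[OF w(2), of \<sigma> u v]
    by (simp add: w(1,3) basis_mult sum_distrib_left cscale_mult_right t del: cscale_single)
qed

lemma braid_at_commute:
  assumes "r \<in> {1..<n}" "s \<in> {1..<n}" "r + 1 < s" "x \<in> tensor_power n"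
  shows "braid_at \<sigma> r (braid_at \<sigma> s x) = braid_at \<sigma> s (braid_at \<sigma> r x)"
proof (rule tensor_power_ext[OF cvs_free_algebra _ _ assms(4)])
  show "lin_end (\<lambda>x. braid_at \<sigma> r (braid_at \<sigma> s x))" "lin_end (\<lambda>x. braid_at \<sigma> s (braid_at \<sigma> r x))"
    by (rule clin_comp[OF lin_end_braid_at lin_end_braid_at])+
  fix w :: "'a list" assume w: "length w = n"
  \<comment> \<open>The word is cut just before position \<open>s\<close>: since
    \<open>r + 1 < s\<close>, the operator at \<open>r\<close> acts inside the left piece, and the
    operator at \<open>s\<close> acts at position 1 of the right piece.\<close>
  define y z where "y = (basis_vec (take (s - 1) w) :: 'a tensors)" and "z = (basis_vec (drop (s - 1) w) :: 'a tensors)"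
  have yz: "basis_vec w = y * z" by (simp add: y_def z_def basis_mult)
  have y: "y \<in> tensor_power (s - 1)" and z: "z \<in> tensor_power (n - (s - 1))"
    using w assms by (auto simp: y_def z_def)
  have r: "r \<in> {1..<s - 1}" and one: "1 \<in> {1..<n - (s - 1)}" and s: "s - 1 + 1 = s" using assms by auto
  note R = braid_at_mult_right[OF r y]
  note S = braid_at_mult_left[OF one y z, unfolded s] braid_at_mult_left[OF one braid_at_closed[OF r y] z, unfolded s]
  show "braid_at \<sigma> r (braid_at \<sigma> s (basis_vec w)) = braid_at \<sigma> s (braid_at \<sigma> r (basis_vec w))"
    unfolding yz by (simp only: S R)
qed

text \<open>\<open>braiding\<close> provides the relation on three tensor factors only. Cutting the
  word into a prefix, three letters and a suffix carries it to position \<open>r\<close>.\<close>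

lemma braid_at_braid:
  assumes \<sigma>: "braiding \<sigma>" and r: "1 \<le> r" "r + 1 < n" and x: "x \<in> tensor_power n"
  shows "braid_at \<sigma> r (braid_at \<sigma> (r + 1) (braid_at \<sigma> r x)) =
    braid_at \<sigma> (r + 1) (braid_at \<sigma> r (braid_at \<sigma> (r + 1) x))"
proof (rule tensor_power_ext[OF cvs_free_algebra _ _ x])
  show "lin_end (\<lambda>x. braid_at \<sigma> r (braid_at \<sigma> (r + 1) (braid_at \<sigma> r x)))"
    "lin_end (\<lambda>x. braid_at \<sigma> (r + 1) (braid_at \<sigma> r (braid_at \<sigma> (r + 1) x)))"
    by (rule clin_comp[OF lin_end_braid_at clin_comp[OF lin_end_braid_at lin_end_braid_at]])+
  fix w :: "'a list" assume w: "length w = n"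
  define y x z where "y = (basis_vec (take (r - 1) w) :: 'a tensors)"
    and "x = (basis_vec (take 3 (drop (r - 1) w)) :: 'a tensors)"
    and "z = (basis_vec (drop (r + 2) w) :: 'a tensors)"
  have "take 3 (drop (r - 1) w) @ drop (r + 2) w = drop (r - 1) w"
    using r append_take_drop_id[of 3 "drop (r - 1) w"] by simp
  then have yz: "basis_vec w = y * (x * z)" by (simp add: y_def z_def x_def basis_mult)
  have y: "y \<in> tensor_power (r - 1)" and x: "x \<in> tensor_power 3" and z: "z \<in> tensor_power (n - r - 2)"
    using w r by (auto simp: y_def z_def x_def)
  \<comment> \<open>Positions 1 and 2 of the middle piece are positions \<open>r\<close> and
    \<open>r + 1\<close> of the whole word. The degree is recorded as well, so that the equation can
    be iterated.\<close>
  have F: "braid_at \<sigma> (r - 1 + k) (y * (x' * z)) = y * (braid_at \<sigma> k x' * z) \<and> braid_at \<sigma> k x' \<in> tensor_power 3"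
    if "k \<in> {1..<3}" "x' \<in> tensor_power 3" for k x'
  proof -
    have "k \<in> {1..<3 + (n - r - 2)}" using that by simp
    from braid_at_mult_left[OF this y tensor_power_mult[OF that(2) z]]
    show ?thesis using braid_at_mult_right[OF that] braid_at_closed[OF that] by simp
  qed
  have F1: "braid_at \<sigma> r (y * (x' * z)) = y * (braid_at \<sigma> (Suc 0) x' * z)"
    "braid_at \<sigma> (Suc 0) x' \<in> tensor_power 3"
    "braid_at \<sigma> (Suc r) (y * (x' * z)) = y * (braid_at \<sigma> 2 x' * z)"
    "braid_at \<sigma> 2 x' \<in> tensor_power 3" if "x' \<in> tensor_power 3" for x'
    using F[of 1 x'] F[of 2 x'] that r by simp_all
  have b: "braid_at \<sigma> 1 (braid_at \<sigma> 2 (braid_at \<sigma> 1 x)) = braid_at \<sigma> 2 (braid_at \<sigma> 1 (braid_at \<sigma> 2 x))"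
    using \<sigma> x by (simp add: braiding_def)
  show "braid_at \<sigma> r (braid_at \<sigma> (r + 1) (braid_at \<sigma> r (basis_vec w))) =
    braid_at \<sigma> (r + 1) (braid_at \<sigma> r (braid_at \<sigma> (r + 1) (basis_vec w)))"
    unfolding yz using b by (simp add: F1 x)
qed

lemma braid_word_eq: "braid_word \<sigma> = act_word (braid_at \<sigma>)"
  by (simp add: fun_eq_iff braid_word_def act_word_def)

lemma braid_word_simps [simp]:
  "braid_word \<sigma> [] x = x" "braid_word \<sigma> (r # rs) x = braid_at \<sigma> r (braid_word \<sigma> rs x)"
  by (simp_all add: braid_word_eq)

lemma braid_word_append: "braid_word \<sigma> (rs @ ss) x = braid_word \<sigma> rs (braid_word \<sigma> ss x)"
  by (induction rs) simp_all

lemma lin_end_braid_word: "lin_end (braid_word \<sigma> rs)"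
proof (induction rs)
  case Nil
  show ?case by (rule lin_endI) simp_all
next
  case (Cons r rs)
  show ?case using clin_comp[OF Cons lin_end_braid_at, of \<sigma> r] by (simp add: clin_def)
qed

lemma braid_word_closed:
  "set rs \<subseteq> {1..<n} \<Longrightarrow> x \<in> tensor_power n \<Longrightarrow> braid_word \<sigma> rs x \<in> tensor_power n"
  by (induction rs) (simp_all add: braid_at_closed)

lemma braid_word_mult_right:
  "set rs \<subseteq> {1..<m} \<Longrightarrow> x \<in> tensor_power m \<Longrightarrow> braid_word \<sigma> rs (x * y) = braid_word \<sigma> rs x * y"
  by (induction rs) (simp_all add: braid_at_mult_right[where m = m] braid_word_closed)

lemma braid_word_mult_left:
  "set rs \<subseteq> {1..<n} \<Longrightarrow> x \<in> tensor_power m \<Longrightarrow> y \<in> tensor_power n \<Longrightarrow>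
    braid_word \<sigma> (map (\<lambda>r. m + r) rs) (x * y) = x * braid_word \<sigma> rs y"
  by (induction rs) (simp_all add: braid_at_mult_left[where n = n] braid_word_closed)

lemma reduced_word_set: "reduced_word n w rs \<Longrightarrow> set rs \<subseteq> {1..<n}"
  by (simp add: reduced_word_def)

lemma lin_end_braid_perm: "lin_end (braid_perm \<sigma> n w)"
  unfolding braid_perm_def by (rule lin_end_braid_word)

text \<open>Matsumoto's theorem makes the choice of reduced word inside \<open>braid_perm\<close>
  harmless on \<open>tensor_power n\<close>.\<close>

lemma braid_perm_word:
  assumes "braiding \<sigma>" "reduced_word n w rs" "x \<in> tensor_power n"
  shows "braid_perm \<sigma> n w x = braid_word \<sigma> rs x"
proof -
  have red: "reduced_word n w (SOME rs. reduced_word n w rs)" by (rule someI, rule assms(2))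
  show ?thesis unfolding braid_perm_def braid_word_eq
    by (rule matsumoto[where F = "braid_at \<sigma>" and X = "tensor_power n" and n = n, rotated 3, OF red assms(2,3)];
        rule braid_at_closed braid_at_commute braid_at_braid[OF assms(1)]; assumption)
qed

lemma braid_perm_closed:
  assumes "w permutes {1..n}" "x \<in> tensor_power n"
  shows "braid_perm \<sigma> n w x \<in> tensor_power n"
proof -
  have "reduced_word n w (SOME rs. reduced_word n w rs)"
    by (rule someI_ex) (rule exists_reduced_word[OF assms(1)])
  then show ?thesis unfolding braid_perm_def
    by (intro braid_word_closed assms(2)) (rule reduced_word_set)
qed

text \<open>Since the inversion numbers add, reduced words of \<open>w\<close>, of \<open>a\<close>
  and of \<open>b\<close> with letters shifted by \<open>m\<close> concatenate to a reduced word. In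
  it the letters of \<open>a\<close> act on the left tensor factor and the shifted letters of
  \<open>b\<close> on the right one.\<close>

lemma braid_perm_block:
  assumes \<sigma>: "braiding \<sigma>" and w: "w \<in> shuffle_perms m n" and a: "a permutes {1..m}" and b: "b permutes {1..n}"
    and x: "x \<in> tensor_power m" and y: "y \<in> tensor_power n"
  shows "braid_perm \<sigma> (m + n) w (braid_perm \<sigma> m a x * braid_perm \<sigma> n b y) =
    braid_perm \<sigma> (m + n) (w \<circ> block_perm m a b) (x * y)"
proof -
  have wp: "w permutes {1..m + n}" using w by (simp add: shuffle_perms_def)
  obtain ws as bs where red: "reduced_word (m + n) w ws" "reduced_word m a as" "reduced_word n b bs"
    using exists_reduced_word wp a b by metis
  have sets: "set as \<subseteq> {1..<m}" "set bs \<subseteq> {1..<n}" "set ws \<subseteq> {1..<m + n}"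
    using red by (auto simp: reduced_word_iff)
  have whole: "reduced_word (m + n) (w \<circ> block_perm m a b) (ws @ as @ map (\<lambda>r. m + r) bs)"
    unfolding reduced_word_iff
  proof (intro conjI)
    show "set (ws @ as @ map ((+) m) bs) \<subseteq> {1..<m + n}"
      using sets by fastforce
    show "perm_of_word (ws @ as @ map ((+) m) bs) = w \<circ> block_perm m a b"
      using red perm_of_word_shift[OF sets(2), of m] by (simp only: perm_of_word_append reduced_word_iff)
    show "length (ws @ as @ map ((+) m) bs) = card (invs (m + n) (w \<circ> block_perm m a b))"
      unfolding card_invs_block[OF w a b] using red by (simp add: reduced_word_iff)
  qed
  have "braid_perm \<sigma> (m + n) (w \<circ> block_perm m a b) (x * y) =
      braid_word \<sigma> ws (braid_word \<sigma> as x * braid_word \<sigma> bs y)"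
    unfolding braid_perm_word[OF \<sigma> whole tensor_power_mult[OF x y]]
    by (simp add: braid_word_append braid_word_mult_left[OF sets(2) x y] braid_word_mult_right[OF sets(1) x])
  also have "\<dots> = braid_perm \<sigma> (m + n) w (braid_perm \<sigma> m a x * braid_perm \<sigma> n b y)"
    unfolding braid_perm_word[OF \<sigma> red(2) x] braid_perm_word[OF \<sigma> red(3) y]
    by (rule braid_perm_word[OF \<sigma> red(1), symmetric])
      (intro tensor_power_mult braid_word_closed sets x y)
  finally show ?thesis by simp
qed

section \<open>The quantum exterior algebra\<close>

definition antisymmetrizer :: "complex \<Rightarrow> ('i::finite) endo2 \<Rightarrow> 'i tensors \<Rightarrow> 'i tensors" where
  "antisymmetrizer q \<sigma> = lin_ext (\<lambda>w. qantisym q \<sigma> (length w) (basis_vec w))"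

lemma antisym_basis: "antisymmetrizer q \<sigma> (basis_vec w) = qantisym q \<sigma> (length w) (basis_vec w)"
  by (simp add: antisymmetrizer_def)

lemma lin_end_antisym: "lin_end (antisymmetrizer q \<sigma>)"
  unfolding antisymmetrizer_def by (rule lin_end_lin_ext)

lemma lin_end_qantisym: "lin_end (qantisym q \<sigma> k)"
proof -
  have "lin_end (\<lambda>x. qantisym q \<sigma> k x)"
    unfolding qantisym_def by (intro lin_end_cscale_fun lin_end_sum_fun lin_end_braid_perm)
  then show ?thesis .
qed

lemma antisym_tensor_power: "x \<in> tensor_power k \<Longrightarrow> antisymmetrizer q \<sigma> x = qantisym q \<sigma> k x"
  by (rule tensor_power_ext[OF cvs_free_algebra lin_end_antisym lin_end_qantisym])
    (auto simp: antisym_basis)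

lemma qantisym_closed: "x \<in> tensor_power k \<Longrightarrow> qantisym q \<sigma> k x \<in> tensor_power k"
  unfolding qantisym_def
  by (intro tensor_power_cscale tensor_power_sum braid_perm_closed) simp_all

lemma bilinear_qshuffle: "lin_end (\<lambda>x. qshuffle q \<sigma> x y)" "lin_end (qshuffle q \<sigma> x)"
proof -
  show "lin_end (\<lambda>x. qshuffle q \<sigma> x y)"
    unfolding qshuffle_def by (rule lin_end_lin_ext)
  \<comment> \<open>Only the outer \<open>lin_ext\<close> is expanded into a finite sum over the
    support of \<open>x\<close>; its terms are inner extensions, which are linear in
    \<open>y\<close>.\<close>
  have "lin_end (\<lambda>y. qshuffle q \<sigma> x y)"
    unfolding qshuffle_def lin_ext_def[where p = x]
    by (intro lin_end_sum_fun lin_end_cscale_fun lin_end_lin_ext)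
  then show "lin_end (qshuffle q \<sigma> x)" .
qed

definition length_sign :: "complex \<Rightarrow> nat \<Rightarrow> (nat \<Rightarrow> nat) \<Rightarrow> complex" where
  "length_sign q n w = (- q) powi (- int (perm_length n w))"

text \<open>The degrees being fixed, the coefficient no longer depends on the words and both sides
  are bilinear. The product of the free algebra plays the role of the tensor product of
  \<open>x\<close> and \<open>y\<close>.\<close>

lemma qshuffle_tensor_power:
  assumes "x \<in> tensor_power m" "y \<in> tensor_power n"
  shows "qshuffle q \<sigma> x y =
    cscale (qfact (q powi (-2)) m * qfact (q powi (-2)) n / qfact (q powi (-2)) (m + n))
      (\<Sum>w\<in>shuffle_perms m n. cscale (length_sign q (m + n) w) (braid_perm \<sigma> (m + n) w (x * y)))"
proof (rule bilinear_tensor_power_ext[OF bilinear_qshuffle _ _ _ assms], goal_cases)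
  case (1 y)
  show ?case by (intro lin_end_cscale_fun lin_end_sum_fun clin_comp[OF lin_end_mult_right lin_end_braid_perm])
next
  case (2 x)
  show ?case by (intro lin_end_cscale_fun lin_end_sum_fun clin_comp[OF lin_end_mult_left lin_end_braid_perm])
next
  case (3 u v)
  then show ?case by (simp add: qshuffle_def Let_def length_sign_def basis_mult)
qed

lemma qfact_nonzero:
  assumes "\<forall>n\<ge>1. \<nu> ^ n \<noteq> (1 :: complex)"
  shows "qfact \<nu> n \<noteq> 0"
proof -
  \<comment> \<open>The exponent 1 secures the denominators of \<open>qnum\<close>; the other
    exponents secure the numerators.\<close>
  have "\<nu> \<noteq> 1" using assms[rule_format, of 1] by simp
  then show ?thesis using assms unfolding qfact_def qnum_def by auto
qed

context
  fixes q :: complex and \<sigma> :: "('i::finite) endo2"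
  assumes q: "q \<noteq> 0" and root: "\<forall>n\<ge>1. (q powi (-2)) ^ n \<noteq> 1" and \<sigma>: "braiding \<sigma>"
begin

private lemma qf: "qfact (q powi (-2)) n \<noteq> 0"
  by (rule qfact_nonzero[OF root])

private lemma length_sign_block:
  assumes w: "w \<in> shuffle_perms m n" and a: "a permutes {1..m}" and b: "b permutes {1..n}"
  shows "length_sign q (m + n) (w \<circ> block_perm m a b) =
    length_sign q (m + n) w * length_sign q m a * length_sign q n b"
proof -
  have wp: "w permutes {1..m + n}" using w by (simp add: shuffle_perms_def)
  have "perm_length (m + n) (w \<circ> block_perm m a b) =
      perm_length (m + n) w + perm_length m a + perm_length n b"
    unfolding perm_length_eq[OF wp] perm_length_eq[OF a] perm_length_eq[OF b]
      perm_length_eq[OF permutes_compose[OF block_permutes[OF a b] wp]]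
    by (rule card_invs_block[OF w a b])
  then show ?thesis by (simp only: length_sign_def power_int_minus power_int_of_nat power_add) simp
qed

text \<open>The factorial quotient in the shuffle product is made for this identity: its numerator
  cancels the normalizations of the antisymmetrizers of degrees \<open>m\<close> and
  \<open>n\<close>, which relies on q-factorials being nonzero, and its denominator normalizes the
  one of degree \<open>m + n\<close>. The remaining triple sum is reindexed by the shuffle
  decomposition, under which signs multiply and braid operators compose.\<close>

lemma qshuffle_qantisym:
  assumes x: "x \<in> tensor_power m" and y: "y \<in> tensor_power n"
  shows "qshuffle q \<sigma> (qantisym q \<sigma> m x) (qantisym q \<sigma> n y) = qantisym q \<sigma> (m + n) (x * y)"
proof -
  let ?f = "qfact (q powi (-2))"
  let ?A = "\<lambda>n. {a. a permutes {1..n :: nat}}"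
  let ?S = "shuffle_perms m n" and ?l = "length_sign q"
  have fin: "finite (?A n)" for n by (rule finite_permutations) simp
  have wterm: "braid_perm \<sigma> (m + n) w (qantisym q \<sigma> m x * qantisym q \<sigma> n y) =
      cscale (1 / (?f m * ?f n)) (\<Sum>a\<in>?A m. \<Sum>b\<in>?A n. cscale (?l m a * ?l n b)
        (braid_perm \<sigma> (m + n) (w \<circ> block_perm m a b) (x * y)))" if w: "w \<in> ?S" for w
  proof -
    have "qantisym q \<sigma> m x * qantisym q \<sigma> n y =
      cscale (1 / (?f m * ?f n)) (\<Sum>a\<in>?A m. \<Sum>b\<in>?A n. cscale (?l m a * ?l n b)
        (braid_perm \<sigma> m a x * braid_perm \<sigma> n b y))"
      by (simp add: qantisym_def length_sign_def cscale_mult_left cscale_mult_right sum_product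
        mult.commute[of "qfact _ n"] mult.commute[of "_ powi (- int (perm_length n _))"])
    then have "braid_perm \<sigma> (m + n) w (qantisym q \<sigma> m x * qantisym q \<sigma> n y) =
      cscale (1 / (?f m * ?f n)) (\<Sum>a\<in>?A m. \<Sum>b\<in>?A n. cscale (?l m a * ?l n b)
        (braid_perm \<sigma> (m + n) w (braid_perm \<sigma> m a x * braid_perm \<sigma> n b y)))"
      by (simp only: lin_end_cscale[OF lin_end_braid_perm] lin_end_sum[OF lin_end_braid_perm])
    also have "\<dots> = cscale (1 / (?f m * ?f n)) (\<Sum>a\<in>?A m. \<Sum>b\<in>?A n. cscale (?l m a * ?l n b)
        (braid_perm \<sigma> (m + n) (w \<circ> block_perm m a b) (x * y)))"
      by (intro arg_cong[where f = "cscale _"] sum.cong refl) (simp add: braid_perm_block[OF \<sigma> w _ _ x y])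
    finally show ?thesis .
  qed
  have "qshuffle q \<sigma> (qantisym q \<sigma> m x) (qantisym q \<sigma> n y) =
      cscale (?f m * ?f n / ?f (m + n)) (\<Sum>w\<in>?S. cscale (?l (m + n) w)
        (cscale (1 / (?f m * ?f n)) (\<Sum>a\<in>?A m. \<Sum>b\<in>?A n. cscale (?l m a * ?l n b)
        (braid_perm \<sigma> (m + n) (w \<circ> block_perm m a b) (x * y)))))"
    unfolding qshuffle_tensor_power[OF qantisym_closed[OF x] qantisym_closed[OF y]]
    by (simp add: wterm)
  also have "\<dots> = cscale (1 / ?f (m + n)) (\<Sum>w\<in>?S. \<Sum>a\<in>?A m. \<Sum>b\<in>?A n.
      cscale (?l (m + n) w * ?l m a * ?l n b)
        (braid_perm \<sigma> (m + n) (w \<circ> block_perm m a b) (x * y)))"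
    using qf[of m] qf[of n] by (simp add: pm.scale_sum_right mult.assoc)
  also have "\<dots> = cscale (1 / ?f (m + n)) (\<Sum>w\<in>?S. \<Sum>a\<in>?A m. \<Sum>b\<in>?A n.
      cscale (?l (m + n) (w \<circ> block_perm m a b))
        (braid_perm \<sigma> (m + n) (w \<circ> block_perm m a b) (x * y)))"
    by (intro arg_cong[where f = "cscale _"] sum.cong refl) (simp add: length_sign_block)
  also have "\<dots> = cscale (1 / ?f (m + n)) (\<Sum>(w, a, b)\<in>?S \<times> ?A m \<times> ?A n.
      cscale (?l (m + n) (w \<circ> block_perm m a b))
        (braid_perm \<sigma> (m + n) (w \<circ> block_perm m a b) (x * y)))"
    by (simp add: sum.cartesian_product)
  also have "\<dots> = cscale (1 / ?f (m + n)) (\<Sum>p\<in>?A (m + n).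
      cscale (?l (m + n) p) (braid_perm \<sigma> (m + n) p (x * y)))"
    using sum.reindex_bij_betw[OF shuffle_decomposition_bij[of m n],
      of "\<lambda>p. cscale (?l (m + n) p) (braid_perm \<sigma> (m + n) p (x * y))"]
    by (simp add: case_prod_unfold)
  also have "\<dots> = qantisym q \<sigma> (m + n) (x * y)" by (simp add: qantisym_def length_sign_def)
  finally show ?thesis .
qed

lemma qshuffle_antisym: "qshuffle q \<sigma> (antisymmetrizer q \<sigma> x) (antisymmetrizer q \<sigma> y) = antisymmetrizer q \<sigma> (x * y)"
proof (rule free_algebra_ext[OF cvs_free_algebra, where p = x
      and f = "\<lambda>x. qshuffle q \<sigma> (antisymmetrizer q \<sigma> x) (antisymmetrizer q \<sigma> y)" and g = "\<lambda>x. antisymmetrizer q \<sigma> (x * y)"])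
  show "lin_end (\<lambda>x. qshuffle q \<sigma> (antisymmetrizer q \<sigma> x) (antisymmetrizer q \<sigma> y))"
    by (rule clin_comp[OF lin_end_antisym bilinear_qshuffle(1)])
  show "lin_end (\<lambda>x. antisymmetrizer q \<sigma> (x * y))"
    by (rule clin_comp[OF lin_end_mult_right lin_end_antisym])
  fix u
  show "qshuffle q \<sigma> (antisymmetrizer q \<sigma> (basis_vec u)) (antisymmetrizer q \<sigma> y) = antisymmetrizer q \<sigma> (basis_vec u * y)"
  proof (rule free_algebra_ext[OF cvs_free_algebra, where p = y
        and f = "\<lambda>y. qshuffle q \<sigma> (antisymmetrizer q \<sigma> (basis_vec u)) (antisymmetrizer q \<sigma> y)"
        and g = "\<lambda>y. antisymmetrizer q \<sigma> (basis_vec u * y)"])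
    show "lin_end (\<lambda>y. qshuffle q \<sigma> (antisymmetrizer q \<sigma> (basis_vec u)) (antisymmetrizer q \<sigma> y))"
      by (rule clin_comp[OF lin_end_antisym bilinear_qshuffle(2)])
    show "lin_end (\<lambda>y. antisymmetrizer q \<sigma> (basis_vec u * y))"
      by (rule clin_comp[OF lin_end_mult_left lin_end_antisym])
    fix v
    show "qshuffle q \<sigma> (antisymmetrizer q \<sigma> (basis_vec u)) (antisymmetrizer q \<sigma> (basis_vec v)) =
        antisymmetrizer q \<sigma> (basis_vec u * basis_vec v)"
      using qshuffle_qantisym[of "basis_vec u" "length u" "basis_vec v" "length v"]
      by (simp add: antisym_basis basis_mult)
  qed
qed

text \<open>In degrees 0 and 1 the identity is the only permutation. This places the unit and the
  generators in the image of the antisymmetrizer.\<close>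

private lemma qantisym_small:
  assumes "n \<le> 1" "x \<in> tensor_power n"
  shows "qantisym q \<sigma> n x = x"
proof -
  have perms: "{w. w permutes {1..n}} = {id}"
    using assms(1) by (cases n) (auto simp: permutes_empty permutes_sing)
  have red: "reduced_word n id []" by (simp add: reduced_word_iff)
  have "q powi (-2) \<noteq> 1" using root[rule_format, of 1] by simp
  then have "qfact (q powi (-2)) n = 1" using assms(1) by (cases n) (auto simp: qfact_def qnum_def)
  moreover have "perm_length n id = 0" using red by (simp add: reduced_word_def)
  ultimately show ?thesis
    unfolding qantisym_def perms using braid_perm_word[OF \<sigma> red assms(2)] by simp
qed

lemma antisym_small: "n \<le> 1 \<Longrightarrow> x \<in> tensor_power n \<Longrightarrow> antisymmetrizer q \<sigma> x = x"
  using antisym_tensor_power[of x n q \<sigma>] qantisym_small[of n x] by simp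

lemma antisym_one: "antisymmetrizer q \<sigma> 1 = 1"
  by (rule antisym_small[of 0]) (simp_all add: one_eq_basis)

text \<open>The image contains the unit and the generators and is closed under the product by
  \<open>qshuffle_antisym\<close>. Conversely, peeling off letters exhibits an antisymmetrized word
  as an iterated product of generators.\<close>

lemma qext_carrier_eq: "qext_carrier q \<sigma> = range (antisymmetrizer q \<sigma>)"
proof (intro equalityI subsetI)
  fix x assume "x \<in> qext_carrier q \<sigma>"
  then show "x \<in> range (antisymmetrizer q \<sigma>)"
  proof induction
    case one
    show ?case using antisym_one by (metis rangeI)
  next
    case (generator x)
    then show ?case using antisym_small[of 1 x] by (metis order.refl rangeI)
  next
    case (add x y)
    then show ?case by (auto simp flip: lin_end_add[OF lin_end_antisym])
  next
    case (scale x c)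
    then show ?case by (auto simp flip: lin_end_cscale[OF lin_end_antisym])
  next
    case (mult x y)
    then show ?case by (auto simp: qshuffle_antisym)
  qed
next
  have word: "antisymmetrizer q \<sigma> (basis_vec w) \<in> qext_carrier q \<sigma>" for w
  proof (induction w)
    case Nil
    show ?case using antisym_one qext_carrier.one by (simp add: one_eq_basis)
  next
    case (Cons i w)
    have "antisymmetrizer q \<sigma> (basis_vec (i # w)) =
        qshuffle q \<sigma> (antisymmetrizer q \<sigma> (basis_vec [i])) (antisymmetrizer q \<sigma> (basis_vec w))"
      by (simp add: qshuffle_antisym basis_mult)
    moreover have "antisymmetrizer q \<sigma> (basis_vec [i]) = basis_vec [i]" by (rule antisym_small[of 1]) simp_all
    ultimately show ?case using qext_carrier.mult[OF qext_carrier.generator Cons.IH] by simp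
  qed
  fix x assume "x \<in> range (antisymmetrizer q \<sigma>)"
  then obtain p where p: "x = antisymmetrizer q \<sigma> p" by blast
  have "p \<in> lspan free_algebra (range basis_vec)" using free_algebra_lspan by auto
  then have "antisymmetrizer q \<sigma> p \<in> qext_carrier q \<sigma>"
  proof induction
    case lspan_zero
    \<comment> \<open>Zero is not among the introduction rules of \<open>qext_carrier\<close>; it
      arises as a multiple of the unit.\<close>
    have "cscale 0 1 \<in> qext_carrier q \<sigma>" by (intro qext_carrier.scale qext_carrier.one)
    then show ?case by (simp add: lin_end_zero[OF lin_end_antisym])
  qed (auto simp: word lin_end_add[OF lin_end_antisym] lin_end_cscale[OF lin_end_antisym]
      intro: qext_carrier.intros)
  then show "x \<in> qext_carrier q \<sigma>" by (simp add: p)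
qed

lemma complex_algebra_qext: "complex_algebra (qext q \<sigma>)"
  by (rule complex_algebra_image[OF complex_algebra_free, where f = "antisymmetrizer q \<sigma>"])
    (simp_all add: qext_def qext_carrier_eq lin_end_add[OF lin_end_antisym] lin_end_zero[OF lin_end_antisym]
      lin_end_cscale[OF lin_end_antisym] qshuffle_antisym antisym_one)

end

section \<open>The coaction\<close>

lemma words_mid_bij:
  "bij_betw (\<lambda>((a, b), ms). a @ ms @ b) ((words m \<times> words n) \<times> words k) (words (m + (k + n)))"
  by (rule bij_betw_byWitness[where f' = "\<lambda>w. ((take m w, drop (m + k) w), take k (drop m w))"])
    (auto simp: add.commute simp flip: drop_drop)

lemma finsum_words_mid:
  assumes "cvs P" "\<And>w. length w = m + (k + n) \<Longrightarrow> f w \<in> carrier P"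
  shows "finsum P f (words (m + (k + n)) :: ('i::finite) list set) =
    finsum P (\<lambda>p. finsum P (\<lambda>ms. f (fst p @ ms @ snd p)) (words k)) (words m \<times> words n)"
  using finsum_bij_Times[OF assms(1) words_mid_bij finite_cartesian_product[OF finite_words finite_words]
      finite_words, of m k n f] assms(2)
  by (simp add: case_prod_unfold)

context
  fixes \<sigma> :: "('i::finite) endo2"
begin

private abbreviation (input) "TV \<equiv> free_algebra :: (complex, 'i tensors) module"
private abbreviation (input) "FRT \<equiv> frt \<sigma>"
private abbreviation (input) "TVF \<equiv> tensor_vs TV FRT"

private lemma tens_T_closed [simp]: "h \<in> carrier FRT \<Longrightarrow> tens TV FRT x h \<in> carrier TVF"
  by (simp add: tens_closed)

lemma tensor_coaction_eq_lc:
  "tensor_coaction \<sigma> = lc TVF (\<lambda>is. finsum TVF (\<lambda>js. tens TV FRT (basis_vec js) (T_mono \<sigma> js is)) (words (length is)))"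
  by (simp add: fun_eq_iff tensor_coaction_def lc_def)

lemma clin_tensor_coaction: "clin TV TVF (tensor_coaction \<sigma>)"
  unfolding tensor_coaction_eq_lc clin_free_algebra
  by (rule cvs.clin_lc[OF cvs_tensor_vs]) (simp add: tensor_sum_closed)

lemma tensor_coaction_basis:
  "tensor_coaction \<sigma> (basis_vec is) = finsum TVF (\<lambda>js. tens TV FRT (basis_vec js) (T_mono \<sigma> js is)) (words (length is))"
  unfolding tensor_coaction_eq_lc
  by (rule cvs.lc_basis[OF cvs_tensor_vs]) (simp add: tensor_sum_closed)

lemma tensor_map_coaction_basis:
  assumes "clin TV M f"
  shows "tensor_map M FRT f (\<lambda>h. h) (tensor_coaction \<sigma> (basis_vec is)) =
    finsum (tensor_vs M FRT) (\<lambda>js. tens M FRT (f (basis_vec js)) (T_mono \<sigma> js is)) (words (length is))"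
proof -
  have "tensor_map M FRT f (\<lambda>h. h) (tensor_coaction \<sigma> (basis_vec is)) =
    finsum (tensor_vs M FRT) (\<lambda>js. tensor_map M FRT f (\<lambda>h. h) (tens TV FRT (basis_vec js) (T_mono \<sigma> js is))) (words (length is))"
    unfolding tensor_coaction_basis
    by (rule clin_finsum[OF cvs_tensor_vs cvs_tensor_vs clin_tensor_map[OF cvs_free_algebra cvs_frt assms clin_id]])
      simp
  also have "\<dots> = finsum (tensor_vs M FRT) (\<lambda>js. tens M FRT (f (basis_vec js)) (T_mono \<sigma> js is)) (words (length is))"
    by (intro tensor_sum_cong tens_closed)
      (simp_all add: tensor_map_tens[OF cvs_free_algebra cvs_frt assms clin_id] clin_closed[OF assms])
  finally show ?thesis .
qed

text \<open>Expresses that \<open>f\<close> restricts to a comodule endomorphism in degree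
  \<open>n\<close>. Linearity is asked on all of \<open>T(V)\<close>, since
  \<open>tensor_map\<close> is formed from \<open>f\<close> on the whole space.\<close>

definition equivariant :: "nat \<Rightarrow> ('i tensors \<Rightarrow> 'i tensors) \<Rightarrow> bool" where
  "equivariant n f \<longleftrightarrow> lin_end f \<and> (\<forall>x\<in>tensor_power n. f x \<in> tensor_power n \<and>
     tensor_coaction \<sigma> (f x) = tensor_map TV FRT f (\<lambda>h. h) (tensor_coaction \<sigma> x))"

private lemma coaction_closed [simp]: "tensor_coaction \<sigma> x \<in> carrier TVF"
  using clin_closed[OF clin_tensor_coaction] by simp

private lemma clin_map: "lin_end f \<Longrightarrow> clin TVF TVF (tensor_map TV FRT f (\<lambda>h. h))"
  by (rule clin_tensor_map[OF cvs_free_algebra cvs_frt _ clin_id])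

private lemma map_tens: "lin_end f \<Longrightarrow> h \<in> carrier FRT \<Longrightarrow> tensor_map TV FRT f (\<lambda>h. h) (tens TV FRT x h) = tens TV FRT (f x) h"
  by (rule tensor_map_tens[OF cvs_free_algebra cvs_frt _ clin_id]) simp_all

private lemmas map_ext = tensor_map_unique[OF cvs_free_algebra cvs_frt cvs_tensor_vs _ _
  order.refl lspan_carrier order.refl lspan_carrier]

lemma equivariantI:
  assumes f: "lin_end f" and "\<And>w. length w = n \<Longrightarrow> f (basis_vec w) \<in> tensor_power n"
    and "\<And>w. length w = n \<Longrightarrow> tensor_coaction \<sigma> (f (basis_vec w)) =
      finsum TVF (\<lambda>js. tens TV FRT (f (basis_vec js)) (T_mono \<sigma> js w)) (words n)"
  shows "equivariant n f"
  unfolding equivariant_def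
proof (intro conjI ballI)
  fix x :: "'i tensors" assume x: "x \<in> tensor_power n"
  show "f x \<in> tensor_power n" by (rule lin_end_tensor_power[OF f x assms(2)])
  show "tensor_coaction \<sigma> (f x) = tensor_map TV FRT f (\<lambda>h. h) (tensor_coaction \<sigma> x)"
    by (rule tensor_power_ext[OF cvs_tensor_vs clin_comp[OF f clin_tensor_coaction]
          clin_comp[OF clin_tensor_coaction clin_map[OF f]] x])
      (simp add: assms(3) tensor_map_coaction_basis[OF f])
qed (rule f)

lemma equivariant_id: "equivariant n (\<lambda>x. x)"
  by (rule equivariantI) (simp_all add: clin_id tensor_coaction_basis)

lemma equivariant_comp:
  assumes "equivariant n f" "equivariant n g"
  shows "equivariant n (\<lambda>x. f (g x))"
proof -
  have f: "lin_end f" and g: "lin_end g" using assms by (auto simp: equivariant_def)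
  have fg: "lin_end (\<lambda>x. f (g x))" by (rule clin_comp[OF g f])
  have "tensor_map TV FRT (\<lambda>x. f (g x)) (\<lambda>h. h) X = tensor_map TV FRT f (\<lambda>h. h) (tensor_map TV FRT g (\<lambda>h. h) X)"
    if "X \<in> carrier TVF" for X
    by (rule map_ext[OF clin_map[OF fg] clin_comp[OF clin_map[OF g] clin_map[OF f]] _ that])
      (simp add: map_tens f g fg)
  then show ?thesis using assms fg by (simp add: equivariant_def)
qed

lemma equivariant_cscale:
  assumes "equivariant n f"
  shows "equivariant n (\<lambda>x. cscale c (f x))"
proof -
  have f: "lin_end f" using assms by (auto simp: equivariant_def)
  have cf: "lin_end (\<lambda>x. cscale c (f x))" by (rule lin_end_cscale_fun[OF f])
  have "tensor_map TV FRT (\<lambda>x. cscale c (f x)) (\<lambda>h. h) X = c \<odot>\<^bsub>TVF\<^esub> tensor_map TV FRT f (\<lambda>h. h) X"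
    if "X \<in> carrier TVF" for X
    by (rule map_ext[OF clin_map[OF cf] cvs.clin_smult_fun[OF cvs_tensor_vs clin_map[OF f]] _ that])
      (use tens_smult_left[of _ TV _ FRT] in \<open>simp add: map_tens f cf\<close>)
  then show ?thesis
    using assms cf clin_smult[OF clin_tensor_coaction] by (simp add: equivariant_def tensor_power_cscale)
qed

lemma equivariant_add:
  assumes "equivariant n f" "equivariant n g"
  shows "equivariant n (\<lambda>x. f x + g x)"
proof -
  have f: "lin_end f" and g: "lin_end g" using assms by (auto simp: equivariant_def)
  have fg: "lin_end (\<lambda>x. f x + g x)" using cvs.clin_add_fun[OF cvs_free_algebra f g] by simp
  have "tensor_map TV FRT (\<lambda>x. f x + g x) (\<lambda>h. h) X =
      tensor_map TV FRT f (\<lambda>h. h) X \<oplus>\<^bsub>TVF\<^esub> tensor_map TV FRT g (\<lambda>h. h) X"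
    if "X \<in> carrier TVF" for X
    by (rule map_ext[OF clin_map[OF fg] cvs.clin_add_fun[OF cvs_tensor_vs clin_map[OF f] clin_map[OF g]] _ that])
      (use tens_add_left[of _ TV _ _ FRT] in \<open>simp add: map_tens f g fg\<close>)
  then show ?thesis
    using assms fg clin_add[OF clin_tensor_coaction] by (simp add: equivariant_def tensor_power_add)
qed

lemma equivariant_zero: "equivariant n (\<lambda>x. 0)"
proof -
  have "equivariant n (\<lambda>x. cscale 0 x)" by (rule equivariant_cscale[OF equivariant_id])
  then show ?thesis by simp
qed

lemma equivariant_sum: "(\<And>a. a \<in> A \<Longrightarrow> equivariant n (f a)) \<Longrightarrow> equivariant n (\<lambda>x. \<Sum>a\<in>A. f a x)"
  by (induction A rule: infinite_finite_induct) (simp_all add: equivariant_zero equivariant_add)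

text \<open>Multiplying by the monomials of the letters to the left and to the right is a linear map
  \<open>L\<close> on the FRT algebra, so the relation for the two middle letters can be pushed
  through it; the dependence on upper indices sits in the basis vector.\<close>

private lemma relation_sandwich:
  assumes "length is = 2" "length u = length a" "length v = length b"
  shows "finsum TVF (\<lambda>ks. coef_word \<sigma> is ks \<odot>\<^bsub>TVF\<^esub>
        finsum TVF (\<lambda>ms. tens TV FRT (basis_vec (a @ ms @ b)) (T_mono \<sigma> (a @ ms @ b) (u @ ks @ v))) (words 2)) (words 2) =
    finsum TVF (\<lambda>ms. tens TV FRT (\<Sum>ks\<in>words 2. cscale (coef_word \<sigma> ms ks) (basis_vec (a @ ks @ b)))
        (T_mono \<sigma> (a @ ms @ b) (u @ is @ v))) (words 2)"
proof -
  interpret TVF: cvs TVF by (rule cvs_tensor_vs)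
  note mb = bilin_mult[OF complex_algebra_frt[of \<sigma>]]
  define L where "L = (\<lambda>h. T_mono \<sigma> a u \<otimes>\<^bsub>FRT\<^esub> (h \<otimes>\<^bsub>FRT\<^esub> T_mono \<sigma> b v))"
  have L: "clin FRT FRT L"
    unfolding L_def by (rule clin_comp[OF bilinD2[OF mb] bilinD1[OF mb]]) simp_all
  have TL: "T_mono \<sigma> (a @ ms @ b) (u @ ks @ v) = L (T_mono \<sigma> ms ks)"
    if "length ms = length ks" for ms ks
    using that assms by (simp add: L_def T_mono_append)
  have K: "clin FRT TVF (\<lambda>h. tens TV FRT x (L h))" for x
    by (rule clin_comp[OF L bilinD1[OF bilin_tens]]) simp
  have Lc [simp]: "L h \<in> carrier FRT" if "h \<in> carrier FRT" for h by (rule clin_closed[OF L that])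
  have "finsum TVF (\<lambda>ks. coef_word \<sigma> is ks \<odot>\<^bsub>TVF\<^esub>
        finsum TVF (\<lambda>ms. tens TV FRT (basis_vec (a @ ms @ b)) (T_mono \<sigma> (a @ ms @ b) (u @ ks @ v))) (words 2)) (words 2) =
      finsum TVF (\<lambda>ks. coef_word \<sigma> is ks \<odot>\<^bsub>TVF\<^esub>
        finsum TVF (\<lambda>ms. tens TV FRT (basis_vec (a @ ms @ b)) (L (T_mono \<sigma> ms ks))) (words 2)) (words 2)"
    by (intro tensor_sum_cong arg_cong2[where f = "smult TVF"] refl)
      (simp_all add: TL tensor_sum_closed)
  also have "\<dots> = finsum TVF (\<lambda>ks. finsum TVF (\<lambda>ms. coef_word \<sigma> ks ms \<odot>\<^bsub>TVF\<^esub>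
      tens TV FRT (basis_vec (a @ ms @ b)) (L (T_mono \<sigma> ks is))) (words 2)) (words 2)"
    by (rule frt_exchange[OF cvs_tensor_vs K assms(1)])
  also have "\<dots> = finsum TVF (\<lambda>ms. tens TV FRT (\<Sum>ks\<in>words 2. cscale (coef_word \<sigma> ms ks) (basis_vec (a @ ks @ b)))
        (T_mono \<sigma> (a @ ms @ b) (u @ is @ v))) (words 2)"
  proof (rule tensor_sum_cong)
    fix ks :: "'i list" assume ks: "ks \<in> words 2"
    have S: "clin TV TVF (\<lambda>x. tens TV FRT x (L (T_mono \<sigma> ks is)))"
      by (rule bilinD2[OF bilin_tens]) simp
    show "finsum TVF (\<lambda>ms. coef_word \<sigma> ks ms \<odot>\<^bsub>TVF\<^esub> tens TV FRT (basis_vec (a @ ms @ b)) (L (T_mono \<sigma> ks is))) (words 2) =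
      tens TV FRT (\<Sum>ms\<in>words 2. cscale (coef_word \<sigma> ks ms) (basis_vec (a @ ms @ b))) (T_mono \<sigma> (a @ ks @ b) (u @ is @ v))"
      using ks assms(1) clin_smult[OF S] by (simp add: TL clin_sum[OF cvs_tensor_vs S] del: cscale_single)
  qed simp
  finally show ?thesis .
qed

text \<open>For each choice \<open>p\<close> of the upper indices away from positions
  \<open>r\<close> and \<open>r + 1\<close>, the claim is the FRT relation for the two middle
  letters, multiplied by monomials on both sides.\<close>

lemma equivariant_braid_at:
  assumes "r \<in> {1..<n}"
  shows "equivariant n (braid_at \<sigma> r)"
proof (rule equivariantI[OF lin_end_braid_at])
  interpret TVF: cvs TVF by (rule cvs_tensor_vs)
  fix w :: "'i list" assume n: "length w = n"
  then show "braid_at \<sigma> r (basis_vec w) \<in> tensor_power n" by (intro braid_at_closed assms) simp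
  from word_split_at[OF assms n] obtain u "is" v
    where w: "w = u @ is @ v" "length is = 2" "r = Suc (length u)" "length v = n - r - 1" .
  have n': "n = length u + (2 + length v)" using n w by simp
  let ?P = "words (length u) \<times> words (length v) :: ('i list \<times> 'i list) set"
  let ?g = "\<lambda>p ms ks. tens TV FRT (basis_vec (fst p @ ms @ snd p)) (T_mono \<sigma> (fst p @ ms @ snd p) (u @ ks @ v))"
  have finP: "finite ?P" by simp
  have "tensor_coaction \<sigma> (braid_at \<sigma> r (basis_vec w)) =
      finsum TVF (\<lambda>ks. coef_word \<sigma> is ks \<odot>\<^bsub>TVF\<^esub> tensor_coaction \<sigma> (basis_vec (u @ ks @ v))) (words 2)"
    unfolding w(1,3) braid_at_basis[OF w(2)]
    using clin_smult[OF clin_tensor_coaction]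
    by (simp add: clin_sum[OF cvs_tensor_vs clin_tensor_coaction] del: cscale_single)
  \<comment> \<open>Upper words are written as \<open>fst p @ ms @ snd p\<close>. Once the sum over
    \<open>p\<close> is moved outside, the inner sums involve only the middle letters.\<close>
  also have "\<dots> = finsum TVF (\<lambda>ks. finsum TVF (\<lambda>p. coef_word \<sigma> is ks \<odot>\<^bsub>TVF\<^esub> finsum TVF (\<lambda>ms. ?g p ms ks) (words 2)) ?P) (words 2)"
  proof (rule tensor_sum_cong)
    fix ks :: "'i list" assume "ks \<in> words 2"
    then have "tensor_coaction \<sigma> (basis_vec (u @ ks @ v)) = finsum TVF (\<lambda>p. finsum TVF (\<lambda>ms. ?g p ms ks) (words 2)) ?P"
      unfolding tensor_coaction_basis using finsum_words_mid[OF cvs_tensor_vs, of "length u" 2 "length v"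
          "\<lambda>t. tens TV FRT (basis_vec t) (T_mono \<sigma> t (u @ ks @ v))" TV FRT] by simp
    then show "coef_word \<sigma> is ks \<odot>\<^bsub>TVF\<^esub> tensor_coaction \<sigma> (basis_vec (u @ ks @ v)) =
        finsum TVF (\<lambda>p. coef_word \<sigma> is ks \<odot>\<^bsub>TVF\<^esub> finsum TVF (\<lambda>ms. ?g p ms ks) (words 2)) ?P"
      by (simp add: TVF.smult_finsum tensor_sum_closed)
  qed (simp add: tensor_sum_closed)
  also have "\<dots> = finsum TVF (\<lambda>p. finsum TVF (\<lambda>ks. coef_word \<sigma> is ks \<odot>\<^bsub>TVF\<^esub> finsum TVF (\<lambda>ms. ?g p ms ks) (words 2)) (words 2)) ?P"
    by (rule finsum_swap[OF cvs_tensor_vs]) (simp_all add: tensor_sum_closed)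
  also have "\<dots> = finsum TVF (\<lambda>p. finsum TVF (\<lambda>ms. tens TV FRT (braid_at \<sigma> r (basis_vec (fst p @ ms @ snd p)))
      (T_mono \<sigma> (fst p @ ms @ snd p) w)) (words 2)) ?P"
  proof (rule tensor_sum_cong)
    fix p assume p: "p \<in> ?P"
    then have len: "length u = length (fst p)" "length v = length (snd p)" by auto
    have "finsum TVF (\<lambda>ks. coef_word \<sigma> is ks \<odot>\<^bsub>TVF\<^esub> finsum TVF (\<lambda>ms. ?g p ms ks) (words 2)) (words 2) =
      finsum TVF (\<lambda>ms. tens TV FRT (\<Sum>ks\<in>words 2. cscale (coef_word \<sigma> ms ks) (basis_vec (fst p @ ks @ snd p)))
        (T_mono \<sigma> (fst p @ ms @ snd p) (u @ is @ v))) (words 2)"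
      by (rule relation_sandwich[OF w(2) len])
    also have "\<dots> = finsum TVF (\<lambda>ms. tens TV FRT (braid_at \<sigma> r (basis_vec (fst p @ ms @ snd p)))
      (T_mono \<sigma> (fst p @ ms @ snd p) w)) (words 2)"
      by (rule tensor_sum_cong)
        (simp_all add: w(1,3) len(1) braid_at_basis del: cscale_single)
    finally show "finsum TVF (\<lambda>ks. coef_word \<sigma> is ks \<odot>\<^bsub>TVF\<^esub> finsum TVF (\<lambda>ms. ?g p ms ks) (words 2)) (words 2) = \<dots>" .
  qed (simp add: tensor_sum_closed)
  also have "\<dots> = finsum TVF (\<lambda>js. tens TV FRT (braid_at \<sigma> r (basis_vec js)) (T_mono \<sigma> js w)) (words n)"
    unfolding n' by (rule finsum_words_mid[OF cvs_tensor_vs, symmetric]) simp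
  finally show "tensor_coaction \<sigma> (braid_at \<sigma> r (basis_vec w)) = \<dots>" .
qed

lemma equivariant_braid_word: "set rs \<subseteq> {1..<n} \<Longrightarrow> equivariant n (braid_word \<sigma> rs)"
proof (induction rs)
  case Nil
  have "braid_word \<sigma> [] = (\<lambda>x. x)" by (simp add: fun_eq_iff)
  then show ?case by (simp add: equivariant_id)
next
  case (Cons r rs)
  have "braid_word \<sigma> (r # rs) = (\<lambda>x. braid_at \<sigma> r (braid_word \<sigma> rs x))" by (simp add: fun_eq_iff)
  then show ?case using Cons equivariant_comp[OF equivariant_braid_at[of r n]] by simp
qed

lemma equivariant_braid_perm:
  assumes "w permutes {1..n}"
  shows "equivariant n (braid_perm \<sigma> n w)"
proof -
  have "reduced_word n w (SOME rs. reduced_word n w rs)"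
    by (rule someI_ex) (rule exists_reduced_word[OF assms(1)])
  then show ?thesis unfolding braid_perm_def
    by (intro equivariant_braid_word) (rule reduced_word_set)
qed

lemma equivariant_qantisym: "equivariant n (qantisym q \<sigma> n)"
proof -
  have "equivariant n (\<lambda>x. qantisym q \<sigma> n x)"
    unfolding qantisym_def by (intro equivariant_cscale equivariant_sum equivariant_braid_perm) simp
  then show ?thesis .
qed

text \<open>The formula of the theorem, with left tensor factors still regarded as elements of
  \<open>T(V)\<close>.\<close>

lemma tensor_coaction_antisym:
  "tensor_coaction \<sigma> (antisymmetrizer q \<sigma> (basis_vec is)) =
    finsum TVF (\<lambda>js. tens TV FRT (antisymmetrizer q \<sigma> (basis_vec js)) (T_mono \<sigma> js is)) (words (length is))"
proof -
  have "tensor_coaction \<sigma> (qantisym q \<sigma> (length is) (basis_vec is)) =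
      tensor_map TV FRT (qantisym q \<sigma> (length is)) (\<lambda>h. h) (tensor_coaction \<sigma> (basis_vec is))"
    using equivariant_qantisym[of "length is" q] by (simp add: equivariant_def)
  also have "\<dots> = finsum TVF (\<lambda>js. tens TV FRT (qantisym q \<sigma> (length is) (basis_vec js)) (T_mono \<sigma> js is)) (words (length is))"
    by (rule tensor_map_coaction_basis[OF lin_end_qantisym])
  also have "\<dots> = finsum TVF (\<lambda>js. tens TV FRT (antisymmetrizer q \<sigma> (basis_vec js)) (T_mono \<sigma> js is)) (words (length is))"
    by (intro tensor_sum_cong) (simp_all add: antisym_basis)
  finally show ?thesis by (simp add: antisym_basis)
qed

end

section \<open>The comodule algebra structure on the quantum exterior algebra\<close>

lemma complex_subspace_retraction:
  fixes S :: "('a \<Rightarrow>\<^sub>0 complex) set"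
  assumes "pm.subspace S"
  obtains r where "range r \<subseteq> S" "\<And>x y. r (x + y) = r x + r y" "\<And>c x. r (cscale c x) = cscale c (r x)"
    "\<And>x. x \<in> S \<Longrightarrow> r x = x"
proof -
  interpret vector_space_pair "cscale :: complex \<Rightarrow> ('a \<Rightarrow>\<^sub>0 complex) \<Rightarrow> _" cscale
    by (rule vector_space_pair.intro[OF pm.vector_space_axioms pm.vector_space_axioms])
  have "Vector_Spaces.linear cscale cscale (id :: ('a \<Rightarrow>\<^sub>0 complex) \<Rightarrow> _)"
    by (rule pm.linear_id)
  \<comment> \<open>A linear left inverse of the identity on \<open>S\<close> with values in
    \<open>S\<close> is a projection onto \<open>S\<close>.\<close>
  from linear_exists_left_inverse_on[OF this assms] obtain r
    where "range r \<subseteq> S" "Vector_Spaces.linear cscale cscale r" "\<forall>x\<in>S. r (id x) = x" by auto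
  then show ?thesis using that[of r] by (auto simp: Vector_Spaces.linear_iff)
qed

text \<open>The second conjunct identifies \<open>\<delta>\<close> with the restriction of the
  tensor coaction. The comparison takes place after mapping to
  \<open>T(V) \<otimes> \<A>(\<sigma>)\<close>, because \<open>\<delta>\<close> takes values in the
  tensor product formed with the exterior algebra itself.\<close>

theorem corollary4p3:
  fixes \<sigma> :: "('i::finite) endo2" and q :: complex
  assumes "q \<noteq> 0"
    and "\<forall>n\<ge>1. (q powi (-2)) ^ n \<noteq> 1"
    and "braiding \<sigma>"
  shows "\<exists>\<delta>. right_comodule_algebra (frt \<sigma>) (frt_coproduct \<sigma>) (frt_counit \<sigma>) (qext q \<sigma>) \<delta> \<and>
    (\<forall>x\<in>carrier (qext q \<sigma>).
       tensor_map free_algebra (frt \<sigma>) (\<lambda>y. y) (\<lambda>h. h) (\<delta> x) = tensor_coaction \<sigma> x) \<and>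
    (\<forall>k is. length is = k \<longrightarrow>
       \<delta> (qantisym q \<sigma> k (basis_vec is)) =
       finsum (tensor_vs (qext q \<sigma>) (frt \<sigma>))
         (\<lambda>js. tens (qext q \<sigma>) (frt \<sigma>) (qantisym q \<sigma> k (basis_vec js)) (T_mono \<sigma> js is))
         {js. length js = k})"
proof -
  define E where "E = qext q \<sigma>"
  define A where "A = (\<lambda>w. antisymmetrizer q \<sigma> (basis_vec w))"
  let ?F = "free_algebra :: (complex, 'i tensors) module"
  let ?H = "frt \<sigma>"
  let ?T = "tensor_vs ?F ?H" and ?EH = "tensor_vs E ?H"
  let ?\<rho> = "tensor_coaction \<sigma>"
  have E: "complex_algebra E" unfolding E_def by (rule complex_algebra_qext[OF assms])
  note H = complex_algebra_frt[of \<sigma>]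
  note cE = complex_algebra_cvs[OF E] and cH = cvs_frt[of \<sigma>] and cF = cvs_free_algebra and cT = cvs_tensor_vs
  interpret E: cvs E by (rule cE)
  interpret EH: cvs ?EH by (rule cT)
  have E_simps: "carrier E = range (antisymmetrizer q \<sigma>)" "mult E = qshuffle q \<sigma>" "one E = 1"
      "zero E = 0" "add E = (+)" "smult E = cscale"
    by (simp_all add: E_def qext_def qext_carrier_eq[OF assms])
  have incl: "clin E ?F (\<lambda>y. y)" by (rule clinI) (simp_all add: E_simps)
  have proj: "clin ?F E (antisymmetrizer q \<sigma>)"
    by (rule clinI) (simp_all add: E_simps lin_end_add[OF lin_end_antisym] lin_end_cscale[OF lin_end_antisym])
  have A_closed [simp]: "A w \<in> carrier E" for w by (simp add: A_def E_simps)
  have A_span: "carrier E \<subseteq> lspan E (range A)"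
  proof
    fix x assume "x \<in> carrier E"
    then obtain p where p: "x = antisymmetrizer q \<sigma> p" by (auto simp: E_simps)
    have "antisymmetrizer q \<sigma> p \<in> lspan E (antisymmetrizer q \<sigma> ` range basis_vec)"
      by (rule clin_image_lspan[OF cF cE proj]) (use free_algebra_lspan in auto)
    then show "x \<in> lspan E (range A)" by (simp add: p A_def image_image)
  qed
  have E_ext: "f x = g x"
    if "cvs P" "clin E P f" "clin E P g" "\<And>w. f (A w) = g (A w)" "x \<in> carrier E"
    for P :: "(complex, 'z) module" and f g x
    by (rule clin_eq_on_lspan[OF cE that(1-3), where S = "range A"]) (use that A_span in auto)
  have A_mult: "A u \<otimes>\<^bsub>E\<^esub> A v = A (u @ v)" for u v
    by (simp add: A_def E_simps qshuffle_antisym[OF assms] basis_mult)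
  \<comment> \<open>The tensor coaction takes values in \<open>T(V) \<otimes> H\<close>; a linear retraction \<open>T(V) \<rightarrow> E\<close> moves them to
    \<open>E \<otimes> H\<close>, so that injectivity of \<open>E \<otimes> H \<rightarrow> T(V) \<otimes> H\<close> is not needed.\<close>
  have "pm.subspace (carrier E)"
    using E.a_closed E.smult_closed E.zero_closed by (simp add: pm.subspace_def E_simps)
  from complex_subspace_retraction[OF this] obtain r where r: "range r \<subseteq> carrier E" "\<And>x y. r (x + y) = r x + r y"
      "\<And>c x. r (cscale c x) = cscale c (r x)" "\<And>x. x \<in> carrier E \<Longrightarrow> r x = x"
    by (metis (no_types))
  have r_lin: "clin ?F E r" by (rule clinI) (use r in \<open>auto simp: E_simps\<close>)
  define \<delta> where "\<delta> = (\<lambda>x. tensor_map E ?H r (\<lambda>h. h) (?\<rho> x))"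
  have map_r: "clin ?T ?EH (tensor_map E ?H r (\<lambda>h. h))"
    by (rule clin_tensor_map[OF cF cH r_lin clin_id])
  have \<delta>_lin: "clin E ?EH \<delta>"
    unfolding \<delta>_def by (rule clin_comp[OF clin_comp[OF incl clin_tensor_coaction] map_r])
  \<comment> \<open>All left factors \<open>A js\<close> lie in \<open>E\<close>, where
    \<open>r\<close> is the identity, so \<open>r\<close> changes only the tensor product in which
    the sum is formed.\<close>
  have \<delta>_A: "\<delta> (A w) = finsum ?EH (\<lambda>js. tens E ?H (A js) (T_mono \<sigma> js w)) (words (length w))" for w
  proof -
    have "\<delta> (A w) = finsum ?EH (\<lambda>js. tensor_map E ?H r (\<lambda>h. h) (tens ?F ?H (A js) (T_mono \<sigma> js w))) (words (length w))"
      unfolding \<delta>_def A_def tensor_coaction_antisym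
      by (rule clin_finsum[OF cT cT map_r]) (simp add: tens_closed)
    also have "\<dots> = finsum ?EH (\<lambda>js. tens E ?H (A js) (T_mono \<sigma> js w)) (words (length w))"
      by (rule tensor_sum_cong)
        (simp_all add: tensor_map_tens[OF cF cH r_lin clin_id] r(4) tens_closed)
    finally show ?thesis .
  qed
  have bil_EH: "bilin E E ?EH (\<lambda>x y. \<delta> (x \<otimes>\<^bsub>E\<^esub> y))"
    by (rule bilin_comp_left[OF bilin_mult[OF E] \<delta>_lin])
  have bil_EH': "bilin E E ?EH (\<lambda>x y. \<delta> x \<otimes>\<^bsub>tensor_alg E ?H\<^esub> \<delta> y)"
    using bilin_comp[OF bilin_mult[OF complex_algebra_tensor[OF E H]], of E \<delta> E \<delta>] \<delta>_lin
    by (simp add: bilin_def)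
  \<comment> \<open>Both sides are bilinear, so antisymmetrized words suffice. For these, pairs of
    upper words are the same as upper words of the concatenation, and the matrix entries multiply
    accordingly.\<close>
  have \<delta>_mult: "\<delta> (x \<otimes>\<^bsub>E\<^esub> y) = \<delta> x \<otimes>\<^bsub>tensor_alg E ?H\<^esub> \<delta> y" if x: "x \<in> carrier E" and y: "y \<in> carrier E" for x y
  proof (rule E_ext[OF cT bilinD2[OF bil_EH y] bilinD2[OF bil_EH' y] _ x])
    fix u
    show "\<delta> (A u \<otimes>\<^bsub>E\<^esub> y) = \<delta> (A u) \<otimes>\<^bsub>tensor_alg E ?H\<^esub> \<delta> y"
    proof (rule E_ext[OF cT bilinD1[OF bil_EH A_closed] bilinD1[OF bil_EH' A_closed] _ y])
      fix v
      have "\<delta> (A u) \<otimes>\<^bsub>tensor_alg E ?H\<^esub> \<delta> (A v) = finsum ?EH (\<lambda>a. finsum ?EH (\<lambda>b.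
          tens E ?H (A a \<otimes>\<^bsub>E\<^esub> A b) (T_mono \<sigma> a u \<otimes>\<^bsub>?H\<^esub> T_mono \<sigma> b v)) (words (length v))) (words (length u))"
        unfolding \<delta>_A by (rule tensor_mult_finsum[OF E H]) simp_all
      also have "\<dots> = finsum ?EH (\<lambda>a. finsum ?EH (\<lambda>b.
          tens E ?H (A (a @ b)) (T_mono \<sigma> (a @ b) (u @ v))) (words (length v))) (words (length u))"
      proof (rule tensor_sum_cong)
        fix a :: "'i list" assume "a \<in> words (length u)"
        then show "finsum ?EH (\<lambda>b. tens E ?H (A a \<otimes>\<^bsub>E\<^esub> A b) (T_mono \<sigma> a u \<otimes>\<^bsub>?H\<^esub> T_mono \<sigma> b v)) (words (length v)) =
          finsum ?EH (\<lambda>b. tens E ?H (A (a @ b)) (T_mono \<sigma> (a @ b) (u @ v))) (words (length v))"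
          by (intro tensor_sum_cong) (simp_all add: A_mult tens_closed flip: T_mono_append)
      qed (simp add: tensor_sum_closed tens_closed)
      also have "\<dots> = \<delta> (A (u @ v))"
        unfolding \<delta>_A length_append by (rule finsum_words_add[OF cT, symmetric]) (simp add: tens_closed)
      finally show "\<delta> (A u \<otimes>\<^bsub>E\<^esub> A v) = \<delta> (A u) \<otimes>\<^bsub>tensor_alg E ?H\<^esub> \<delta> (A v)" by (simp add: A_mult)
    qed
  qed
  have A_Nil: "A [] = 1" by (simp add: A_def antisym_one[OF assms] flip: one_eq_basis)
  have \<delta>_one: "\<delta> 1 = tens E ?H \<one>\<^bsub>E\<^esub> \<one>\<^bsub>?H\<^esub>"
  proof -
    have "words 0 = {[] :: 'i list}" by auto
    moreover have "tens E ?H (A []) (T_mono \<sigma> [] []) \<in> carrier ?EH" by (rule tens_closed) simp_all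
    ultimately have "\<delta> (A []) = tens E ?H (A []) (T_mono \<sigma> [] [])"
      by (simp add: \<delta>_A EH.finsum_insert)
    then show ?thesis by (simp add: A_Nil T_mono_Nil E_simps)
  qed
  have "right_comodule_algebra ?H (frt_coproduct \<sigma>) (frt_counit \<sigma>) E \<delta>"
  proof (rule right_comodule_algebra.intro[OF frt_bialgebra E], unfold_locales)
    show "\<delta> \<in> alg_hom E (tensor_alg E ?H)"
      unfolding alg_hom_def ring_hom_def
      using clin_closed[OF \<delta>_lin] clin_add[OF \<delta>_lin] clin_smult[OF \<delta>_lin] \<delta>_mult \<delta>_one
      by (auto simp: tensor_alg_simps E_simps(3))
    fix x assume x: "x \<in> carrier E"
    note D = clin_frt_coproduct[of \<sigma>]
    have e: "clin ?H complex_alg (frt_counit \<sigma>)" by (rule alg_hom_clin[OF frt_counit_hom])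
    have br: "bilin E ?H E (\<lambda>y h. frt_counit \<sigma> h \<odot>\<^bsub>E\<^esub> y)" by (rule bilin_counit_right[OF cE e])
    show "tensor_assoc E ?H ?H (tensor_map (tensor_alg E ?H) ?H \<delta> (\<lambda>h. h) (\<delta> x)) =
        tensor_map E (tensor_alg ?H ?H) (\<lambda>y. y) (frt_coproduct \<sigma>) (\<delta> x)"
    proof (rule E_ext[OF cT _ _ _ x])
      show "clin E (tensor_vs E (tensor_alg ?H ?H))
          (\<lambda>x. tensor_assoc E ?H ?H (tensor_map (tensor_alg E ?H) ?H \<delta> (\<lambda>h. h) (\<delta> x)))"
        by (rule clin_comp[OF \<delta>_lin clin_comp[OF clin_tensor_map[OF cE cH] clin_tensor_assoc[OF cE cH cH]]])
          (simp_all add: \<delta>_lin clin_id)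
      show "clin E (tensor_vs E (tensor_alg ?H ?H))
          (\<lambda>x. tensor_map E (tensor_alg ?H ?H) (\<lambda>y. y) (frt_coproduct \<sigma>) (\<delta> x))"
        by (rule clin_comp[OF \<delta>_lin clin_tensor_map[OF cE cH]]) (simp_all add: D clin_id)
      show "tensor_assoc E ?H ?H (tensor_map (tensor_alg E ?H) ?H \<delta> (\<lambda>h. h) (\<delta> (A w))) =
        tensor_map E (tensor_alg ?H ?H) (\<lambda>y. y) (frt_coproduct \<sigma>) (\<delta> (A w))" for w
        by (rule matrix_coassoc[OF cE cH _ _ _ _ \<delta>_lin D, where a = A and I = "words (length w)" and b = "T_mono \<sigma>"])
          (simp_all add: \<delta>_A frt_coproduct_T_mono)
    qed
    show "tensor_lift E (\<lambda>y h. frt_counit \<sigma> h \<odot>\<^bsub>E\<^esub> y) (\<delta> x) = x"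
    proof (rule E_ext[OF cE clin_comp[OF \<delta>_lin clin_tensor_lift[OF cE cH cE br]] clin_id _ x])
      show "tensor_lift E (\<lambda>y h. frt_counit \<sigma> h \<odot>\<^bsub>E\<^esub> y) (\<delta> (A w)) = A w" for w
        by (rule matrix_counit[OF cE cH _ _ _ _ br cE, where a = A and I = "words (length w)" and b = "T_mono \<sigma>" and f = A])
          (simp_all add: \<delta>_A frt_counit_T_mono)
    qed
  qed
  moreover have "tensor_map ?F ?H (\<lambda>y. y) (\<lambda>h. h) (\<delta> x) = ?\<rho> x" if x: "x \<in> carrier E" for x
  proof (rule E_ext[OF cT _ _ _ x])
    have restr: "clin ?EH ?T (tensor_map ?F ?H (\<lambda>y. y) (\<lambda>h. h))"
      by (rule clin_tensor_map[OF cE cH incl clin_id])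
    show "clin E ?T (\<lambda>x. tensor_map ?F ?H (\<lambda>y. y) (\<lambda>h. h) (\<delta> x))"
      by (rule clin_comp[OF \<delta>_lin restr])
    show "clin E ?T ?\<rho>" by (rule clin_comp[OF incl clin_tensor_coaction])
    fix w
    have "tensor_map ?F ?H (\<lambda>y. y) (\<lambda>h. h) (\<delta> (A w)) =
        finsum ?T (\<lambda>js. tensor_map ?F ?H (\<lambda>y. y) (\<lambda>h. h) (tens E ?H (A js) (T_mono \<sigma> js w))) (words (length w))"
      unfolding \<delta>_A by (rule clin_finsum[OF cT cT restr]) (simp add: tens_closed)
    also have "\<dots> = finsum ?T (\<lambda>js. tens ?F ?H (A js) (T_mono \<sigma> js w)) (words (length w))"
      by (rule tensor_sum_cong)
        (simp_all add: tensor_map_tens[OF cE cH incl clin_id] tens_closed)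
    also have "\<dots> = ?\<rho> (A w)" unfolding A_def by (rule tensor_coaction_antisym[symmetric])
    finally show "tensor_map ?F ?H (\<lambda>y. y) (\<lambda>h. h) (\<delta> (A w)) = ?\<rho> (A w)" .
  qed
  moreover have "\<delta> (qantisym q \<sigma> k (basis_vec is)) =
       finsum ?EH (\<lambda>js. tens E ?H (qantisym q \<sigma> k (basis_vec js)) (T_mono \<sigma> js is)) (words k)"
    if k: "length is = k" for k "is"
  proof -
    have "A js = qantisym q \<sigma> k (basis_vec js)" if "length js = k" for js
      using that by (auto simp: A_def antisym_basis)
    moreover have "\<delta> (A is) = finsum ?EH (\<lambda>js. tens E ?H (qantisym q \<sigma> k (basis_vec js)) (T_mono \<sigma> js is)) (words k)"
      unfolding \<delta>_A k by (rule tensor_sum_cong) (simp_all add: tens_closed flip: calculation)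
    ultimately show ?thesis using k by simp
  qed
  ultimately show ?thesis unfolding E_def by blast
qed

end
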